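(* Assume hypothesis (H) and assume that the positive equilibrium $K$ of the delay differential equation $u'(t)=-u(t)+g(u(t-h))$ is globally attracting. Then there exists $c_*>0$ with the following property. For every unit vector $\nu\in\mathbb{R}^m$ and every $c>c_*$, the equation $$u_t(t,x)=\Delta u(t,x)-u(t,x)+g(u(t-h,x)),\qquad t\in\mathbb{R},\ x\in\mathbb{R}^m,$$ has a positive travelling wave solution $u(t,x)=\phi_c(t+\nu\cdot x/c)$ (wave speed $c$), where $\phi_c:\mathbb{R}\to(0,\infty)$ satisfies $\phi_c(-\infty)=0$, $\phi_c(+\infty)=K$, and the profiles $\phi_c$ depend continuously on $c\in(c_*,\infty)$ with respect to the supremum norm on $\mathbb{R}$. Moreover, for each such $c$ there is $s_0=s_0(c)\in\mathbb{R}$ such that, as $s\to-\infty$, $$\phi_c(s-s_0)=e^{\lambda_1(c)s}+O(e^{2\lambda s}),\qquad \phi_c'(s-s_0)=\lambda_1(c)e^{\lambda_1(c)s}+O(e^{2\lambda s}),$$ and in particular $\phi_c'>0$ on some semi-axis $(-\infty,z]$. Finally, if in addition $g'(K)\,h\,e^{h+1}<-1$, then $c_*$ can be chosen so that, for every $c>c_*$, the profile $\phi_c$ oscillates about $K$ on every interval $[z,+\infty)$, i.e. for every $z\in\mathbb{R}$ the function $\phi_c-K$ takes both positive and negative values on $[z,+\infty)$.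
   Context: Let $h>0$ and $g:\mathbb{R}_+\to\mathbb{R}_+$, where $\mathbb{R}_+=[0,\infty)$. Hypothesis (H): the equation $u'(t)=-u(t)+g(u(t-h))$, $u\ge 0$, has exactly two constant solutions $u\equiv 0$ and $u\equiv K$ with $K>0$ (so $g(0)=0$, $g(K)=K$); the equilibrium $K$ is exponentially asymptotically stable and the equilibrium $0$ is hyperbolic; $g\in C^1(\mathbb{R}_+,\mathbb{R}_+)$, $g$ is $C^2$ in some neighbourhood of $0$ and of $K$, and $p:=g'(0)>1$. "Globally attracting" means every solution of $u'(t)=-u(t)+g(u(t-h))$ with nonnegative, not identically zero initial function on $[-h,0]$ converges to $K$ as $t\to+\infty$. $\lambda$ denotes the unique positive root of $-z-1+pe^{-zh}=0$, and for large $c$, $\lambda_1(c)$ denotes the minimal positive root of $(z/c)^2-z-1+pe^{-zh}=0$. *)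

theory Defs
  imports "HOL-Analysis.Analysis"
begin

definition dde_solution :: "(real \<Rightarrow> real) \<Rightarrow> real \<Rightarrow> (real \<Rightarrow> real) \<Rightarrow> (real \<Rightarrow> real) \<Rightarrow> bool" where
  "dde_solution g h phi u \<longleftrightarrow>
     (\<forall>t\<in>{-h..0}. u t = phi t) \<and> continuous_on {-h..} u \<and>
     (\<forall>t\<ge>0. (u has_real_derivative (- u t + g (u (t - h)))) (at t within {0..}))"

definition exp_asymp_stable :: "(real \<Rightarrow> real) \<Rightarrow> real \<Rightarrow> real \<Rightarrow> bool" where
  "exp_asymp_stable g h K \<longleftrightarrow>
     (\<exists>\<delta>>0. \<exists>M \<gamma>. \<gamma> > 0 \<and>
        (\<forall>phi u. continuous_on {-h..0} phi \<and> (\<forall>s\<in>{-h..0}. phi s \<ge> 0 \<and> \<bar>phi s - K\<bar> \<le> \<delta>)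
            \<and> dde_solution g h phi u \<longrightarrow>
            (\<forall>t\<ge>0. \<bar>u t - K\<bar> \<le> M * exp (- \<gamma> * t) * (SUP s\<in>{-h..0}. \<bar>phi s - K\<bar>))))"

text \<open>Hyperbolicity of the equilibrium a: the characteristic equation
  z + 1 - g'(a) e^{-zh} = 0 of the linearization has no root on the imaginary axis.\<close>
definition hyperbolic_equilibrium :: "(real \<Rightarrow> real) \<Rightarrow> real \<Rightarrow> real \<Rightarrow> bool" where
  "hyperbolic_equilibrium g' h a \<longleftrightarrow>
     (\<forall>z::complex. Re z = 0 \<longrightarrow> z + 1 - complex_of_real (g' a) * exp (- z * complex_of_real h) \<noteq> 0)"

definition globally_attracting :: "(real \<Rightarrow> real) \<Rightarrow> real \<Rightarrow> real \<Rightarrow> bool" where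
  "globally_attracting g h K \<longleftrightarrow>
     (\<forall>phi u. continuous_on {-h..0} phi \<and> (\<forall>s\<in>{-h..0}. phi s \<ge> 0) \<and> (\<exists>s\<in>{-h..0}. phi s \<noteq> 0)
        \<and> dde_solution g h phi u \<longrightarrow> (u \<longlongrightarrow> K) at_top)"

definition C2_near :: "(real \<Rightarrow> real) \<Rightarrow> real \<Rightarrow> bool" where
  "C2_near g a \<longleftrightarrow> (\<exists>\<epsilon>>0. \<exists>g1 g2. let S = {0..} \<inter> {a - \<epsilon> <..< a + \<epsilon>} in
      (\<forall>x\<in>S. (g has_real_derivative g1 x) (at x within S) \<and> (g1 has_real_derivative g2 x) (at x within S))
      \<and> continuous_on S g2)"

definition lam :: "real \<Rightarrow> real \<Rightarrow> real" where
  "lam p h = (THE z. z > 0 \<and> - z - 1 + p * exp (- z * h) = 0)"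

definition lam1 :: "real \<Rightarrow> real \<Rightarrow> real \<Rightarrow> real" where
  "lam1 p h c = (THE z. z > 0 \<and> (z / c)^2 - z - 1 + p * exp (- z * h) = 0 \<and>
                    (\<forall>w>0. (w / c)^2 - w - 1 + p * exp (- w * h) = 0 \<longrightarrow> z \<le> w))"

definition dir_second_deriv :: "('a::euclidean_space \<Rightarrow> real) \<Rightarrow> 'a \<Rightarrow> 'a \<Rightarrow> real \<Rightarrow> bool" where
  "dir_second_deriv f x b d \<longleftrightarrow>
     (\<exists>f1. (\<forall>r. ((\<lambda>s. f (x + s *\<^sub>R b)) has_real_derivative f1 r) (at r)) \<and> (f1 has_real_derivative d) (at 0))"

definition pde_solution :: "(real \<Rightarrow> real) \<Rightarrow> real \<Rightarrow> (real \<Rightarrow> 'a::euclidean_space \<Rightarrow> real) \<Rightarrow> bool" where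
  "pde_solution g h u \<longleftrightarrow>
     (\<forall>t x. \<exists>ut D. ((\<lambda>\<tau>. u \<tau> x) has_real_derivative ut) (at t) \<and>
        (\<forall>b\<in>Basis. dir_second_deriv (u t) x b (D b)) \<and>
        ut = (\<Sum>b\<in>Basis. D b) - u t x + g (u (t - h) x))"

end

theory Submission
  imports Defs
begin

text \<open>Put \<open>\<epsilon> = 1 / c\<^sup>2\<close> and rescale time by \<open>\<lambda>\<^sub>1(c) / \<lambda>\<close>. The profile equation becomes \<open>\<Psi> = k\<^sub>\<epsilon> * G(\<Psi>)\<close> with a
  two-sided exponential kernel \<open>k\<^sub>\<epsilon>\<close> which converges, in a weighted \<open>L\<^sup>1\<close> norm, to the one-sided kernel of
  the delay equation as \<open>\<epsilon> \<rightarrow> 0\<close>. Thanks to the rescaling, every \<open>k\<^sub>\<epsilon>\<close> acts in the same way on \<open>exp (\<lambda> t)\<close> and on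
  constants. The delay equation has a heteroclinic solution \<open>\<psi>\<close> from \<open>0\<close> to \<open>K\<close> on the strongly unstable
  manifold of \<open>0\<close>, and its linearization along \<open>\<psi>\<close> is boundedly invertible on continuous functions bounded
  by \<open>min (exp (2 \<lambda> t)) (exp (- \<gamma> t))\<close>: this space excludes the leading eigenfunction at \<open>-\<infinity>\<close>, and at \<open>+\<infinity>\<close>
  one uses the stability of \<open>K\<close>. Hence \<open>\<Psi> = \<psi> + y\<close> is found by a contraction in \<open>y\<close> which is uniform in \<open>\<epsilon>\<close>;
  continuity in \<open>c\<close> and the asymptotics at \<open>-\<infinity>\<close> come with it. Oscillation follows because a profile on one side
  of \<open>K\<close> would yield a positive solution of \<open>w'(t) \<le> - A w(t - \<tau>)\<close> with \<open>A \<tau> e > 1\<close>, which does not exist.\<close>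

section \<open>Weighted fixed points and exponential averages\<close>

text \<open>The second derivative is a singular perturbation: its coefficient is small, but the
  operator is unbounded. Only after the differential part has been inverted is the perturbation
  small, as a difference of two kernels. Without the rescaling of time such a difference would send
  exp (\<lambda> t) to a nonzero multiple of itself, which the weight exp (2 \<lambda> t) does not
  dominate at -\<infinity>. The exponent 2 \<lambda> is the size of the quadratic remainder of
  \<open>g\<close> at 0 along functions of size exp (\<lambda> t). The number in the oscillation
  criterion comes from the linearization at \<open>K\<close>: for w(t) = (u(t) - K) e^t the
  linearized delay equation becomes w'(t) = g'(K) e^h w(t - h), so A = |g'(K)| e^h and \<tau> = h
  give A \<tau> e = |g'(K)| h e^(h+1). The wave kernel also looks into the future; a small part of
  the delay is sacrificed to control this, which a strict criterion allows.\<close>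

lemma weighted_fixpoint:
  fixes T :: "(real \<Rightarrow> real) \<Rightarrow> real \<Rightarrow> real" and w :: "real \<Rightarrow> real"
  assumes wc: "continuous_on UNIV w" and wp: "\<And>t. w t > 0" and d: "\<delta> \<ge> 0"
    and th: "0 \<le> \<theta>" "\<theta> < 1"
    and self: "\<And>y. continuous_on UNIV y \<Longrightarrow> (\<And>t. \<bar>y t\<bar> \<le> \<delta> * w t) \<Longrightarrow>
        continuous_on UNIV (T y) \<and> (\<forall>t. \<bar>T y t\<bar> \<le> \<delta> * w t)"
    and contr: "\<And>y y' D t. continuous_on UNIV y \<Longrightarrow> (\<And>t. \<bar>y t\<bar> \<le> \<delta> * w t) \<Longrightarrow>
        continuous_on UNIV y' \<Longrightarrow> (\<And>t. \<bar>y' t\<bar> \<le> \<delta> * w t) \<Longrightarrow> D \<ge> 0 \<Longrightarrow>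
        (\<And>t. \<bar>y t - y' t\<bar> \<le> D * w t) \<Longrightarrow> \<bar>T y t - T y' t\<bar> \<le> \<theta> * D * w t"
  shows "\<exists>y. continuous_on UNIV y \<and> (\<forall>t. \<bar>y t\<bar> \<le> \<delta> * w t) \<and> T y = y"
proof -
  define s where "s = {z :: real \<Rightarrow>\<^sub>C real. \<forall>t. \<bar>apply_bcontfun z t\<bar> \<le> \<delta>}"
  \<comment> \<open>Multiplication by \<open>w\<close> identifies bounded continuous functions with
    those that are O(w), so that Banach's theorem applies in the sup norm, on the closed ball
    \<open>s\<close>.\<close>
  define lift where "lift z = (\<lambda>t. w t * apply_bcontfun z t)" for z :: "real \<Rightarrow>\<^sub>C real"
  define F where "F z = Bcontfun (\<lambda>t. T (lift z) t / w t)" for z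
  have s_eq: "s = PiC UNIV (\<lambda>_. {-\<delta>..\<delta>})"
    by (auto simp: s_def mem_PiC_iff abs_le_iff minus_le_iff Pi_iff)
  have "closed s" unfolding s_eq by (rule closed_PiC) auto
  then have comp: "complete s" by (simp add: complete_eq_closed)
  have ne: "s \<noteq> {}" using d by (auto simp: s_def intro!: exI[of _ 0])
  have lin_coeff: "continuous_on UNIV (lift z)" for z
    unfolding lift_def by (intro continuous_intros wc) auto
  have lb: "\<bar>lift z t\<bar> \<le> \<delta> * w t" if "z \<in> s" for z t
    using that wp[of t] by (auto simp: lift_def s_def abs_mult mult.commute intro!: mult_left_mono)
  have bc: "(\<lambda>t. T (lift z) t / w t) \<in> bcontfun" if "z \<in> s" for z
  proof (rule bcontfun_normI)
    show "continuous_on UNIV (\<lambda>t. T (lift z) t / w t)"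
      using self[OF lin_coeff lb[OF that]] wp wc
      by (intro continuous_on_divide ballI less_imp_neq[THEN not_sym]) auto
    show "norm (T (lift z) t / w t) \<le> \<delta>" for t
      using self[OF lin_coeff lb[OF that]] wp[of t] by (auto simp: divide_simps)
  qed
  have ap: "apply_bcontfun (F z) t = T (lift z) t / w t" if "z \<in> s" for z t
    unfolding F_def using bc[OF that] by (simp add: Bcontfun_inverse)
  have Fs: "F ` s \<subseteq> s"
  proof clarsimp
    fix z assume z: "z \<in> s"
    have "\<bar>T (lift z) t / w t\<bar> \<le> \<delta>" for t
      using self[OF lin_coeff lb[OF z]] wp[of t] by (simp add: abs_divide divide_simps)
    then show "F z \<in> s" unfolding s_def by (simp add: ap[OF z])
  qed
  have Fc: "dist (F z) (F z') \<le> \<theta> * dist z z'" if z: "z \<in> s" "z' \<in> s" for z z'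
  proof (rule dist_bound)
    fix t
    have "\<bar>lift z u - lift z' u\<bar> \<le> dist z z' * w u" for u
    proof -
      have "\<bar>lift z u - lift z' u\<bar> = w u * dist (apply_bcontfun z u) (apply_bcontfun z' u)"
        using wp[of u] by (simp add: lift_def dist_real_def abs_mult right_diff_distrib[symmetric])
      also have "\<dots> \<le> w u * dist z z'"
        using wp[of u] by (intro mult_left_mono dist_bounded) auto
      finally show ?thesis by (simp add: mult.commute)
    qed
    from contr[OF lin_coeff lb[OF z(1)] lin_coeff lb[OF z(2)] _ this, of t]
    have "\<bar>T (lift z) t - T (lift z') t\<bar> \<le> \<theta> * dist z z' * w t" by auto
    then show "dist (apply_bcontfun (F z) t) (apply_bcontfun (F z') t) \<le> \<theta> * dist z z'"
      using wp[of t] by (simp add: ap z dist_real_def diff_divide_distrib[symmetric] divide_simps)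
  qed
  obtain z where z: "z \<in> s" "F z = z"
    using Banach_fix[OF comp ne th Fs] Fc by blast
  have "T (lift z) t = lift z t" for t
    using ap[OF z(1), of t] z(2) wp[of t] by (simp add: lift_def divide_simps mult.commute)
  then show ?thesis using lin_coeff lb[OF z(1)] by (intro exI[of _ "lift z"]) auto
qed

text \<open>Variation of constants from -\<infinity>: on functions bounded by a multiple of exp (b
  t) with a + b > 0 this inverts D + a, where D is differentiation.\<close>

definition past_avg :: "real \<Rightarrow> (real \<Rightarrow> real) \<Rightarrow> real \<Rightarrow> real" where
  "past_avg a z x = exp (- a * x) * (LINT u:{..x}|lborel. exp (a * u) * z u)"

lemma exp_atMost_integrable:
  fixes a x :: real assumes "a > 0"
  shows "set_integrable lborel {..x} (\<lambda>u. exp (a * u))"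
    and "(LINT u:{..x}|lborel. exp (a * u)) = exp (a * x) / a"
proof -
  have 1: "has_bochner_integral lborel (\<lambda>u. indicator {0..} u *\<^sub>R exp (- a * u)) (1 / a)"
  proof (rule has_bochner_integral_nn_integral)
    show "(\<integral>\<^sup>+ u. ennreal (indicator {0..} u *\<^sub>R exp (- a * u)) \<partial>lborel) = ennreal (1 / a)"
    proof -
      have "(\<integral>\<^sup>+ u. ennreal (exp (- a * u)) * indicator {0..} u \<partial>lborel) = ennreal (0 - (- exp (- a * 0) / a))"
      proof (rule nn_integral_FTC_atLeast)
        show "((\<lambda>u. - exp (- a * u) / a) \<longlongrightarrow> 0) at_top"
          using assms by real_asymp
      qed (use assms in \<open>auto intro!: derivative_eq_intros\<close>)
      moreover have "ennreal (exp (- a * u)) * indicator {0..} u = ennreal (indicator {0..} u *\<^sub>R exp (- a * u))" for u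
        by (simp add: indicator_def)
      ultimately show ?thesis by simp
    qed
  qed (use assms in auto)
  \<comment> \<open>The reflection u -> x - u carries the half-line from 0 to \<infinity> to the
    half-line that ends at x.\<close>
  have eq: "indicator {0..} (x - u) *\<^sub>R exp (- a * (x - u)) = indicator {..x} u *\<^sub>R (exp (a * u) * exp (- a * x))" for u
    by (auto simp: indicator_def algebra_simps exp_add exp_diff exp_minus divide_simps)
  have 2: "has_bochner_integral lborel (\<lambda>u. indicator {..x} u *\<^sub>R (exp (a * u) * exp (- a * x))) (1 / a)"
    using lborel_has_bochner_integral_real_affine_iff[of "-1" "\<lambda>u. indicator {0..} u *\<^sub>R exp (- a * u)" "1/a" x] 1
    using eq by simp
  have 3: "has_bochner_integral lborel (\<lambda>u. (indicator {..x} u *\<^sub>R exp (a * u)) * exp (- a * x) * exp (a * x)) (1 / a * exp (a * x))"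
    using 2 by (intro has_bochner_integral_mult_left) (simp add: mult.assoc)
  have 4: "has_bochner_integral lborel (\<lambda>u. indicator {..x} u *\<^sub>R exp (a * u)) (exp (a * x) / a)"
    using 3 by (simp add: mult.assoc exp_minus)
  then show "set_integrable lborel {..x} (\<lambda>u. exp (a * u))"
    "(LINT u:{..x}|lborel. exp (a * u)) = exp (a * x) / a"
    by (auto simp: set_integrable_def set_lebesgue_integral_def has_bochner_integral_iff)
qed

lemma past_avg_integrable:
  fixes z :: "real \<Rightarrow> real"
  assumes "a + b > 0" "continuous_on UNIV z" "\<And>u. u \<le> x \<Longrightarrow> \<bar>z u\<bar> \<le> Z * exp (b * u)"
  shows "set_integrable lborel {..x} (\<lambda>u. exp (a * u) * z u)"
proof -
  have "set_integrable lborel {..x} (\<lambda>u. Z * exp ((a + b) * u))"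
    using exp_atMost_integrable(1)[OF assms(1), of x] by (intro set_integrable_mult_right) auto
  then show ?thesis
  proof (rule set_integrable_bound)
    have "(\<lambda>u. exp (a * u) * z u) \<in> borel_measurable borel"
      by (intro borel_measurable_continuous_onI continuous_intros assms)
    then show "set_borel_measurable lborel {..x} (\<lambda>u. exp (a * u) * z u)"
      unfolding set_borel_measurable_def by measurable
    show "AE u in lborel. u \<in> {..x} \<longrightarrow> norm (exp (a * u) * z u) \<le> norm (Z * exp ((a + b) * u))"
    proof (intro AE_I2 impI)
      fix u assume "u \<in> {..x}"
      then have "\<bar>z u\<bar> \<le> \<bar>Z\<bar> * exp (b * u)" using assms(3)[of u]
        by (smt (verit) atMost_iff exp_ge_zero mult_right_mono)
      then have "exp (a * u) * \<bar>z u\<bar> \<le> exp (a * u) * (\<bar>Z\<bar> * exp (b * u))" by simp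
      then show "norm (exp (a * u) * z u) \<le> norm (Z * exp ((a + b) * u))"
        by (simp add: abs_mult algebra_simps exp_add)
    qed
  qed
qed

text \<open>The source of the factor 1 / (1 + \<beta>) in the contraction constants below: a larger
  exponent b gives a smaller norm.\<close>

lemma past_avg_bound:
  assumes "a + b > 0" "continuous_on UNIV z" "\<And>u. u \<le> x \<Longrightarrow> \<bar>z u\<bar> \<le> Z * exp (b * u)"
  shows "\<bar>past_avg a z x\<bar> \<le> Z / (a + b) * exp (b * x)"
proof -
  have I: "set_integrable lborel {..x} (\<lambda>u. Z * exp ((a + b) * u))"
    using exp_atMost_integrable(1)[OF assms(1), of x] by (intro set_integrable_mult_right) auto
  have "\<bar>LINT u:{..x}|lborel. exp (a * u) * z u\<bar> \<le> (LINT u:{..x}|lborel. \<bar>exp (a * u) * z u\<bar>)"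
    using set_integral_norm_bound[OF past_avg_integrable[OF assms]] by simp
  also have "\<dots> \<le> (LINT u:{..x}|lborel. Z * exp ((a + b) * u))"
  proof (rule set_integral_mono)
    show "set_integrable lborel {..x} (\<lambda>u. \<bar>exp (a * u) * z u\<bar>)"
      using past_avg_integrable[OF assms] by (rule set_integrable_abs)
    show "\<bar>exp (a * u) * z u\<bar> \<le> Z * exp ((a + b) * u)" if "u \<in> {..x}" for u
      using mult_left_mono[OF assms(3)[of u], of "exp (a * u)"] that
      by (simp add: abs_mult algebra_simps exp_add)
  qed (rule I)
  also have "\<dots> = Z * (exp ((a + b) * x) / (a + b))"
    using exp_atMost_integrable(2)[OF assms(1), of x] by simp
  finally have *: "\<bar>LINT u:{..x}|lborel. exp (a * u) * z u\<bar> \<le> Z * (exp ((a + b) * x) / (a + b))" .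
  have "\<bar>past_avg a z x\<bar> = exp (- a * x) * \<bar>LINT u:{..x}|lborel. exp (a * u) * z u\<bar>"
    by (simp add: past_avg_def abs_mult)
  also have "\<dots> \<le> exp (- a * x) * (Z * (exp ((a + b) * x) / (a + b)))"
    using * by (intro mult_left_mono) auto
  also have "\<dots> = Z / (a + b) * exp (b * x)"
    by (simp add: exp_add algebra_simps exp_minus)
  finally show ?thesis .
qed

lemma past_avg_exp:
  assumes "a + b > 0"
  shows "past_avg a (\<lambda>u. Z * exp (b * u)) x = Z / (a + b) * exp (b * x)"
proof -
  have "past_avg a (\<lambda>u. Z * exp (b * u)) x = exp (- a * x) * (LINT u:{..x}|lborel. Z * exp ((a + b) * u))"
    unfolding past_avg_def by (simp add: algebra_simps exp_add)
  also have "\<dots> = exp (- a * x) * (Z * (exp ((a + b) * x) / (a + b)))"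
    using exp_atMost_integrable(2)[OF assms, of x] by simp
  also have "\<dots> = Z / (a + b) * exp (b * x)"
    by (simp add: exp_add algebra_simps exp_minus)
  finally show ?thesis .
qed

text \<open>Cutting the half-line at x - 1 leaves a constant plus an integral over a compact
  interval, to which the fundamental theorem applies.\<close>

lemma integral_atMost_has_derivative:
  fixes f :: "real \<Rightarrow> real"
  assumes "continuous_on UNIV f" "\<And>x. set_integrable lborel {..x} f"
  shows "((\<lambda>x. LINT u:{..x}|lborel. f u) has_real_derivative f x) (at x)"
proof -
  have split: "(LINT u:{..y}|lborel. f u) = (LINT u:{..x-1}|lborel. f u) + integral {x-1..y} f"
    if "y \<ge> x - 1" for y
  proof -
    have S: "set_integrable lborel {x-1<..y} f"
      by (rule set_integrable_subset[OF assms(2)[of y]]) auto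
    have "{..y} = {..x-1} \<union> {x-1<..y}" using that by auto
    then have "(LINT u:{..y}|lborel. f u) = (LINT u:{..x-1}|lborel. f u) + (LINT u:{x-1<..y}|lborel. f u)"
      using set_integral_Un[OF _ assms(2)[of "x-1"] S] by (auto simp: Int_def)
    also have "(LINT u:{x-1<..y}|lborel. f u) = integral {x-1<..y} f"
      by (rule set_borel_integral_eq_integral(2)[OF S])
    also have "\<dots> = integral {x-1..y} f"
      by (intro integral_spike_set negligible_subset[OF negligible_sing[of "x-1"]]) auto
    finally show ?thesis .
  qed
  have "((\<lambda>y. integral {x-1..y} f) has_real_derivative f x) (at x within {x-1..x+1})"
    by (intro integral_has_real_derivative continuous_on_subset[OF assms(1)]) auto
  then have "((\<lambda>y. integral {x-1..y} f) has_real_derivative f x) (at x)"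
    using at_within_Icc_at[of "x-1" x "x+1"] by simp
  then have "((\<lambda>y. (LINT u:{..x-1}|lborel. f u) + integral {x-1..y} f) has_real_derivative f x) (at x)"
    by (auto intro!: derivative_eq_intros)
  then show ?thesis
  proof (rule DERIV_cong_ev[THEN iffD1, OF refl _ refl, rotated])
    have "\<forall>\<^sub>F y in nhds x. y \<in> {x - 1<..}" by (rule eventually_nhds_in_open) auto
    then show "\<forall>\<^sub>F y in nhds x. (LINT u:{..x-1}|lborel. f u) + integral {x-1..y} f = (LINT u:{..y}|lborel. f u)"
      by eventually_elim (intro split[symmetric], simp)
  qed
qed

lemma past_avg_deriv:
  assumes "continuous_on UNIV z" "a + b > 0" "\<And>x. \<exists>Z. \<forall>u\<le>x. \<bar>z u\<bar> \<le> Z * exp (b * u)"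
  shows "(past_avg a z has_real_derivative z x - a * past_avg a z x) (at x)"
proof -
  have I: "set_integrable lborel {..x} (\<lambda>u. exp (a * u) * z u)" for x
    using past_avg_integrable[OF assms(2,1)] assms(3) by blast
  have D: "((\<lambda>x. LINT u:{..x}|lborel. exp (a * u) * z u) has_real_derivative exp (a * x) * z x) (at x)"
    by (rule integral_atMost_has_derivative) (intro continuous_intros assms I)+
  have "((\<lambda>x. exp (- a * x) * (LINT u:{..x}|lborel. exp (a * u) * z u)) has_real_derivative
     exp (- a * x) * (exp (a * x) * z x) + (- a * exp (- a * x)) * (LINT u:{..x}|lborel. exp (a * u) * z u)) (at x)"
    by (rule derivative_eq_intros D refl | simp)+
  moreover have "exp (- a * x) * (exp (a * x) * z x) = z x"
    by (simp add: exp_minus)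
  ultimately show ?thesis unfolding past_avg_def[abs_def] by (simp only:) (simp add: mult.assoc)
qed

section \<open>A priori bounds for relaxation equations with delay\<close>

lemma relax_bound:
  fixes v q :: "real \<Rightarrow> real"
  assumes "s \<le> t" "\<And>x. x \<in> {s..t} \<Longrightarrow> (v has_real_derivative - v x + q x) (at x within {s..t})"
    "\<And>x. x \<in> {s..t} \<Longrightarrow> \<bar>q x\<bar> \<le> Q" "\<bar>v s\<bar> \<le> Q"
  shows "\<bar>v t\<bar> \<le> Q"
proof -
  \<comment> \<open>A maximum principle: as long as r \<le> Q, the function (f - Q) exp is
    nonincreasing. Applying this to \<open>v\<close> and to its negative gives both signs.\<close>
  have up: "f t \<le> Q" if "\<And>x. x \<in> {s..t} \<Longrightarrow> (f has_real_derivative - f x + r x) (at x within {s..t})"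
    "\<And>x. x \<in> {s..t} \<Longrightarrow> r x \<le> Q" "f s \<le> Q" for f r :: "real \<Rightarrow> real"
  proof -
    have "(\<lambda>x. (f x - Q) * exp x) t \<le> (\<lambda>x. (f x - Q) * exp x) s"
    proof (rule DERIV_nonpos_imp_decreasing_open[OF assms(1)])
      fix x assume x: "s < x" "x < t"
      have "(f has_real_derivative - f x + r x) (at x)"
        using that(1)[of x] x at_within_Icc_at[of s x t] by simp
      then have "((\<lambda>x. (f x - Q) * exp x) has_real_derivative (r x - Q) * exp x) (at x)"
        by (auto intro!: derivative_eq_intros simp: algebra_simps)
      moreover have "(r x - Q) * exp x \<le> 0" using that(2)[of x] x by (simp add: mult_nonpos_nonneg)
      ultimately show "\<exists>y. ((\<lambda>x. (f x - Q) * exp x) has_real_derivative y) (at x) \<and> y \<le> 0" by blast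
    next
      have "continuous_on {s..t} f"
        using that(1) DERIV_continuous by (fastforce simp: continuous_on_eq_continuous_within)
      then show "continuous_on {s..t} (\<lambda>x. (f x - Q) * exp x)" by (intro continuous_intros)
    qed
    also have "\<dots> \<le> 0" using that(3) by (simp add: mult_nonpos_nonneg)
    finally show ?thesis by (simp add: mult_le_0_iff)
  qed
  have 1: "v t \<le> Q"
    by (rule up[of v q]) (use assms in \<open>auto simp: abs_le_iff\<close>)
  have 2: "(\<lambda>x. - v x) t \<le> Q"
  proof (rule up[of "\<lambda>x. - v x" "\<lambda>x. - q x"])
    fix x assume "x \<in> {s..t}"
    then show "((\<lambda>x. - v x) has_real_derivative - (- v x) + - q x) (at x within {s..t})"
      using DERIV_minus[OF assms(2)[of x]] by simp
  qed (use assms in \<open>fastforce simp: abs_le_iff\<close>)+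
  from 1 2 show ?thesis by (simp add: abs_le_iff)
qed

text \<open>Method of steps: on each interval of length \<open>h\<close> the delayed term is already
  bounded by the previous step, and \<open>relax_bound\<close> costs one factor 1 + A. The forcing
  is absorbed because F never exceeds the current bound.\<close>

lemma delay_growth:
  fixes v q :: "real \<Rightarrow> real"
  assumes h: "h > 0" and A: "A \<ge> 0" and F: "F \<ge> 0" and E: "E \<ge> 0"
    and hist: "\<And>x. x \<in> {s-h..s} \<Longrightarrow> \<bar>v x\<bar> \<le> E"
    and der: "\<And>x. x \<in> {s..s+T} \<Longrightarrow> (v has_real_derivative - v x + q x) (at x within {s..s+T})"
    and q: "\<And>x. x \<in> {s..s+T} \<Longrightarrow> \<bar>q x\<bar> \<le> A * \<bar>v (x - h)\<bar> + F"
  shows "\<forall>t. s - h \<le> t \<and> t \<le> s + T \<and> t \<le> s + real n * h \<longrightarrow> \<bar>v t\<bar> \<le> (1 + A) ^ n * (E + F)"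
proof (induction n)
  case 0 then show ?case using hist F by (auto simp: ) (smt (verit) hist atLeastAtMost_iff)
next
  case (Suc n)
  let ?D = "(1 + A) ^ n * (E + F)"
  have D0: "?D \<ge> 0" using A E F by simp
  have FD: "F \<le> ?D"
  proof -
    have "1 * (E + F) \<le> ?D" using A E F by (intro mult_right_mono) auto
    then show ?thesis using E by simp
  qed
  show ?case
  proof (intro allI impI)
    fix t assume t: "s - h \<le> t \<and> t \<le> s + T \<and> t \<le> s + real (Suc n) * h"
    have mono: "?D \<le> (1 + A) * ?D" using mult_right_mono[of 1 "1 + A" ?D] D0 A by simp
    show "\<bar>v t\<bar> \<le> (1 + A) ^ Suc n * (E + F)"
    proof (cases "t \<le> s + real n * h")
      case True then show ?thesis using Suc t mono by fastforce
    next
      case False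
      then have ts: "t \<ge> s" using h by (smt (verit) mult_nonneg_nonneg of_nat_0_le_iff)
      have "\<bar>v t\<bar> \<le> (1 + A) * ?D"
      proof (rule relax_bound[OF ts])
        fix x assume x: "x \<in> {s..t}"
        show "(v has_real_derivative - v x + q x) (at x within {s..t})"
          by (rule DERIV_subset[OF der]) (use x t in auto)
        have "\<bar>v (x - h)\<bar> \<le> ?D" using Suc x t h by (auto simp: algebra_simps)
        then have "A * \<bar>v (x - h)\<bar> \<le> A * ?D" using A by (rule mult_left_mono)
        then show "\<bar>q x\<bar> \<le> (1 + A) * ?D" using q[of x] x t FD by (auto simp: algebra_simps)
      next
        have "\<bar>v s\<bar> \<le> ?D" using Suc ts t h by simp
        then show "\<bar>v s\<bar> \<le> (1 + A) * ?D" using mono by linarith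
      qed
      then show ?thesis by (simp add: mult.assoc)
    qed
  qed
qed

section \<open>The delay equation and exponential kernels\<close>

lemma integral_has_derivative_atLeast:
  fixes f :: "real \<Rightarrow> real"
  assumes "continuous_on UNIV f" "a \<le> x"
  shows "((\<lambda>x. integral {a..x} f) has_real_derivative f x) (at x within {a..})"
proof -
  have "((\<lambda>x. integral {a..x} f) has_real_derivative f x) (at x within {a..x+1})"
    using assms by (intro integral_has_real_derivative continuous_on_subset[OF assms(1)]) auto
  moreover have "at x within {a..x+1} = at x within {a..}"
    by (rule at_within_nhd[of x "{..<x+1}"]) auto
  ultimately show ?thesis by simp
qed

text \<open>Continuity of \<open>G\<close> is enough: the right-hand side at time t involves only
  the value at t - h, so each application of the integral operator \<open>step\<close> makes the
  function correct on one more interval of length \<open>h\<close>, without any fixed point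
  theorem.\<close>

lemma dde_steps:
  fixes G phi :: "real \<Rightarrow> real"
  assumes h: "h > 0" and G: "continuous_on UNIV G" and phi: "continuous_on {-h..0} phi"
  shows "\<exists>u. continuous_on UNIV u \<and> (\<forall>t\<in>{-h..0}. u t = phi t) \<and>
    (\<forall>t\<ge>0. (u has_real_derivative - u t + G (u (t - h))) (at t within {0..}))"
proof -
  \<comment> \<open>Clamping the argument extends \<open>phi\<close> to a continuous function on the
    line, constant outside the initial interval; this makes every iterate total and
    continuous.\<close>
  define ph where "ph t = phi (max (-h) (min 0 t))" for t
  define step where "step f t = exp (- max 0 t) * (ph t + integral {0..max 0 t} (\<lambda>s. exp s * G (f (s - h))))" for f t
  define U where "U = rec_nat ph (\<lambda>_. step)"
  have U0: "U 0 = ph" and US: "U (Suc n) = step (U n)" for n by (simp_all add: U_def)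
  have phc: "continuous_on UNIV ph" unfolding ph_def
    by (rule continuous_on_compose2[OF phi]) (use h in \<open>auto intro!: continuous_intros\<close>)
  have ph0: "ph t = ph 0" if "t \<ge> 0" for t using that by (simp add: ph_def)
  have Ic: "continuous_on UNIV (\<lambda>s. exp s * G (f (s - h)))" if "continuous_on UNIV f" for f
    by (intro continuous_intros continuous_on_compose2[OF G] continuous_on_compose2[OF that]) auto
  have stc: "continuous_on UNIV (step f)" if f: "continuous_on UNIV f" for f
  proof -
    have "continuous_on {0..} (\<lambda>x. integral {0..x} (\<lambda>s. exp s * G (f (s - h))))"
      using integral_has_derivative_atLeast[OF Ic[OF f], of 0] DERIV_continuous
      by (fastforce simp: continuous_on_eq_continuous_within)
    then show ?thesis unfolding step_def
      by (intro continuous_intros phc continuous_on_compose2[of "{0..}" _ UNIV "\<lambda>t. max 0 t"]) auto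
  qed
  have Uc: "continuous_on UNIV (U n)" for n by (induction n) (auto simp: U0 US phc stc)
  have agree: "\<forall>t \<le> real n * h. U (Suc n) t = U n t" for n
  proof (induction n)
    case 0 show ?case by (auto simp: U0 US step_def max_def)
  next
    case (Suc n)
    show ?case
    proof (intro allI impI)
      fix t assume t: "t \<le> real (Suc n) * h"
      have "integral {0..max 0 t} (\<lambda>s. exp s * G (U (Suc n) (s - h))) = integral {0..max 0 t} (\<lambda>s. exp s * G (U n (s - h)))"
      proof (rule integral_cong)
        fix s assume "s \<in> {0..max 0 t}"
        then have "s \<le> real (Suc n) * h" using t h by (auto simp: max_def split: if_splits)
        then have "s - h \<le> real n * h" by (simp add: algebra_simps)
        then show "exp s * G (U (Suc n) (s - h)) = exp s * G (U n (s - h))" using Suc by simp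
      qed
      then show "U (Suc (Suc n)) t = U (Suc n) t" by (simp add: US[of "Suc n"] US[of n] step_def)
    qed
  qed
  have agree2: "U (n + k) t = U n t" if "t \<le> real n * h" for n k t
  proof (induction k)
    case (Suc k)
    have "real n * h \<le> real (n + k) * h" using h by (intro mult_right_mono) auto
    then show ?case using agree[of "n + k"] that Suc by simp
  qed simp
  \<comment> \<open>From number n on, the iterates agree up to time \<open>n * h\<close>, so iterate
    number ceiling (t / h) already has the final value at t. For t \<le> 0 the conversion
    \<open>nat\<close> gives iterate 0.\<close>
  define u where "u t = U (nat \<lceil>t / h\<rceil>) t" for t
  have uU: "u t = U n t" if "t \<le> real n * h" for n t
  proof -
    let ?m = "nat \<lceil>t / h\<rceil>"
    have "t / h \<le> real ?m" by linarith
    then have m: "t \<le> real ?m * h" using h by (simp add: divide_simps)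
    show ?thesis unfolding u_def using agree2[OF m, of "n - ?m"] agree2[OF that, of "?m - n"]
      by (cases "?m \<le> n") auto
  qed
  have big: "\<exists>n. t < real n * h" for t
    using reals_Archimedean3[OF h] by (metis)
  show ?thesis
  proof (intro exI[of _ u] conjI ballI allI impI)
    show "continuous_on UNIV u"
      unfolding continuous_on_eq_continuous_at[OF open_UNIV]
    proof
      fix t
      obtain n where n: "t < real n * h" using big by blast
      have "isCont (U n) t" using Uc[of n] by (simp add: continuous_on_eq_continuous_at)
      moreover have "\<forall>\<^sub>F s in nhds t. U n s = u s"
        using eventually_nhds_in_open[of "{..<real n * h}" t] n
        by (auto elim!: eventually_mono simp: uU[of _ n])
      ultimately show "isCont u t" using isCont_cong by blast
    qed
    show "u t = phi t" if "t \<in> {-h..0}" for t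
      using uU[of t 0] that by (simp add: U0 ph_def)
    fix t :: real assume t: "t \<ge> 0"
    obtain n where n: "t < real n * h" using big by blast
    have st: "step f x = exp (-x) * (ph 0 + integral {0..x} (\<lambda>s. exp s * G (f (s - h))))" if "x \<ge> 0" for x f
      using that ph0[of x] by (simp add: step_def)
    have "((\<lambda>x. exp (-x) * (ph 0 + integral {0..x} (\<lambda>s. exp s * G (U n (s - h))))) has_real_derivative
        - step (U n) t + G (U n (t - h))) (at t within {0..})"
      by (rule derivative_eq_intros integral_has_derivative_atLeast Ic Uc refl t)+
        (simp add: st[OF t] exp_minus field_simps)
    then have "(step (U n) has_real_derivative - step (U n) t + G (U n (t - h))) (at t within {0..})"
      by (rule has_field_derivative_transform_within[of _ _ _ _ 1]) (use t st in auto)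
    then have "(u has_real_derivative - step (U n) t + G (U n (t - h))) (at t within {0..})"
    proof (rule has_field_derivative_transform_within[of _ _ _ _ "real n * h - t"])
      fix x assume x: "x \<in> {0..}" "dist x t < real n * h - t"
      then have "x \<le> real n * h" by (simp add: dist_real_def)
      moreover then have "x \<le> real (Suc n) * h" using h by (simp add: algebra_simps)
      ultimately show "step (U n) x = u x" using uU[of x "Suc n"] by (simp add: US)
    qed (use t n in auto)
    moreover have "step (U n) t = u t" using uU[of t n] agree[of n] n by (simp add: US)
    moreover have "U n (t - h) = u (t - h)" using uU[of "t - h" n] n h by simp
    ultimately show "(u has_real_derivative - u t + G (u (t - h))) (at t within {0..})" by simp
  qed
qed

text \<open>Two conflicting estimates of the ratio w(t - \<tau>) / w(t): it is bounded, because a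
  positive nonincreasing function cannot drop by more than its own value over half a delay, and by a
  bootstrap it is eventually at least every power of r = A \<tau> e.\<close>

lemma no_positive_delay_decay:
  fixes w w' :: "real \<Rightarrow> real"
  assumes tau: "\<tau> > 0" and A: "A > 0" and crit: "A * \<tau> * exp 1 > 1"
    and pos: "\<And>t. t \<ge> t0 - \<tau> \<Longrightarrow> w t > 0"
    and der: "\<And>t. t \<ge> t0 \<Longrightarrow> (w has_real_derivative w' t) (at t)"
    and ineq: "\<And>t. t \<ge> t0 \<Longrightarrow> w' t \<le> - A * w (t - \<tau>)"
  shows False
proof -
  have w'neg: "w' t \<le> 0" if "t \<ge> t0" for t
    using ineq[OF that] mult_pos_pos[OF A pos[of "t - \<tau>"]] that by simp
  have mono: "w t \<le> w s" if "t0 \<le> s" "s \<le> t" for s t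
    using DERIV_nonpos_imp_nonincreasing[OF that(2), of w] der w'neg that by (meson order_trans)
  \<comment> \<open>On [t, t + \<tau>/2] the slope is at most - A w(t - \<tau>/2) by monotonicity,
    and the resulting drop cannot exceed w(t).\<close>
  have half: "w (t - \<tau>/2) \<le> 2 / (A * \<tau>) * w t" if t: "t \<ge> t0 + 2 * \<tau>" for t
  proof -
    obtain z where z: "z > t" "z < t + \<tau>/2" "w (t + \<tau>/2) - w t = (t + \<tau>/2 - t) * w' z"
      using MVT2[of t "t + \<tau>/2" w w'] der t tau by auto
    have "w (t - \<tau>/2) \<le> w (z - \<tau>)" using z t tau by (intro mono) auto
    then have "A * w (t - \<tau>/2) \<le> A * w (z - \<tau>)" using A by simp
    also have "\<dots> \<le> - w' z" using ineq[of z] z t tau by simp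
    finally have "(\<tau>/2) * (A * w (t - \<tau>/2)) \<le> (\<tau>/2) * (- w' z)" using tau by (intro mult_left_mono) auto
    also have "\<dots> \<le> w t" using z(3) pos[of "t + \<tau>/2"] t tau by (simp add: algebra_simps)
    finally show ?thesis using A tau by (simp add: field_simps)
  qed
  have upper: "w (t - \<tau>) \<le> (2 / (A * \<tau>))^2 * w t" if t: "t \<ge> t0 + 3 * \<tau>" for t
  proof -
    have "w (t - \<tau>) \<le> 2 / (A * \<tau>) * w (t - \<tau>/2)" using half[of "t - \<tau>/2"] t tau by simp
    also have "\<dots> \<le> 2 / (A * \<tau>) * (2 / (A * \<tau>) * w t)"
      using half[of t] t tau A by (intro mult_left_mono) auto
    finally show ?thesis by (simp add: power2_eq_square mult.assoc)
  qed
  define r where "r = A * \<tau> * exp 1"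
  have r1: "r > 1" using crit by (simp add: r_def)
  \<comment> \<open>If the ratio is at least r^n, then w' \<le> - A r^n w, which integrates over one
    delay to a ratio of at least exp (A r^n \<tau>); exp x \<ge> e x makes this at least r^(n+1).
    Each round starts one delay later.\<close>
  have lower: "\<forall>t \<ge> t0 + real (n + 1) * \<tau>. w (t - \<tau>) \<ge> r ^ n * w t" for n
  proof (induction n)
    case 0 then show ?case using mono tau by auto
  next
    case (Suc n)
    show ?case
    proof (intro allI impI)
      fix t assume t: "t \<ge> t0 + real (Suc n + 1) * \<tau>"
      have t': "t - \<tau> \<ge> t0 + real (n + 1) * \<tau>" using t by (simp add: algebra_simps)
      have "real (n + 1) * \<tau> \<ge> 0" using tau by simp
      then have t0': "t - \<tau> \<ge> t0" using t' by linarith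
      let ?B = "A * r ^ n"
      define f where "f = (\<lambda>s. w s * exp (?B * s))"
      have "f t \<le> f (t - \<tau>)"
      proof (rule DERIV_nonpos_imp_nonincreasing[where f = f])
        fix s assume s: "t - \<tau> \<le> s" "s \<le> t"
        have "w (s - \<tau>) \<ge> r ^ n * w s" using Suc s t' by simp
        then have "A * (r ^ n * w s) \<le> A * w (s - \<tau>)" using A by simp
        then have "w' s + ?B * w s \<le> 0" using ineq[of s] s t0' by (simp add: mult.assoc)
        moreover have "(f has_real_derivative (w' s + ?B * w s) * exp (?B * s)) (at s)"
          using der[of s] s t0' unfolding f_def by (auto intro!: derivative_eq_intros simp: algebra_simps)
        ultimately show "\<exists>y. (f has_real_derivative y) (at s) \<and> y \<le> 0"
          by (meson exp_ge_zero mult_nonpos_nonneg)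
      qed (use tau in auto)
      then have "(w t * exp (?B * \<tau>)) * exp (?B * (t - \<tau>)) \<le> w (t - \<tau>) * exp (?B * (t - \<tau>))"
        unfolding f_def by (simp add: exp_add[symmetric] algebra_simps)
      then have w1: "w t * exp (?B * \<tau>) \<le> w (t - \<tau>)" by simp
      have "exp 1 * (?B * \<tau>) \<le> exp 1 * exp (?B * \<tau> - 1)"
        using exp_ge_add_one_self[of "?B * \<tau> - 1"] by (intro mult_left_mono) auto
      also have "\<dots> = exp (?B * \<tau>)" by (simp add: exp_add[symmetric])
      finally have "r ^ Suc n \<le> exp (?B * \<tau>)" by (simp add: r_def algebra_simps)
      then have "r ^ Suc n * w t \<le> exp (?B * \<tau>) * w t"
        using pos[of t] t0' tau by (intro mult_right_mono) auto
      then show "w (t - \<tau>) \<ge> r ^ Suc n * w t" using w1 by (simp add: mult.commute)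
    qed
  qed
  obtain n where n: "r ^ n > (2 / (A * \<tau>))^2" using real_arch_pow[OF r1] by blast
  define t where "t = t0 + real (n + 3) * \<tau>"
  have "real n * \<tau> \<ge> 0" using tau by simp
  then have t: "t \<ge> t0 + 3 * \<tau>" "t \<ge> t0 + real (n + 1) * \<tau>" "t \<ge> t0 - \<tau>"
    using tau by (simp_all add: t_def algebra_simps)
  have "r ^ n * w t \<le> (2 / (A * \<tau>))^2 * w t" using lower[of n] upper[of t] t by fastforce
  then show False using n pos[OF t(3)] by simp
qed

text \<open>The parameter \<open>q\<close> is the reciprocal of the rate to the left of \<open>d\<close>, so that \<open>q = 0\<close> is the one-sided
  kernel of the delay equation; \<open>x / 0 = 0\<close> makes the separate case necessary.\<close>

definition kern :: "real \<Rightarrow> real \<Rightarrow> real \<Rightarrow> real \<Rightarrow> real \<Rightarrow> real" where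
  "kern A a q d s = (if d \<le> s then A * exp (- a * (s - d)) else if q = 0 then 0 else A * exp ((s - d) / q))"

definition conv :: "(real \<Rightarrow> real) \<Rightarrow> (real \<Rightarrow> real) \<Rightarrow> real \<Rightarrow> real" where
  "conv k z t = (LINT s|lborel. k s * z (t - s))"

text \<open>The time reversal of \<open>past_avg\<close>: it gives the solution of v' = b v - z that
  does not contain the growing mode exp (b t).\<close>

definition future_avg :: "real \<Rightarrow> (real \<Rightarrow> real) \<Rightarrow> real \<Rightarrow> real" where
  "future_avg b z x = past_avg b (\<lambda>u. z (- u)) (- x)"

lemma conv_subst: "conv k z t = (LINT u|lborel. k (t - u) * z u)"
  unfolding conv_def by (subst lborel_integral_real_affine[where c="-1" and t=t]) auto

lemma conv_kern_0: "conv (kern A a 0 d) z t = A * past_avg a z (t - d)"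
proof -
  have "kern A a 0 d (t - u) * z u = (A * exp (- a * (t - d))) * (indicator {..t-d} u *\<^sub>R (exp (a * u) * z u))" for u
    by (auto simp: kern_def indicator_def algebra_simps exp_add[symmetric])
  then show ?thesis
    unfolding conv_subst past_avg_def set_lebesgue_integral_def by (simp only: integral_mult_right_zero mult.assoc)
qed

lemma conv_kern_pos:
  assumes q: "q > 0" and z: "continuous_on UNIV z" "\<And>u. \<bar>z u\<bar> \<le> Z * exp (c * u)" and c: "a + c > 0" "c < 1 / q"
  shows "conv (kern A a q d) z t = A * (past_avg a z (t - d) + future_avg (1/q) z (t - d))"
proof -
  let ?x = "t - d"
  define P where "P u = (A * exp (- a * ?x)) * (indicator {..?x} u *\<^sub>R (exp (a * u) * z u))" for u
  define Q where "Q u = (A * exp (?x / q)) * (indicator {..-?x} (-u) *\<^sub>R (exp ((1/q) * (-u)) * z (- (-u))))" for u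
  have I1: "integrable lborel P" unfolding P_def
    using past_avg_integrable[OF c(1) z(1), of ?x Z] z(2)
    by (intro integrable_mult_right) (simp add: set_integrable_def)
  have c2: "1/q + (-c) > 0" using c by simp
  have I2': "set_integrable lborel {..-?x} (\<lambda>u. exp ((1/q) * u) * z (-u))"
    by (rule past_avg_integrable[OF c2, of _ _ Z])
      (use z(2)[of "- _"] in \<open>auto intro!: continuous_on_compose2[OF z(1)] continuous_intros\<close>)
  have I2: "integrable lborel Q" unfolding Q_def
    using lborel_integrable_real_affine[of "\<lambda>u. indicator {..-?x} u *\<^sub>R (exp ((1/q) * u) * z (-u))" "-1" 0] I2'
    by (intro integrable_mult_right) (simp add: set_integrable_def)
  \<comment> \<open>At u = t - d both indicators are 1, so the splitting of the kernel into
    \<open>P\<close> and \<open>Q\<close> is correct only off this null set.\<close>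
  have "AE u in lborel. u \<noteq> ?x"
    by (rule AE_lborel_singleton)
  then have "AE u in lborel. kern A a q d (t - u) * z u = P u + Q u"
    by eventually_elim (use q in \<open>auto simp: kern_def P_def Q_def indicator_def exp_add[symmetric] diff_divide_distrib add_divide_distrib algebra_simps\<close>)
  moreover have "(\<lambda>u. kern A a q d (t - u) * z u) \<in> borel_measurable lborel"
    unfolding kern_def using borel_measurable_continuous_onI[OF z(1)] by measurable
  ultimately have "conv (kern A a q d) z t = (LINT u|lborel. P u + Q u)"
    unfolding conv_subst using I1 I2 by (intro integral_cong_AE) auto
  also have "\<dots> = (LINT u|lborel. P u) + (LINT u|lborel. Q u)" using I1 I2 by simp
  also have "(LINT u|lborel. P u) = A * past_avg a z ?x"
    unfolding P_def past_avg_def set_lebesgue_integral_def by simp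
  also have "(LINT u|lborel. Q u) = A * future_avg (1/q) z ?x"
  proof -
    have "(LINT u|lborel. indicator {..-?x} u *\<^sub>R (exp ((1/q) * u) * z (-u)))
       = (LINT u|lborel. indicator {..-?x} (-u) *\<^sub>R (exp ((1/q) * (-u)) * z (- (-u))))"
      by (subst lborel_integral_real_affine[where c="-1" and t=0]) auto
    moreover have "- (1 / q) * (- ?x) = ?x / q" unfolding minus_mult_minus by simp
    ultimately show ?thesis
      unfolding Q_def future_avg_def past_avg_def set_lebesgue_integral_def
      by (simp only: integral_mult_right_zero mult.assoc)
  qed
  finally show ?thesis by (simp add: algebra_simps)
qed

section \<open>Calculus of averages over the future\<close>

lemma future_avg_deriv:
  assumes "continuous_on UNIV z" "b > c" "\<And>x. \<exists>Z. \<forall>u\<ge>x. \<bar>z u\<bar> \<le> Z * exp (c * u)"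
  shows "(future_avg b z has_real_derivative b * future_avg b z x - z x) (at x)"
proof -
  have "\<exists>Z. \<forall>u\<le>x. \<bar>z (-u)\<bar> \<le> Z * exp ((-c) * u)" for x
    using assms(3)[of "-x"] by (metis minus_le_iff minus_mult_commute minus_minus neg_le_iff_le)
  moreover have zc: "continuous_on UNIV (\<lambda>u. z (-u))"
    by (auto intro!: continuous_on_compose2[OF assms(1)] continuous_intros)
  ultimately have "(past_avg b (\<lambda>u. z (-u)) has_real_derivative z x - b * past_avg b (\<lambda>u. z (-u)) (-x)) (at (-x))"
    using past_avg_deriv[OF zc, of b "-c" "-x"] assms(2) by auto
  then have "((\<lambda>x. past_avg b (\<lambda>u. z (-u)) (-x)) has_real_derivative (z x - b * past_avg b (\<lambda>u. z (-u)) (-x)) * (-1)) (at x)"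
    by (rule DERIV_chain2[where g = uminus]) (auto intro!: derivative_eq_intros)
  then show ?thesis unfolding future_avg_def[abs_def] by (simp add: algebra_simps)
qed

lemma future_avg_exp:
  assumes "b > c"
  shows "future_avg b (\<lambda>u. Z * exp (c * u)) x = Z / (b - c) * exp (c * x)"
  using past_avg_exp[of b "-c" Z "-x"] assms by (simp add: future_avg_def)

lemma future_avg_bound:
  assumes "b > c" "continuous_on UNIV z" "\<And>u. u \<ge> x \<Longrightarrow> \<bar>z u\<bar> \<le> Z * exp (c * u)"
  shows "\<bar>future_avg b z x\<bar> \<le> Z / (b - c) * exp (c * x)"
proof -
  have "\<bar>past_avg b (\<lambda>u. z (- u)) (- x)\<bar> \<le> Z / (b + - c) * exp (- c * - x)"
  proof (rule past_avg_bound)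
    show "\<bar>z (-u)\<bar> \<le> Z * exp (- c * u)" if "u \<le> - x" for u using assms(3)[of "-u"] that by simp
  qed (use assms in \<open>auto intro!: continuous_on_compose2[OF assms(2)] continuous_intros\<close>)
  then show ?thesis by (simp add: future_avg_def)
qed

text \<open>The factor dominates the quotient w(t - s) / w(t) for w(t) = min (exp (\<beta> t)) (exp
  (- \<gamma> t)), so this number bounds the operator norm of convolution with \<open>f\<close> in
  the space weighted by w.\<close>

definition knorm :: "real \<Rightarrow> real \<Rightarrow> (real \<Rightarrow> real) \<Rightarrow> real" where
  "knorm \<gamma> \<beta> f = (LINT s|lborel. \<bar>f s\<bar> * (exp (\<gamma> * s) + exp (- \<beta> * s)))"

lemma kern_measurable [measurable]: "kern A a q d \<in> borel_measurable borel"
  unfolding kern_def[abs_def] by measurable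

lemma conv_integrable:
  fixes k z :: "real \<Rightarrow> real"
  assumes "k \<in> borel_measurable borel" "continuous_on UNIV z"
    "integrable lborel (\<lambda>s. \<bar>k s\<bar> * (exp (\<gamma> * s) + exp (- \<beta> * s)))"
    "\<And>s. \<bar>z (t - s)\<bar> \<le> V * (exp (\<gamma> * s) + exp (- \<beta> * s))"
  shows "integrable lborel (\<lambda>s. k s * z (t - s))"
proof (rule Bochner_Integration.integrable_bound)
  show "integrable lborel (\<lambda>s. V * (\<bar>k s\<bar> * (exp (\<gamma> * s) + exp (- \<beta> * s))))"
    using assms(3) by (rule integrable_mult_right)
  have "(\<lambda>s. z (t - s)) \<in> borel_measurable borel"
    by (intro borel_measurable_continuous_onI continuous_on_compose2[OF assms(2)] continuous_intros) auto
  then show "(\<lambda>s. k s * z (t - s)) \<in> borel_measurable lborel" using assms(1) by measurable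
  show "AE s in lborel. norm (k s * z (t - s)) \<le> norm (V * (\<bar>k s\<bar> * (exp (\<gamma> * s) + exp (- \<beta> * s))))"
  proof (rule AE_I2)
    fix s
    have "\<bar>k s\<bar> * \<bar>z (t - s)\<bar> \<le> \<bar>k s\<bar> * (V * (exp (\<gamma> * s) + exp (- \<beta> * s)))"
      using assms(4)[of s] by (intro mult_left_mono) auto
    also have "\<dots> \<le> \<bar>V * (\<bar>k s\<bar> * (exp (\<gamma> * s) + exp (- \<beta> * s)))\<bar>" by (simp add: mult.left_commute)
    finally show "norm (k s * z (t - s)) \<le> norm (V * (\<bar>k s\<bar> * (exp (\<gamma> * s) + exp (- \<beta> * s))))"
      by (simp add: abs_mult)
  qed
qed

lemma conv_bound:
  fixes k z :: "real \<Rightarrow> real"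
  assumes "k \<in> borel_measurable borel" "continuous_on UNIV z"
    "integrable lborel (\<lambda>s. \<bar>k s\<bar> * (exp (\<gamma> * s) + exp (- \<beta> * s)))"
    "\<And>s. \<bar>z (t - s)\<bar> \<le> V * (exp (\<gamma> * s) + exp (- \<beta> * s))"
  shows "\<bar>conv k z t\<bar> \<le> V * knorm \<gamma> \<beta> k"
proof -
  have I: "integrable lborel (\<lambda>s. k s * z (t - s))" by (rule conv_integrable[OF assms])
  have "\<bar>conv k z t\<bar> \<le> (LINT s|lborel. \<bar>k s * z (t - s)\<bar>)"
    unfolding conv_def by (rule integral_abs_bound)
  also have "\<dots> \<le> (LINT s|lborel. V * (\<bar>k s\<bar> * (exp (\<gamma> * s) + exp (- \<beta> * s))))"
  proof (rule integral_mono)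
    show "integrable lborel (\<lambda>s. V * (\<bar>k s\<bar> * (exp (\<gamma> * s) + exp (- \<beta> * s))))"
      using assms(3) by (rule integrable_mult_right)
    show "\<bar>k s * z (t - s)\<bar> \<le> V * (\<bar>k s\<bar> * (exp (\<gamma> * s) + exp (- \<beta> * s)))" for s
      using mult_left_mono[OF assms(4)[of s], of "\<bar>k s\<bar>"] by (simp add: abs_mult algebra_simps)
  qed (use I in auto)
  also have "\<dots> = V * knorm \<gamma> \<beta> k" by (simp add: knorm_def)
  finally show ?thesis .
qed

lemma conv_diff:
  assumes "integrable lborel (\<lambda>s. k s * z (t - s))" "integrable lborel (\<lambda>s. k s * z' (t - s))"
  shows "conv k (\<lambda>u. z u - z' u) t = conv k z t - conv k z' t"
  unfolding conv_def using assms by (simp add: right_diff_distrib)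

lemma conv_kernel_diff:
  assumes "integrable lborel (\<lambda>s. k s * z (t - s))" "integrable lborel (\<lambda>s. k' s * z (t - s))"
  shows "conv (\<lambda>s. k s - k' s) z t = conv k z t - conv k' z t"
  unfolding conv_def using assms by (simp add: left_diff_distrib)

section \<open>The characteristic equation and the wave kernels\<close>

text \<open>Here \<open>\<epsilon>\<close> stands for \<open>1 / c\<^sup>2\<close>, and \<open>\<epsilon> = 0\<close> gives the characteristic function of the delay equation.\<close>

definition chi :: "real \<Rightarrow> real \<Rightarrow> real \<Rightarrow> real \<Rightarrow> real" where
  "chi p h \<epsilon> z = \<epsilon> * z\<^sup>2 - z - 1 + p * exp (- z * h)"

locale dispersion =
  fixes p h :: real
  assumes p1: "p > 1" and h0: "h > 0"
begin

abbreviation lm :: real where "lm \<equiv> lam p h"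

lemma chi0_strict: "x < y \<Longrightarrow> chi p h 0 y < chi p h 0 x"
proof -
  assume xy: "x < y"
  then have "p * exp (- y * h) \<le> p * exp (- x * h)" using p1 h0 by (intro mult_left_mono) auto
  then show ?thesis using xy by (simp add: chi_def)
qed

lemma lam_props: "lm > 0" "p * exp (- lm * h) = 1 + lm"
proof -
  have "\<exists>z. 0 \<le> z \<and> z \<le> p \<and> chi p h 0 z = 0"
  proof (rule IVT2')
    have "p * exp (- p * h) \<le> p * 1" using p1 h0 by (intro mult_left_mono) auto
    then show "chi p h 0 p \<le> 0" by (simp add: chi_def)
  qed (use p1 in \<open>auto simp: chi_def intro!: continuous_intros\<close>)
  then obtain z where z: "0 \<le> z" "chi p h 0 z = 0" by blast
  have "z \<noteq> 0" using z p1 by (auto simp: chi_def)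
  then have zp: "z > 0 \<and> - z - 1 + p * exp (- z * h) = 0" using z by (simp add: chi_def)
  have "lm > 0 \<and> - lm - 1 + p * exp (- lm * h) = 0"
    unfolding lam_def
  proof (rule theI[of _ z], rule zp)
    fix y assume y: "y > 0 \<and> - y - 1 + p * exp (- y * h) = 0"
    then show "y = z" using chi0_strict[of y z] chi0_strict[of z y] z
      by (cases y z rule: linorder_cases) (auto simp: chi_def)
  qed
  then show "lm > 0" "p * exp (- lm * h) = 1 + lm" by auto
qed

text \<open>Linearized at 0, the delay operator multiplies exp (\<beta> t) by p exp (- \<beta> h) /
  (1 + \<beta>). This factor is 1 at \<beta> = \<lambda>; once below 1 it makes the operator a
  contraction for the weight exp (\<beta> t).\<close>

lemma beyond_lam: "\<beta> > lm \<Longrightarrow> p * exp (- \<beta> * h) < 1 + \<beta>"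
  using chi0_strict[of lm \<beta>] lam_props by (simp add: chi_def)

text \<open>The entries serve, in this order, the bound \<open>ka\<close> \<ge> 1/2, the slope of
  \<open>chi\<close> on [0, 2 \<lambda>] together with \<open>time_scale\<close> \<le> 5/4, the
  bound 1 / \<open>kq\<close> \<ge> 2 \<lambda> + 1, and the sign of \<open>chi\<close> at 2
  \<lambda>.\<close>

definition eps1 :: real where
  "eps1 = min (min (1/4) (1/(32 * lm))) (min (1/(2 * (2 * lm + 1))) ((1 + 2 * lm - p * exp (- (2 * lm) * h)) / (8 * lm\<^sup>2)))"

lemma eps1: "eps1 > 0" "eps1 \<le> 1/4" "eps1 \<le> 1/(32 * lm)" "eps1 \<le> 1/(2 * (2 * lm + 1))"
  "eps1 \<le> (1 + 2 * lm - p * exp (- (2 * lm) * h)) / (8 * lm\<^sup>2)"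
proof -
  have "(1 + 2 * lm - p * exp (- (2 * lm) * h)) / (8 * lm\<^sup>2) > 0"
    using lam_props(1) beyond_lam[of "2 * lm"] by (intro divide_pos_pos) auto
  then show "eps1 > 0" unfolding eps1_def min_less_iff_conj using lam_props(1) by simp
qed (unfold eps1_def, linarith+)

context
  fixes \<epsilon> :: real
  assumes e: "0 \<le> \<epsilon>" "\<epsilon> \<le> eps1"
begin

text \<open>On [0, 2 \<lambda>] the secant slopes of the quadratic term are at most 1/8, so the term
  - z dominates. This quantitative monotonicity yields uniqueness of the root as well as its
  Lipschitz dependence on \<epsilon>.\<close>

lemma chi_slope:
  assumes "0 \<le> x" "x \<le> y" "y \<le> 2 * lm"
  shows "chi p h \<epsilon> x - chi p h \<epsilon> y \<ge> (y - x) / 2"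
proof -
  have l: "lm > 0" by (rule lam_props)
  have "\<epsilon> * (x + y) \<le> 1/(32 * lm) * (4 * lm)"
    using e eps1(3) assms l by (intro mult_mono) auto
  also have "\<dots> \<le> 1/2" using l by simp
  finally have "(y - x) * (\<epsilon> * (x + y)) \<le> (y - x) * (1/2)" using assms by (intro mult_left_mono) auto
  moreover have "\<epsilon> * x\<^sup>2 - \<epsilon> * y\<^sup>2 = - ((y - x) * (\<epsilon> * (x + y)))" by (simp add: power2_eq_square algebra_simps)
  moreover have "p * exp (- y * h) \<le> p * exp (- x * h)" using p1 h0 assms by (intro mult_left_mono) auto
  ultimately show ?thesis unfolding chi_def by (simp add: field_simps)
qed

text \<open>At \<lambda> the value of \<open>chi\<close> is \<epsilon> \<lambda>^2 \<ge> 0, and at 2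
  \<lambda> the last entry of \<open>eps1\<close> makes it nonpositive.\<close>

lemma chi_root_ex: "\<exists>!z. lm \<le> z \<and> z \<le> 2 * lm \<and> chi p h \<epsilon> z = 0"
proof -
  have l: "lm > 0" by (rule lam_props)
  have "\<exists>z\<ge>lm. z \<le> 2 * lm \<and> chi p h \<epsilon> z = 0"
  proof (rule IVT2')
    have "\<epsilon> * (8 * lm\<^sup>2) \<le> 1 + 2 * lm - p * exp (- (2 * lm) * h)"
      using order_trans[OF e(2) eps1(5)] l by (simp add: le_divide_eq)
    moreover have "\<epsilon> * lm\<^sup>2 \<ge> 0" using e by simp
    ultimately show "chi p h \<epsilon> (2 * lm) \<le> 0" by (simp add: chi_def)
    show "0 \<le> chi p h \<epsilon> lm" using lam_props(2) e by (simp add: chi_def)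
  qed (use l in \<open>auto simp: chi_def intro!: continuous_intros\<close>)
  moreover have "x = y" if "lm \<le> x" "x \<le> 2 * lm" "chi p h \<epsilon> x = 0" "lm \<le> y" "y \<le> 2 * lm" "chi p h \<epsilon> y = 0" for x y
    using chi_slope[of x y] chi_slope[of y x] that l by (cases "x \<le> y") auto
  ultimately show ?thesis by blast
qed

end

definition lead_root :: "real \<Rightarrow> real" where
  "lead_root \<epsilon> = (THE z. lm \<le> z \<and> z \<le> 2 * lm \<and> chi p h \<epsilon> z = 0)"

lemma lead_root:
  assumes "0 \<le> \<epsilon>" "\<epsilon> \<le> eps1"
  shows "lm \<le> lead_root \<epsilon>" "lead_root \<epsilon> \<le> 2 * lm" "chi p h \<epsilon> (lead_root \<epsilon>) = 0"
  using theI'[OF chi_root_ex[OF assms]] unfolding lead_root_def by auto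

lemma lead_root_0: "lead_root 0 = lm"
proof -
  have "lm \<le> lead_root 0 \<and> lead_root 0 \<le> 2 * lm \<and> chi p h 0 (lead_root 0) = 0"
    "lm \<le> lm \<and> lm \<le> 2 * lm \<and> chi p h 0 lm = 0"
    using lead_root[of 0] eps1(1) lam_props by (auto simp: chi_def)
  then show ?thesis using chi_root_ex[of 0] eps1(1) less_imp_le by blast
qed

text \<open>Inserting the root for \<epsilon>' into \<open>chi\<close> for \<epsilon> leaves
  (\<epsilon> - \<epsilon>') times its square; \<open>chi_slope\<close> converts this defect into a
  distance between the roots.\<close>

lemma lead_root_lipschitz:
  assumes "0 \<le> \<epsilon>" "\<epsilon> \<le> eps1" "0 \<le> \<epsilon>'" "\<epsilon>' \<le> eps1"
  shows "\<bar>lead_root \<epsilon> - lead_root \<epsilon>'\<bar> \<le> 8 * lm\<^sup>2 * \<bar>\<epsilon> - \<epsilon>'\<bar>"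
proof -
  note r = lead_root[OF assms(1,2)] lead_root[OF assms(3,4)]
  have l: "lm > 0" by (rule lam_props)
  have c: "chi p h \<epsilon> (lead_root \<epsilon>') = (\<epsilon> - \<epsilon>') * (lead_root \<epsilon>')\<^sup>2"
    using r(6) by (simp add: chi_def algebra_simps)
  have "\<bar>lead_root \<epsilon> - lead_root \<epsilon>'\<bar> / 2 \<le> \<bar>chi p h \<epsilon> (lead_root \<epsilon>')\<bar>"
    using chi_slope[OF assms(1,2), of "lead_root \<epsilon>" "lead_root \<epsilon>'"] chi_slope[OF assms(1,2), of "lead_root \<epsilon>'" "lead_root \<epsilon>"] r l
    by (cases "lead_root \<epsilon> \<le> lead_root \<epsilon>'") auto
  also have "\<dots> = \<bar>\<epsilon> - \<epsilon>'\<bar> * (lead_root \<epsilon>')\<^sup>2" by (simp add: c abs_mult)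
  also have "\<dots> \<le> \<bar>\<epsilon> - \<epsilon>'\<bar> * (2 * lm)\<^sup>2" using r l by (intro mult_left_mono power_mono) auto
  finally show ?thesis by (simp add: power2_eq_square algebra_simps)
qed

text \<open>The quadratic term creates a second positive root, but \<open>chi_slope\<close> keeps it
  out of [0, 2 \<lambda>], so \<open>lead_root\<close> is the minimal one.\<close>

lemma lam1_root:
  assumes "c > 0" "1 / c\<^sup>2 \<le> eps1"
  shows "lam1 p h c = lead_root (1 / c\<^sup>2)"
proof -
  let ?e = "1 / c\<^sup>2"
  have e: "0 \<le> ?e" by simp
  note r = lead_root[OF e assms(2)]
  have l: "lm > 0" by (rule lam_props)
  have ch: "(z / c)^2 - z - 1 + p * exp (- z * h) = chi p h ?e z" for z
    by (simp add: chi_def power_divide)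
  have minr: "lead_root ?e \<le> w" if "w > 0" "chi p h ?e w = 0" for w
    using chi_slope[OF e assms(2), of w "lead_root ?e"] r that by (cases "w \<le> lead_root ?e") auto
  show ?thesis unfolding lam1_def ch
    using r l minr by (intro the_equality) (auto intro!: antisym)
qed

text \<open>In the time rescaled by \<open>\<lambda>\<^sub>1(c) / \<lambda>\<close>, the inverse of \<open>1 + D - (D / c)\<^sup>2\<close> followed by the delay is
  convolution with an exponential kernel. Its decay rates are \<open>ka\<close> and \<open>1 / kq\<close>, its shift is \<open>kd\<close>, its height \<open>kA\<close>;
  \<open>rr\<close> is the square root of the discriminant.\<close>

definition time_scale where "time_scale \<epsilon> = lead_root \<epsilon> / lm"
definition rr :: "real \<Rightarrow> real" where "rr \<epsilon> = sqrt (1 + 4 * \<epsilon>)"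
definition ka where "ka \<epsilon> = 2 / ((1 + rr \<epsilon>) * time_scale \<epsilon>)"
definition kq where "kq \<epsilon> = time_scale \<epsilon> * (rr \<epsilon> - 1) / 2"
definition kd where "kd \<epsilon> = time_scale \<epsilon> * h"
definition kA where "kA \<epsilon> = 1 / (time_scale \<epsilon> * rr \<epsilon>)"
definition wave_kernel where "wave_kernel \<epsilon> = kern (kA \<epsilon>) (ka \<epsilon>) (kq \<epsilon>) (kd \<epsilon>)"

lemma rr_bounds: assumes "0 \<le> \<epsilon>" shows "1 \<le> rr \<epsilon>" "rr \<epsilon> \<le> 1 + 2 * \<epsilon>" "(rr \<epsilon>)\<^sup>2 = 1 + 4 * \<epsilon>"
proof -
  show "1 \<le> rr \<epsilon>" using assms by (simp add: rr_def)
  show "rr \<epsilon> \<le> 1 + 2 * \<epsilon>" unfolding rr_def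
    by (rule real_le_lsqrt) (use assms in \<open>auto simp: power2_eq_square algebra_simps\<close>)
  show "(rr \<epsilon>)\<^sup>2 = 1 + 4 * \<epsilon>" using assms by (simp add: rr_def)
qed

lemma rr_gt1: "0 < \<epsilon> \<Longrightarrow> rr \<epsilon> > 1" by (simp add: rr_def)

lemma at0: "time_scale 0 = 1" "rr 0 = 1" "ka 0 = 1" "kq 0 = 0" "kd 0 = h" "kA 0 = 1"
  using lam_props(1) by (simp_all add: time_scale_def lead_root_0 rr_def ka_def kq_def kd_def kA_def)

context
  fixes \<epsilon> :: real
  assumes e: "0 \<le> \<epsilon>" "\<epsilon> \<le> eps1"
begin

lemma time_scale_bounds: "1 \<le> time_scale \<epsilon>" "time_scale \<epsilon> \<le> 5/4"
proof -
  have l: "lm > 0" by (rule lam_props)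
  show "1 \<le> time_scale \<epsilon>" using lead_root[OF e] l by (simp add: time_scale_def)
  have "\<epsilon> * (32 * lm) \<le> 1" using order_trans[OF e(2) eps1(3)] l by (simp add: le_divide_eq)
  then have "8 * lm\<^sup>2 * \<epsilon> \<le> lm / 4" using mult_right_mono[of "\<epsilon> * (32 * lm)" 1 "lm / 4"] l by (simp add: power2_eq_square algebra_simps)
  then have "lead_root \<epsilon> \<le> 5/4 * lm" using lead_root_lipschitz[OF e, of 0] lead_root_0 e eps1(1) by simp
  then show "time_scale \<epsilon> \<le> 5/4" using l by (simp add: time_scale_def divide_le_eq)
qed

lemma param_bounds: "1/2 \<le> ka \<epsilon>" "0 \<le> kq \<epsilon>" "kq \<epsilon> \<le> 1 / (2 * lm + 1)" "h \<le> kd \<epsilon>" "kd \<epsilon> \<le> 2 * h"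
   "0 < kA \<epsilon>" "kA \<epsilon> \<le> 1"
proof -
  have l: "lm > 0" by (rule lam_props)
  note s = time_scale_bounds and r = rr_bounds[OF e(1)]
  have e4: "\<epsilon> \<le> 1/4" using e eps1(2) by simp
  have "(1 + rr \<epsilon>) * time_scale \<epsilon> \<le> (5/2) * (5/4)" using r s e4 by (intro mult_mono) auto
  then have "(1 + rr \<epsilon>) * time_scale \<epsilon> \<le> 4" by simp
  moreover have "(1 + rr \<epsilon>) * time_scale \<epsilon> > 0" using r s by auto
  ultimately show "1/2 \<le> ka \<epsilon>" by (simp add: ka_def le_divide_eq)
  show "0 \<le> kq \<epsilon>" using r s by (simp add: kq_def)
  have "time_scale \<epsilon> * (rr \<epsilon> - 1) \<le> 2 * (2 * \<epsilon>)" using r s by (intro mult_mono) auto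
  then have "kq \<epsilon> \<le> 2 * \<epsilon>" by (simp add: kq_def)
  also have "\<dots> \<le> 1 / (2 * lm + 1)" using order_trans[OF e(2) eps1(4)] l by (simp add: field_simps)
  finally show "kq \<epsilon> \<le> 1 / (2 * lm + 1)" .
  show "h \<le> kd \<epsilon>" "kd \<epsilon> \<le> 2 * h" using s h0 by (simp_all add: kd_def)
  have "1 * 1 \<le> time_scale \<epsilon> * rr \<epsilon>" using s r by (intro mult_mono) auto
  then show "0 < kA \<epsilon>" "kA \<epsilon> \<le> 1" by (simp_all add: kA_def)
qed

lemma kq_pos: "0 < \<epsilon> \<Longrightarrow> kq \<epsilon> > 0"
  using rr_gt1[of \<epsilon>] time_scale_bounds by (simp add: kq_def)

lemma kq_inv: "0 < \<epsilon> \<Longrightarrow> 1 / kq \<epsilon> \<ge> 2 * lm + 1"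
  using kq_pos param_bounds(3) lam_props(1) by (simp add: field_simps)

text \<open>The last two are Vieta's relations for 1 + \<sigma> z - \<epsilon> \<sigma>^2 z^2 = (1 +
  z / ka) (1 - kq z) with \<sigma> = \<open>time_scale\<close>, the symbol of the rescaled operator;
  the first says that the kernel has mass 1.\<close>

lemma param_eqs: "kA \<epsilon> * (1 / ka \<epsilon> + kq \<epsilon>) = 1" "1 / ka \<epsilon> - kq \<epsilon> = time_scale \<epsilon>" "(1 / ka \<epsilon>) * kq \<epsilon> = \<epsilon> * (time_scale \<epsilon>)\<^sup>2"
proof -
  note s = time_scale_bounds and r = rr_bounds[OF e(1)]
  show "kA \<epsilon> * (1 / ka \<epsilon> + kq \<epsilon>) = 1" using s r by (simp add: kA_def ka_def kq_def field_simps)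
  show "1 / ka \<epsilon> - kq \<epsilon> = time_scale \<epsilon>" using s r by (simp add: ka_def kq_def field_simps)
  have "(1 / ka \<epsilon>) * kq \<epsilon> = (time_scale \<epsilon>)\<^sup>2 * ((rr \<epsilon>)\<^sup>2 - 1) / 4" using s r(1)
    by (simp add: ka_def kq_def power2_eq_square field_simps)
  then show "(1 / ka \<epsilon>) * kq \<epsilon> = \<epsilon> * (time_scale \<epsilon>)\<^sup>2" using r(3) by simp
qed

lemma conv_wave_kernel_pos:
  assumes "\<epsilon> > 0" "continuous_on UNIV z" "\<And>u. \<bar>z u\<bar> \<le> Z * exp (c * u)" "0 \<le> c" "c \<le> 2 * lm"
  shows "conv (wave_kernel \<epsilon>) z t = kA \<epsilon> * (past_avg (ka \<epsilon>) z (t - kd \<epsilon>) + future_avg (1 / kq \<epsilon>) z (t - kd \<epsilon>))"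
proof -
  have "ka \<epsilon> + c > 0" "c < 1 / kq \<epsilon>" using assms(4,5) kq_inv[OF assms(1)] param_bounds(1) by linarith+
  from conv_kern_pos[OF kq_pos[OF assms(1)] assms(2,3) this] show ?thesis unfolding wave_kernel_def .
qed

text \<open>Exponentials are eigenfunctions of convolution; the eigenvalue is the factor of the
  shift over the symbol of the differential operator at c, recovered from two partial
  fractions.\<close>

lemma kernel_mass_exp:
  assumes "\<epsilon> > 0" "0 \<le> c" "c \<le> 2 * lm"
  shows "conv (wave_kernel \<epsilon>) (\<lambda>u. Z * exp (c * u)) t = Z * exp (c * t) * (exp (- c * kd \<epsilon>) / (1 + c * time_scale \<epsilon> - \<epsilon> * (c * time_scale \<epsilon>)\<^sup>2))"
proof -
  define x where "x = 1 / ka \<epsilon>"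
  have ka: "ka \<epsilon> = 1 / x" and x: "x > 0" using param_bounds by (simp_all add: x_def)
  define q where "q = kq \<epsilon>"
  have q: "q > 0" "1/q \<ge> 2 * lm + 1" using kq_pos kq_inv assms by (simp_all add: q_def)
  have cq: "c < 1/q" using q assms by linarith
  then have cq1: "c * q < 1" using q by (simp add: field_simps)
  have pe: "kA \<epsilon> * (x + q) = 1" "x - q = time_scale \<epsilon>" "x * q = \<epsilon> * (time_scale \<epsilon>)\<^sup>2" using param_eqs by (simp_all add: x_def q_def)
  have "conv (wave_kernel \<epsilon>) (\<lambda>u. Z * exp (c * u)) t = kA \<epsilon> * (past_avg (ka \<epsilon>) (\<lambda>u. Z * exp (c * u)) (t - kd \<epsilon>) + future_avg (1 / q) (\<lambda>u. Z * exp (c * u)) (t - kd \<epsilon>))"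
    unfolding q_def by (rule conv_wave_kernel_pos[where Z = "\<bar>Z\<bar>" and c = c]) (use assms in \<open>auto simp: abs_mult intro!: continuous_intros\<close>)
  also have "\<dots> = kA \<epsilon> * (Z / (1 / x + c) + Z / (1 / q - c)) * exp (c * (t - kd \<epsilon>))"
  proof -
    have "1 / x + c > 0" using x assms by (simp add: add_pos_nonneg)
    from past_avg_exp[OF this] future_avg_exp[OF cq] show ?thesis
      unfolding ka by (simp only: distrib_left distrib_right mult.assoc)
  qed
  also have "Z / (1 / x + c) + Z / (1 / q - c) = Z * (x + q) / ((1 + c * x) * (1 - c * q))"
  proof -
    have n: "1 + c * x \<noteq> 0" "1 - c * q \<noteq> 0" using x assms cq1 by (auto simp: add_nonneg_eq_0_iff)
    have "1 / x + c = (1 + c * x) / x" "1 / q - c = (1 - c * q) / q" using x q by (simp_all add: field_simps)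
    then have "Z / (1 / x + c) + Z / (1 / q - c) = Z * x / (1 + c * x) + Z * q / (1 - c * q)" by simp
    also have "\<dots> = Z * (x + q) / ((1 + c * x) * (1 - c * q))" using n by (simp add: add_frac_eq algebra_simps)
    finally show ?thesis .
  qed
  also have "(1 + c * x) * (1 - c * q) = 1 + c * (x - q) - c\<^sup>2 * (x * q)" by (simp add: power2_eq_square algebra_simps)
  also have "\<dots> = 1 + c * time_scale \<epsilon> - \<epsilon> * (c * time_scale \<epsilon>)\<^sup>2" using pe by (simp add: power_mult_distrib algebra_simps)
  also have "kA \<epsilon> * (Z * (x + q) / (1 + c * time_scale \<epsilon> - \<epsilon> * (c * time_scale \<epsilon>)\<^sup>2)) * exp (c * (t - kd \<epsilon>))
      = (kA \<epsilon> * (x + q)) * (Z * exp (c * t) * (exp (- c * kd \<epsilon>) / (1 + c * time_scale \<epsilon> - \<epsilon> * (c * time_scale \<epsilon>)\<^sup>2)))"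
    by (simp add: exp_diff exp_minus field_simps)
  finally show ?thesis using pe(1) by simp
qed

end

lemma conv_wave_kernel_0: "conv (wave_kernel 0) z t = past_avg 1 z (t - h)"
  using conv_kern_0[of 1 1 h] by (simp add: wave_kernel_def at0)

context
  fixes \<epsilon> :: real
  assumes e: "0 \<le> \<epsilon>" "\<epsilon> \<le> eps1"
begin

lemma conv_wave_kernel_const: "conv (wave_kernel \<epsilon>) (\<lambda>u. Z) t = Z"
proof (cases "\<epsilon> = 0")
  case True then show ?thesis using past_avg_exp[of 1 0 Z] by (simp add: conv_wave_kernel_0)
next
  case False then show ?thesis using kernel_mass_exp[OF e, of 0 Z t] e lam_props(1) by simp
qed

text \<open>This is the purpose of the time scale: \<lambda> times \<open>time_scale\<close> is
  \<open>lead_root\<close>, and the vanishing of \<open>chi\<close> there makes the eigenvalue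
  exactly 1 / p, whatever \<epsilon> is.\<close>

lemma conv_wave_kernel_exp: "conv (wave_kernel \<epsilon>) (\<lambda>u. Z * exp (lm * u)) t = Z / p * exp (lm * t)"
proof (cases "\<epsilon> = 0")
  case True
  have "exp (lm * (t - h)) / (1 + lm) = exp (lm * t) / p"
    using lam_props p1 by (simp add: exp_diff field_simps exp_minus)
  then have "Z * (exp (lm * (t - h)) / (1 + lm)) = Z * (exp (lm * t) / p)" by simp
  then show ?thesis using past_avg_exp[of 1 lm Z "t - h"] lam_props(1) True by (simp add: conv_wave_kernel_0)
next
  case False
  have "lm * time_scale \<epsilon> = lead_root \<epsilon>" using lam_props(1) by (simp add: time_scale_def)
  moreover have "1 + lead_root \<epsilon> - \<epsilon> * (lead_root \<epsilon>)\<^sup>2 = p * exp (- (lead_root \<epsilon> * h))"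
    using lead_root(3)[OF e] by (simp add: chi_def)
  moreover have "lm * kd \<epsilon> = lead_root \<epsilon> * h" using lam_props(1) by (simp add: time_scale_def kd_def)
  ultimately show ?thesis using kernel_mass_exp[OF e, of lm Z t] e False lam_props(1) p1
    by (simp add: field_simps)
qed

text \<open>An envelope independent of \<epsilon>: the right rate 1/2 is the lower bound for
  \<open>ka\<close>, the shift of at most 2 h costs exp h, and the left rate is the lower bound for
  1 / \<open>kq\<close>.\<close>

lemma wave_kernel_dom: "\<bar>wave_kernel \<epsilon> s\<bar> \<le> (if 0 \<le> s then exp h * exp (- s / 2) else exp ((2 * lm + 1) * s))"
proof -
  note b = param_bounds[OF e]
  show ?thesis
  proof (cases "kd \<epsilon> \<le> s")
    case True
    have "1/2 * (s - kd \<epsilon>) \<le> ka \<epsilon> * (s - kd \<epsilon>)" using b True by (intro mult_right_mono) auto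
    then have "- ka \<epsilon> * (s - kd \<epsilon>) \<le> h + (- s / 2)" using b(5) by (simp add: field_simps)
    then have "kA \<epsilon> * exp (- ka \<epsilon> * (s - kd \<epsilon>)) \<le> 1 * exp (h + (- s / 2))"
      using b by (intro mult_mono) auto
    then show ?thesis using True b h0 by (simp add: wave_kernel_def kern_def exp_add[symmetric] abs_mult)
  next
    case False
    show ?thesis
    proof (cases "\<epsilon> = 0")
      case True then show ?thesis using False by (simp add: wave_kernel_def kern_def at0)
    next
      case ne: False
      then have q: "kq \<epsilon> > 0" "1 / kq \<epsilon> \<ge> 2 * lm + 1" using kq_pos[OF e] kq_inv[OF e] e by auto
      have K: "\<bar>wave_kernel \<epsilon> s\<bar> \<le> exp ((s - kd \<epsilon>) / kq \<epsilon>)" using False q b by (simp add: wave_kernel_def kern_def abs_mult mult_le_cancel_right1)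
      show ?thesis
      proof (cases "0 \<le> s")
        case True
        have "(s - kd \<epsilon>) / kq \<epsilon> \<le> 0" using False q by (simp add: divide_nonpos_pos)
        also have "0 \<le> h + (- s / 2)" using False b by simp
        finally have "exp ((s - kd \<epsilon>) / kq \<epsilon>) \<le> exp (h + (- s / 2))" by simp
        then show ?thesis using order_trans[OF K] True by (simp only: exp_add) simp
      next
        case sneg: False
        have "(s - kd \<epsilon>) / kq \<epsilon> \<le> s / kq \<epsilon>" using b h0 q by (intro divide_right_mono) auto
        also have "\<dots> = s * (1 / kq \<epsilon>)" by simp
        also have "\<dots> \<le> s * (2 * lm + 1)" using q sneg by (intro mult_left_mono_neg) auto
        finally have "exp ((s - kd \<epsilon>) / kq \<epsilon>) \<le> exp ((2 * lm + 1) * s)" by (simp add: mult.commute)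
        then show ?thesis using order_trans[OF K] sneg by simp
      qed
    qed
  qed
qed

end

text \<open>A dominating function for all kernels of the family, already multiplied by the weight.\<close>

definition dom :: "real \<Rightarrow> real" where
  "dom s = 2 * exp h * (indicator {..0} (-s) *\<^sub>R exp ((1/4) * (-s)) + indicator {..0} s *\<^sub>R exp (1 * s))"

lemma dom_integrable: "integrable lborel dom"
proof -
  have 1: "integrable lborel (\<lambda>s. indicator {..0} s *\<^sub>R exp (1 * s :: real))"
    using exp_atMost_integrable(1)[of 1 0] by (simp add: set_integrable_def)
  have 2: "integrable lborel (\<lambda>s. indicator {..0} (-s) *\<^sub>R exp ((1/4) * (-s) :: real))"
    using lborel_integrable_real_affine[of "\<lambda>u. indicator {..0} u *\<^sub>R exp ((1/4) * u :: real)" "-1" 0]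
      exp_atMost_integrable(1)[of "1/4" 0] by (simp add: set_integrable_def)
  show ?thesis unfolding dom_def[abs_def] by (intro integrable_mult_right Bochner_Integration.integrable_add 1 2)
qed

context
  fixes \<gamma> :: real
  assumes g: "0 < \<gamma>" "\<gamma> \<le> 1/4"
begin

text \<open>On the right exp (- s / 2) has to absorb a weight of at most 2 exp (s / 4), which
  explains \<gamma> \<le> 1/4; on the left the rate 2 \<lambda> + 1 exceeds that of the weight by
  1.\<close>

lemma wave_kernel_dom_weighted:
  assumes "0 \<le> \<epsilon>" "\<epsilon> \<le> eps1"
  shows "\<bar>wave_kernel \<epsilon> s\<bar> * (exp (\<gamma> * s) + exp (- (2 * lm) * s)) \<le> dom s"
proof -
  have l: "lm > 0" by (rule lam_props)
  have eh: "exp h \<ge> 1" using h0 by simp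
  show ?thesis
  proof (cases "0 \<le> s")
    case True
    have "\<gamma> * s \<le> 1/4 * s" using g True by (intro mult_right_mono) auto
    then have "exp (\<gamma> * s) \<le> exp (s/4)" by simp
    moreover have "- (2 * lm) * s \<le> s / 4" using l True by (smt (verit) divide_nonneg_nonneg mult_minus_left mult_nonneg_nonneg)
    then have "exp (- (2 * lm) * s) \<le> exp (s / 4)" by simp
    ultimately have "exp (\<gamma> * s) + exp (- (2 * lm) * s) \<le> 2 * exp (s / 4)" by linarith
    then have "\<bar>wave_kernel \<epsilon> s\<bar> * (exp (\<gamma> * s) + exp (- (2 * lm) * s)) \<le> (exp h * exp (- s / 2)) * (2 * exp (s / 4))"
      using wave_kernel_dom[OF assms, of s] True by (intro mult_mono) auto
    also have "\<dots> = 2 * exp h * exp (- s / 4)" by (simp add: exp_add[symmetric])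
    also have "\<dots> \<le> dom s" using True eh by (simp add: dom_def indicator_def)
    finally show ?thesis .
  next
    case False
    have "\<gamma> * s \<le> 0" using g False by (simp add: mult_nonneg_nonpos)
    moreover have "0 \<le> - (2 * lm) * s" using l False by (simp add: mult_nonneg_nonpos)
    ultimately have "exp (\<gamma> * s) \<le> exp (- (2 * lm) * s)" unfolding exp_le_cancel_iff by linarith
    then have "exp (\<gamma> * s) + exp (- (2 * lm) * s) \<le> 2 * exp (- (2 * lm) * s)" by linarith
    then have "\<bar>wave_kernel \<epsilon> s\<bar> * (exp (\<gamma> * s) + exp (- (2 * lm) * s)) \<le> exp ((2 * lm + 1) * s) * (2 * exp (- (2 * lm) * s))"
      using wave_kernel_dom[OF assms, of s] False by (intro mult_mono) auto
    also have "\<dots> = 2 * 1 * exp s" by (simp add: exp_add[symmetric] algebra_simps)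
    also have "\<dots> \<le> 2 * exp h * exp s" using eh by (intro mult_mono) auto
    also have "\<dots> \<le> dom s" using False by (simp add: dom_def indicator_def)
    finally show ?thesis .
  qed
qed

lemma wave_kernel_measurable [measurable]: "wave_kernel \<epsilon> \<in> borel_measurable borel"
  unfolding wave_kernel_def by measurable

lemma wave_kernel_integrable:
  assumes "0 \<le> \<epsilon>" "\<epsilon> \<le> eps1"
  shows "integrable lborel (\<lambda>s. \<bar>wave_kernel \<epsilon> s\<bar> * (exp (\<gamma> * s) + exp (- (2 * lm) * s)))"
  by (rule Bochner_Integration.integrable_bound[OF dom_integrable])
    (use wave_kernel_dom_weighted[OF assms] in \<open>auto intro!: AE_I2 abs_leI order_trans[OF _ abs_ge_self] simp: abs_mult\<close>)

lemma wave_kernel_diff_integrable: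
  assumes "0 \<le> \<epsilon>" "\<epsilon> \<le> eps1" "0 \<le> \<epsilon>'" "\<epsilon>' \<le> eps1"
  shows "integrable lborel (\<lambda>s. \<bar>wave_kernel \<epsilon> s - wave_kernel \<epsilon>' s\<bar> * (exp (\<gamma> * s) + exp (- (2 * lm) * s)))"
proof (rule Bochner_Integration.integrable_bound)
  show "integrable lborel (\<lambda>s. \<bar>wave_kernel \<epsilon> s\<bar> * (exp (\<gamma> * s) + exp (- (2 * lm) * s)) + \<bar>wave_kernel \<epsilon>' s\<bar> * (exp (\<gamma> * s) + exp (- (2 * lm) * s)))"
    by (intro Bochner_Integration.integrable_add wave_kernel_integrable assms)
  show "AE s in lborel. norm (\<bar>wave_kernel \<epsilon> s - wave_kernel \<epsilon>' s\<bar> * (exp (\<gamma> * s) + exp (- (2 * lm) * s)))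
     \<le> norm (\<bar>wave_kernel \<epsilon> s\<bar> * (exp (\<gamma> * s) + exp (- (2 * lm) * s)) + \<bar>wave_kernel \<epsilon>' s\<bar> * (exp (\<gamma> * s) + exp (- (2 * lm) * s)))"
    by (intro AE_I2) (simp add: distrib_right[symmetric] abs_mult, intro mult_right_mono, auto)
qed measurable

section \<open>Continuity of the kernels in \<epsilon>\<close>

lemma param_tendsto:
  assumes X: "\<And>n. 0 \<le> X n" "\<And>n. X n \<le> eps1" and e: "0 \<le> \<epsilon>" "\<epsilon> \<le> eps1" and lim: "X \<longlonglongrightarrow> \<epsilon>"
  shows "(\<lambda>n. time_scale (X n)) \<longlonglongrightarrow> time_scale \<epsilon>" "(\<lambda>n. ka (X n)) \<longlonglongrightarrow> ka \<epsilon>" "(\<lambda>n. kq (X n)) \<longlonglongrightarrow> kq \<epsilon>"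
    "(\<lambda>n. kd (X n)) \<longlonglongrightarrow> kd \<epsilon>" "(\<lambda>n. kA (X n)) \<longlonglongrightarrow> kA \<epsilon>"
proof -
  have "(\<lambda>n. 8 * lm\<^sup>2 * \<bar>X n - \<epsilon>\<bar>) \<longlonglongrightarrow> 8 * lm\<^sup>2 * \<bar>\<epsilon> - \<epsilon>\<bar>"
    by (intro tendsto_intros lim)
  then have t0: "(\<lambda>n. 8 * lm\<^sup>2 * \<bar>X n - \<epsilon>\<bar>) \<longlonglongrightarrow> 0" by simp
  have "(\<lambda>n. lead_root (X n) - lead_root \<epsilon>) \<longlonglongrightarrow> 0"
  proof (rule tendsto_0_le[OF t0])
    have "norm (lead_root (X n) - lead_root \<epsilon>) \<le> norm (8 * lm\<^sup>2 * \<bar>X n - \<epsilon>\<bar>) * 1" for n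
      using lead_root_lipschitz[OF X(1)[of n] X(2)[of n] e] by simp
    then show "\<forall>\<^sub>F n in sequentially. norm (lead_root (X n) - lead_root \<epsilon>) \<le> norm (8 * lm\<^sup>2 * \<bar>X n - \<epsilon>\<bar>) * 1"
      by simp
  qed
  then have "(\<lambda>n. lead_root (X n)) \<longlonglongrightarrow> lead_root \<epsilon>" by (simp add: LIM_zero_iff)
  then show s: "(\<lambda>n. time_scale (X n)) \<longlonglongrightarrow> time_scale \<epsilon>" unfolding time_scale_def using lam_props(1) by (intro tendsto_intros) auto
  have r: "(\<lambda>n. rr (X n)) \<longlonglongrightarrow> rr \<epsilon>" unfolding rr_def by (intro tendsto_intros lim)
  have s1: "time_scale \<epsilon> \<ge> 1" and r1: "rr \<epsilon> \<ge> 1" using time_scale_bounds[OF e] rr_bounds[OF e(1)] by auto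
  show "(\<lambda>n. ka (X n)) \<longlonglongrightarrow> ka \<epsilon>" unfolding ka_def using s1 r1 by (intro tendsto_intros s r) auto
  show "(\<lambda>n. kq (X n)) \<longlonglongrightarrow> kq \<epsilon>" unfolding kq_def by (intro tendsto_intros s r) auto
  show "(\<lambda>n. kd (X n)) \<longlonglongrightarrow> kd \<epsilon>" unfolding kd_def by (intro tendsto_intros s)
  show "(\<lambda>n. kA (X n)) \<longlonglongrightarrow> kA \<epsilon>" unfolding kA_def using s1 r1 by (intro tendsto_intros s r) auto
qed

text \<open>The branches meet at s = kd, where the kernel for \<epsilon> = 0 jumps. Left of this
  point the exponent (s - kd) / kq tends to -\<infinity> as kq tends to 0, so the left branch
  vanishes in the limit, in accordance with \<open>kern\<close>.\<close>

lemma wave_kernel_pointwise: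
  assumes X: "\<And>n. 0 \<le> X n" "\<And>n. X n \<le> eps1" and e: "0 \<le> \<epsilon>" "\<epsilon> \<le> eps1" and lim: "X \<longlonglongrightarrow> \<epsilon>"
    and s: "s \<noteq> kd \<epsilon>"
  shows "(\<lambda>n. wave_kernel (X n) s) \<longlonglongrightarrow> wave_kernel \<epsilon> s"
proof -
  note T = param_tendsto[OF X e lim]
  show ?thesis
  proof (cases "kd \<epsilon> < s")
    case True
    have "\<forall>\<^sub>F n in sequentially. kd (X n) < s" using order_tendstoD(2)[OF T(4) True] .
    then have "\<forall>\<^sub>F n in sequentially. kA (X n) * exp (- ka (X n) * (s - kd (X n))) = wave_kernel (X n) s"
      by eventually_elim (simp add: wave_kernel_def kern_def)
    moreover have "(\<lambda>n. kA (X n) * exp (- ka (X n) * (s - kd (X n)))) \<longlonglongrightarrow> kA \<epsilon> * exp (- ka \<epsilon> * (s - kd \<epsilon>))"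
      by (intro tendsto_intros T)
    ultimately show ?thesis using True by (simp add: wave_kernel_def kern_def Lim_transform_eventually)
  next
    case False
    then have sd: "s < kd \<epsilon>" using s by simp
    have ev: "\<forall>\<^sub>F n in sequentially. s < kd (X n)" using order_tendstoD(1)[OF T(4) sd] .
    show ?thesis
    proof (cases "\<epsilon> = 0")
      case ne: False
      then have q: "kq \<epsilon> > 0" using kq_pos[OF e] e by auto
      then have "\<forall>\<^sub>F n in sequentially. kq (X n) > 0" using order_tendstoD(1)[OF T(3)] by blast
      with ev have "\<forall>\<^sub>F n in sequentially. kA (X n) * exp ((s - kd (X n)) / kq (X n)) = wave_kernel (X n) s"
        by eventually_elim (simp add: wave_kernel_def kern_def)
      moreover have "(\<lambda>n. kA (X n) * exp ((s - kd (X n)) / kq (X n))) \<longlonglongrightarrow> kA \<epsilon> * exp ((s - kd \<epsilon>) / kq \<epsilon>)"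
        using q by (intro tendsto_intros T) auto
      ultimately show ?thesis using sd q by (simp add: wave_kernel_def kern_def Lim_transform_eventually)
    next
      case 0: True
      have K0: "wave_kernel \<epsilon> s = 0" using sd 0 by (simp add: wave_kernel_def kern_def at0)
      have "(\<lambda>n. kq (X n) / (kd (X n) - s)) \<longlonglongrightarrow> kq \<epsilon> / (kd \<epsilon> - s)"
        using sd by (intro tendsto_intros T) auto
      then have lim0: "(\<lambda>n. kq (X n) / (kd (X n) - s)) \<longlonglongrightarrow> 0" by (simp add: 0 at0)
      have "\<forall>\<^sub>F n in sequentially. norm (wave_kernel (X n) s) \<le> norm (kq (X n) / (kd (X n) - s)) * 1"
        using ev
      proof eventually_elim
        case (elim n)
        note b = param_bounds[OF X(1)[of n] X(2)[of n]]
        show ?case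
        proof (cases "kq (X n) = 0")
          case True then show ?thesis using elim by (simp add: wave_kernel_def kern_def)
        next
          case False
          then have q: "kq (X n) > 0" using b by simp
          define y where "y = (kd (X n) - s) / kq (X n)"
          have y: "y > 0" using elim q by (simp add: y_def)
          \<comment> \<open>This crude bound suffices: 1 / y is kq / (kd - s), which is already
            known to tend to 0.\<close>
          have "exp (- y) \<le> 1 / y" 
          proof -
            have "y \<le> exp y" using exp_ge_add_one_self[of y] by linarith
            then show ?thesis using y by (simp add: exp_minus inverse_eq_divide frac_le)
          qed
          moreover have "wave_kernel (X n) s = kA (X n) * exp (- y)"
            using elim q by (simp add: wave_kernel_def kern_def y_def minus_divide_left)
          moreover have "kA (X n) * exp (- y) \<le> 1 * exp (-y)" using b by (intro mult_right_mono) auto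
          ultimately have "wave_kernel (X n) s \<le> 1 / y" "0 \<le> wave_kernel (X n) s" using b by (linarith, simp)
          then show ?thesis using q elim by (simp add: y_def)
        qed
      qed
      then have "(\<lambda>n. wave_kernel (X n) s) \<longlonglongrightarrow> 0" by (rule tendsto_0_le[OF lim0])
      then show ?thesis by (simp add: K0)
    qed
  qed
qed

text \<open>Dominated convergence: the majorant \<open>dom\<close> does not depend on \<epsilon>,
  and the one point where pointwise convergence may fail is a null set.\<close>

lemma wave_kernel_knorm_tendsto:
  assumes X: "\<And>n. 0 \<le> X n" "\<And>n. X n \<le> eps1" and e: "0 \<le> \<epsilon>" "\<epsilon> \<le> eps1" and lim: "X \<longlonglongrightarrow> \<epsilon>"
  shows "(\<lambda>n. knorm \<gamma> (2 * lm) (\<lambda>s. wave_kernel (X n) s - wave_kernel \<epsilon> s)) \<longlonglongrightarrow> 0"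
proof -
  have "(\<lambda>n. LINT s|lborel. \<bar>wave_kernel (X n) s - wave_kernel \<epsilon> s\<bar> * (exp (\<gamma> * s) + exp (- (2 * lm) * s))) \<longlonglongrightarrow> (LINT (s::real)|lborel. (0::real))"
  proof (rule integral_dominated_convergence[where w = "\<lambda>s. 2 * dom s"])
    show "integrable lborel (\<lambda>s. 2 * dom s)" using dom_integrable by simp
    show "AE s in lborel. (\<lambda>n. \<bar>wave_kernel (X n) s - wave_kernel \<epsilon> s\<bar> * (exp (\<gamma> * s) + exp (- (2 * lm) * s))) \<longlonglongrightarrow> 0"
      using AE_lborel_singleton[of "kd \<epsilon>"]
    proof eventually_elim
      case (elim s)
      have "(\<lambda>n. \<bar>wave_kernel (X n) s - wave_kernel \<epsilon> s\<bar> * (exp (\<gamma> * s) + exp (- (2 * lm) * s))) \<longlonglongrightarrow> \<bar>wave_kernel \<epsilon> s - wave_kernel \<epsilon> s\<bar> * (exp (\<gamma> * s) + exp (- (2 * lm) * s))"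
        by (intro tendsto_intros wave_kernel_pointwise[OF X e lim elim])
      then show ?case by simp
    qed
    show "AE s in lborel. norm (\<bar>wave_kernel (X n) s - wave_kernel \<epsilon> s\<bar> * (exp (\<gamma> * s) + exp (- (2 * lm) * s))) \<le> 2 * dom s" for n
    proof (rule AE_I2)
      fix s
      have "\<bar>wave_kernel (X n) s - wave_kernel \<epsilon> s\<bar> * (exp (\<gamma> * s) + exp (- (2 * lm) * s))
        \<le> (\<bar>wave_kernel (X n) s\<bar> + \<bar>wave_kernel \<epsilon> s\<bar>) * (exp (\<gamma> * s) + exp (- (2 * lm) * s))"
        by (intro mult_right_mono) auto
      also have "\<dots> \<le> 2 * dom s" using wave_kernel_dom_weighted[OF X(1)[of n] X(2)[of n], of s] wave_kernel_dom_weighted[OF e, of s] by (simp add: distrib_right)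
      finally show "norm (\<bar>wave_kernel (X n) s - wave_kernel \<epsilon> s\<bar> * (exp (\<gamma> * s) + exp (- (2 * lm) * s))) \<le> 2 * dom s"
        by (simp add: abs_mult)
    qed
  qed measurable
  then show ?thesis by (simp add: knorm_def)
qed

text \<open>At \<epsilon> = 0 this starts the perturbation argument; at \<epsilon> > 0 it gives the
  continuity of the profiles in c.\<close>

lemma wave_kernel_knorm_continuous:
  assumes e: "0 \<le> \<epsilon>" "\<epsilon> \<le> eps1" and eta: "\<eta> > 0"
  shows "\<exists>\<delta>>0. \<forall>\<epsilon>'. 0 \<le> \<epsilon>' \<and> \<epsilon>' \<le> eps1 \<and> \<bar>\<epsilon>' - \<epsilon>\<bar> < \<delta> \<longrightarrow>
     knorm \<gamma> (2 * lm) (\<lambda>s. wave_kernel \<epsilon>' s - wave_kernel \<epsilon> s) < \<eta>"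
proof -
  have "((\<lambda>\<epsilon>'. knorm \<gamma> (2 * lm) (\<lambda>s. wave_kernel \<epsilon>' s - wave_kernel \<epsilon> s)) \<longlongrightarrow> 0) (at \<epsilon> within {0..eps1})"
    unfolding tendsto_at_iff_sequentially comp_def
    using wave_kernel_knorm_tendsto[OF _ _ e] by auto
  then have "\<forall>\<^sub>F \<epsilon>' in at \<epsilon> within {0..eps1}. knorm \<gamma> (2 * lm) (\<lambda>s. wave_kernel \<epsilon>' s - wave_kernel \<epsilon> s) < \<eta>"
    using order_tendstoD(2) eta by blast
  then obtain \<delta> where d: "\<delta> > 0" "\<And>\<epsilon>'. \<epsilon>' \<in> {0..eps1} \<Longrightarrow> \<epsilon>' \<noteq> \<epsilon> \<Longrightarrow> dist \<epsilon>' \<epsilon> < \<delta> \<Longrightarrow>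
     knorm \<gamma> (2 * lm) (\<lambda>s. wave_kernel \<epsilon>' s - wave_kernel \<epsilon> s) < \<eta>"
    unfolding eventually_at by blast
  show ?thesis
  proof (intro exI[of _ \<delta>] conjI allI impI)
    show "\<delta> > 0" by (rule d)
    fix \<epsilon>' assume "0 \<le> \<epsilon>' \<and> \<epsilon>' \<le> eps1 \<and> \<bar>\<epsilon>' - \<epsilon>\<bar> < \<delta>"
    then show "knorm \<gamma> (2 * lm) (\<lambda>s. wave_kernel \<epsilon>' s - wave_kernel \<epsilon> s) < \<eta>"
      using d(2)[of \<epsilon>'] eta by (cases "\<epsilon>' = \<epsilon>") (auto simp: dist_real_def knorm_def)
  qed
qed

end

end

section \<open>The strongly unstable solution of the delay equation\<close>

lemma DERIV_delay:
  fixes f :: "real \<Rightarrow> real"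
  assumes "(f has_real_derivative D) (at (t - d))"
  shows "((\<lambda>t. f (t - d)) has_real_derivative D) (at t)"
  using DERIV_shift[of f D t "- d"] assms by simp

lemma past_avg_diff:
  assumes "set_integrable lborel {..x} (\<lambda>u. exp (a * u) * z u)" "set_integrable lborel {..x} (\<lambda>u. exp (a * u) * z' u)"
  shows "past_avg a (\<lambda>u. z u - z' u) x = past_avg a z x - past_avg a z' x"
  unfolding past_avg_def using set_integral_diff(2)[OF assms] by (simp add: right_diff_distrib)

lemma past_avg_continuous:
  assumes "continuous_on UNIV z" "a + b > 0" "\<And>x. \<exists>Z. \<forall>u\<le>x. \<bar>z u\<bar> \<le> Z * exp (b * u)"
  shows "continuous_on UNIV (past_avg a z)"
  using past_avg_deriv[OF assms] by (auto simp: continuous_on_eq_continuous_at intro: DERIV_isCont)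

text \<open>While the delayed values are nonnegative, u(t) exp t is nondecreasing; induction over
  intervals of length \<open>h\<close> removes the proviso. The explicit lower bound gives strict
  positivity as soon as u(0) > 0.\<close>

lemma dde_nonneg:
  fixes G :: "real \<Rightarrow> real"
  assumes h: "h > 0" and G: "\<And>x. x \<ge> 0 \<Longrightarrow> G x \<ge> 0"
    and hist: "\<And>t. t \<in> {-h..0} \<Longrightarrow> u t \<ge> 0"
    and der: "\<And>t. t \<ge> 0 \<Longrightarrow> (u has_real_derivative - u t + G (u (t - h))) (at t within {0..})"
    and t: "t \<ge> 0"
  shows "u t \<ge> exp (- t) * u 0"
proof -
  have uc: "continuous_on {0..} u"
    using der DERIV_continuous by (fastforce simp: continuous_on_eq_continuous_within)
  have step: "u 0 \<le> u t * exp t" if t: "0 \<le> t" and nn: "\<And>s. -h \<le> s \<Longrightarrow> s \<le> t - h \<Longrightarrow> u s \<ge> 0" for t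
  proof -
    define f where "f = (\<lambda>s. u s * exp s)"
    have "f 0 \<le> f t"
    proof (rule DERIV_nonneg_imp_increasing_open[where f = f])
      fix x assume x: "0 < x" "x < t"
      have "at x within {0..} = at x" using x by (intro at_within_interior) auto
      then have "(u has_real_derivative - u x + G (u (x - h))) (at x)" using der[of x] x by simp
      then have "(f has_real_derivative G (u (x - h)) * exp x) (at x)"
        unfolding f_def by (auto intro!: derivative_eq_intros simp: algebra_simps)
      moreover have "G (u (x - h)) * exp x \<ge> 0" using G[OF nn[of "x - h"]] x by simp
      ultimately show "\<exists>y. (f has_real_derivative y) (at x) \<and> y \<ge> 0" by blast
    qed (use t in \<open>auto simp: f_def intro!: continuous_intros continuous_on_subset[OF uc]\<close>)
    then show ?thesis by (simp add: f_def)
  qed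
  have nonneg: "\<forall>t. -h \<le> t \<and> t \<le> real n * h \<longrightarrow> u t \<ge> 0" for n
  proof (induction n)
    case 0 then show ?case using hist by auto
  next
    case (Suc n)
    show ?case
    proof (intro allI impI)
      fix t assume t: "-h \<le> t \<and> t \<le> real (Suc n) * h"
      show "u t \<ge> 0"
      proof (cases "t \<le> 0")
        case True then show ?thesis using hist t by auto
      next
        case False
        have "u 0 \<le> u t * exp t"
          by (rule step) (use False t Suc h in \<open>auto simp: algebra_simps\<close>)
        moreover have "u 0 \<ge> 0" using hist[of 0] h by auto
        ultimately have "0 \<le> u t * exp t" by linarith
        then show ?thesis by (simp add: zero_le_mult_iff)
      qed
    qed
  qed
  obtain n where n: "t < real n * h" using reals_Archimedean3[OF h] by blast
  have "u 0 \<le> u t * exp t" using step[OF t] nonneg[of n] n h t by auto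
  then show ?thesis by (simp add: exp_minus field_simps)
qed

locale wave =
  fixes g g' :: "real \<Rightarrow> real" and h K :: real
  assumes h_pos: "h > 0"
    and g_nonneg: "\<And>x. x \<ge> 0 \<Longrightarrow> g x \<ge> 0"
    and g_deriv: "\<And>x. x \<ge> 0 \<Longrightarrow> (g has_real_derivative g' x) (at x within {0..})"
    and g'_cont: "continuous_on {0..} g'"
    and C2_0: "C2_near g 0"
    and K_pos: "K > 0"
    and equilibria: "{a. a \<ge> 0 \<and> g a = a} = {0, K}"
    and K_stable: "exp_asymp_stable g h K"
    and p_gt1: "g' 0 > 1"
    and K_glob: "globally_attracting g h K"
begin

sublocale dispersion "g' 0" h by unfold_locales (rule p_gt1 h_pos)+

abbreviation p where "p \<equiv> g' 0"

text \<open>A \<open>C\<^sup>1\<close> extension of \<open>g\<close> to the whole line: the contraction arguments do not know a priori that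
  the profiles are nonnegative.\<close>

definition G where "G x = (if x < 0 then p * x else g x)"
definition G1 where "G1 x = g' (max 0 x)"

lemma G_0: "G 0 = 0" and G_K: "G K = K"
  using equilibria K_pos by (auto simp: G_def)

lemma G_nonneg: "x \<ge> 0 \<Longrightarrow> G x \<ge> 0" using g_nonneg by (simp add: G_def)

lemma G1_continuous: "continuous_on S G1"
  unfolding G1_def by (rule continuous_on_compose2[OF g'_cont]) (auto intro!: continuous_intros)

section \<open>Smoothness and remainder estimates for the extended nonlinearity\<close>

lemma G_deriv: "(G has_real_derivative G1 x) (at x)"
proof -
  consider "x < 0" | "x > 0" | "x = 0" by linarith
  then show ?thesis
  proof cases
    case 1
    have "((\<lambda>x. p * x) has_real_derivative p) (at x)" by (auto intro!: derivative_eq_intros)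
    then have "(G has_real_derivative p) (at x)"
      by (rule has_field_derivative_transform_within_open[of _ _ _ "{..<0}"]) (use 1 in \<open>auto simp: G_def\<close>)
    then show ?thesis using 1 by (simp add: G1_def)
  next
    case 2
    have "at x within {0..} = at x" using 2 by (intro at_within_interior) auto
    then have "(g has_real_derivative g' x) (at x)" using g_deriv[of x] 2 by simp
    then have "(G has_real_derivative g' x) (at x)"
      by (rule has_field_derivative_transform_within_open[of _ _ _ "{0<..}"]) (use 2 in \<open>auto simp: G_def\<close>)
    then show ?thesis using 2 by (simp add: G1_def)
  next
    case 3
    have g0: "g 0 = 0" using G_0 by (simp add: G_def)
    have "((\<lambda>x. (g x - g 0) / (x - 0)) \<longlongrightarrow> p) (at 0 within {0..})"
      using g_deriv[of 0] by (simp add: has_field_derivative_iff)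
    then have r: "((\<lambda>x. (g x - g 0) / (x - 0)) \<longlongrightarrow> p) (at_right 0)"
      by (rule tendsto_within_subset) auto
    have "((\<lambda>x. (G x - G 0) / (x - 0)) \<longlongrightarrow> p) (at_right 0)"
      by (rule Lim_transform_eventually[OF r])
        (auto simp: eventually_at_filter G_def g0 intro!: always_eventually)
    moreover have "((\<lambda>x. (G x - G 0) / (x - 0)) \<longlongrightarrow> p) (at_left 0)"
      by (rule Lim_transform_eventually[OF tendsto_const])
        (auto simp: eventually_at_filter G_def g0 intro!: always_eventually)
    ultimately show ?thesis using 3
      by (simp add: has_field_derivative_iff filterlim_split_at G1_def)
  qed
qed

lemma G_continuous: "continuous_on S G"
  using G_deriv by (meson DERIV_isCont continuous_at_imp_continuous_on)

lemma G_mvt: obtains z where "min x y \<le> z" "z \<le> max x y" "G x - G y = G1 z * (x - y)"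
proof -
  have *: "\<exists>z\<ge>x. z \<le> y \<and> G y - G x = G1 z * (y - x)" if xy: "x < y" for x y
  proof -
    obtain z where z: "z > x" "z < y" "G y - G x = (y - x) * G1 z"
      using MVT2[of x y G G1] xy G_deriv by blast
    then show ?thesis by (intro exI[of _ z]) auto
  qed
  consider "x < y" | "y < x" | "x = y" by linarith
  then show ?thesis
  proof cases
    case 1 then show ?thesis using *[of x y] that by (auto simp: algebra_simps)
  next
    case 2 then show ?thesis using *[of y x] that by auto
  next
    case 3 then show ?thesis using that[of x] by auto
  qed
qed

lemma G_lipschitz: "\<exists>L>0. (\<forall>x y. \<bar>x\<bar> \<le> R \<longrightarrow> \<bar>y\<bar> \<le> R \<longrightarrow> \<bar>G x - G y\<bar> \<le> L * \<bar>x - y\<bar>)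
   \<and> (\<forall>x. \<bar>x\<bar> \<le> R \<longrightarrow> \<bar>G1 x\<bar> \<le> L)"
proof -
  have "bounded (G1 ` {-R..R})"
    by (intro compact_imp_bounded compact_continuous_image G1_continuous) auto
  then obtain L where L: "L > 0" "\<And>x. x \<in> {-R..R} \<Longrightarrow> \<bar>G1 x\<bar> \<le> L"
    unfolding bounded_pos by auto
  show ?thesis
  proof (intro exI[of _ L] conjI allI impI)
    show "L > 0" by fact
    fix x y assume xy: "\<bar>x\<bar> \<le> R" "\<bar>y\<bar> \<le> R"
    obtain z where z: "min x y \<le> z" "z \<le> max x y" "G x - G y = G1 z * (x - y)" by (rule G_mvt)
    have "z \<in> {-R..R}" using z xy by auto
    then show "\<bar>G x - G y\<bar> \<le> L * \<bar>x - y\<bar>" using L z by (simp add: abs_mult mult_right_mono)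
  next
    fix x assume "\<bar>x\<bar> \<le> R" then show "\<bar>G1 x\<bar> \<le> L" using L(2)[of x] by (simp add: abs_le_iff)
  qed
qed

text \<open>Strict differentiability, uniform in the base point \<open>a\<close>: with two free
  points x and y near \<open>a\<close> it yields Lipschitz estimates for the remainder of the
  linearization, as contraction arguments require.\<close>

lemma G_uniform_diff:
  assumes "\<omega> > 0"
  shows "\<exists>\<delta>>0. (\<forall>a x y. \<bar>a\<bar> \<le> R \<longrightarrow> \<bar>x - a\<bar> \<le> \<delta> \<longrightarrow> \<bar>y - a\<bar> \<le> \<delta> \<longrightarrow>
      \<bar>G x - G y - G1 a * (x - y)\<bar> \<le> \<omega> * \<bar>x - y\<bar>)
    \<and> (\<forall>a x. \<bar>a\<bar> \<le> R \<longrightarrow> \<bar>x - a\<bar> \<le> \<delta> \<longrightarrow> \<bar>G1 x - G1 a\<bar> \<le> \<omega>)"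
proof -
  have "uniformly_continuous_on {-R-1..R+1} G1"
    by (intro compact_uniformly_continuous G1_continuous) auto
  then obtain d where d: "d > 0" "\<And>x y. x \<in> {-R-1..R+1} \<Longrightarrow> y \<in> {-R-1..R+1} \<Longrightarrow> \<bar>x - y\<bar> < d \<Longrightarrow> \<bar>G1 x - G1 y\<bar> < \<omega>"
    using assms unfolding uniformly_continuous_on_def dist_real_def by (metis abs_minus_commute)
  define \<delta> where "\<delta> = min 1 (d / 2)"
  have near: "\<bar>G1 x - G1 a\<bar> \<le> \<omega>" if "\<bar>a\<bar> \<le> R" "\<bar>x - a\<bar> \<le> \<delta>" for a x
  proof -
    have "\<bar>x - a\<bar> \<le> 1" "\<bar>x - a\<bar> \<le> d / 2" using that by (auto simp: \<delta>_def)
    then have "x \<in> {-R-1..R+1}" "a \<in> {-R-1..R+1}" "\<bar>x - a\<bar> < d"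
      using that(1) d(1) unfolding atLeastAtMost_iff by linarith+
    then show ?thesis using d(2) by (simp add: less_imp_le)
  qed
  show ?thesis
  proof (intro exI[of _ \<delta>] conjI allI impI)
    show "\<delta> > 0" using d by (simp add: \<delta>_def)
    fix a x y assume a: "\<bar>a\<bar> \<le> R" and xy: "\<bar>x - a\<bar> \<le> \<delta>" "\<bar>y - a\<bar> \<le> \<delta>"
    obtain z where z: "min x y \<le> z" "z \<le> max x y" "G x - G y = G1 z * (x - y)" by (rule G_mvt)
    have "\<bar>z - a\<bar> \<le> \<delta>" using z xy by auto
    then have "\<bar>G1 z - G1 a\<bar> \<le> \<omega>" using near a by blast
    moreover have "G x - G y - G1 a * (x - y) = (G1 z - G1 a) * (x - y)" using z by (simp add: algebra_simps)
    ultimately show "\<bar>G x - G y - G1 a * (x - y)\<bar> \<le> \<omega> * \<bar>x - y\<bar>" by (simp add: abs_mult mult_right_mono)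
  qed (use near in auto)
qed

text \<open>For x \<le> 0 the remainder vanishes because the extension is linear there; near 0 the
  bounded second derivative and two mean value steps give the square; away from 0 a linear bound
  becomes quadratic at the price of a large constant.\<close>

lemma G_quadratic: "\<exists>C>0. \<forall>x. \<bar>x\<bar> \<le> R \<longrightarrow> \<bar>G x - p * x\<bar> \<le> C * x\<^sup>2"
proof -
  obtain e g1 g2 where e: "e > 0" and D: "\<And>x. x \<in> {0..} \<inter> {0 - e<..<0 + e} \<Longrightarrow>
      (g has_real_derivative g1 x) (at x within {0..} \<inter> {0 - e<..<0 + e}) \<and>
      (g1 has_real_derivative g2 x) (at x within {0..} \<inter> {0 - e<..<0 + e})"
    and g2: "continuous_on ({0..} \<inter> {0 - e<..<0 + e}) g2"
    using C2_0 unfolding C2_near_def Let_def by blast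
  define S where "S = {0..} \<inter> {0 - e<..<0 + e}"
  have atS: "at x within S = at x" if "0 < x" "x < e" for x
    using that by (intro at_within_interior) (auto simp: S_def interior_Int)
  have g0: "g 0 = 0" using G_0 by (simp add: G_def)
  have Sr: "at 0 within {0<..<e} = at_right (0::real)"
    by (rule at_within_nhd[of _ "{..<e}"]) (use e in auto)
  \<comment> \<open>\<open>C2_near\<close> supplies a first derivative \<open>g1\<close> of its own;
    it has to be identified with \<open>g'\<close>, at 0 and in the open interval.\<close>
  have "((\<lambda>x. (g x - g 0) / (x - 0)) \<longlongrightarrow> g1 0) (at 0 within {0<..<e})"
    by (rule tendsto_within_subset[of _ _ _ S]) (use D[of 0] e in \<open>auto simp: has_field_derivative_iff S_def\<close>)
  moreover have "((\<lambda>x. (g x - g 0) / (x - 0)) \<longlongrightarrow> p) (at 0 within {0<..<e})"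
    by (rule tendsto_within_subset[of _ _ _ "{0..}"]) (use g_deriv[of 0] in \<open>auto simp: has_field_derivative_iff\<close>)
  ultimately have g10: "g1 0 = p" unfolding Sr by (rule tendsto_unique[rotated]) simp
  have g1x: "g1 x = g' x" if "0 < x" "x < e" for x
  proof -
    have "at x within {0..} = at x" using that by (intro at_within_interior) auto
    then have "(g has_real_derivative g' x) (at x)" using g_deriv[of x] that by simp
    moreover have "(g has_real_derivative g1 x) (at x)" using D[of x] that atS[of x] unfolding S_def[symmetric] by (auto simp: S_def)
    ultimately show ?thesis by (rule DERIV_unique[symmetric])
  qed
  have "bounded (g2 ` {0..e/2})"
    by (intro compact_imp_bounded compact_continuous_image continuous_on_subset[OF g2]) (use e in auto)
  then obtain C0 where C0: "C0 > 0" "\<And>x. x \<in> {0..e/2} \<Longrightarrow> \<bar>g2 x\<bar> \<le> C0"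
    unfolding bounded_pos by auto
  have b1: "\<bar>g' x - p\<bar> \<le> C0 * x" if x: "0 < x" "x \<le> e/2" for x
  proof -
    have "continuous_on {0..x} g1"
    proof (rule continuous_on_subset[of S])
      show "continuous_on S g1" using D DERIV_continuous
        by (fastforce simp: continuous_on_eq_continuous_within S_def)
    qed (use x e in \<open>auto simp: S_def\<close>)
    moreover have "(g1 has_derivative (*) (g2 y)) (at y)" if "0 < y" "y < x" for y
      using D[of y] atS[of y] that x unfolding S_def[symmetric] by (auto simp: S_def has_field_derivative_def)
    ultimately obtain z where z: "z > 0" "z < x" "g1 x - g1 0 = g2 z * (x - 0)"
      using mvt[OF x(1), of g1 "\<lambda>y. (*) (g2 y)"] by auto
    then show ?thesis using g1x[of x] g10 C0(2)[of z] x e by (simp add: abs_mult mult_right_mono)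
  qed
  obtain L where L: "L > 0" "\<forall>x y. \<bar>x\<bar> \<le> R \<longrightarrow> \<bar>y\<bar> \<le> R \<longrightarrow> \<bar>G x - G y\<bar> \<le> L * \<bar>x - y\<bar>"
    using G_lipschitz[of R] by blast
  \<comment> \<open>The second summand serves e / 2 < x, where x \<le> (2 / e) x^2.\<close>
  define C where "C = C0 + (L + p) * (2 / e)"
  show ?thesis
  proof (intro exI[of _ C] conjI allI impI)
    show "C > 0" using C0 L p_gt1 e by (simp add: C_def add_pos_nonneg)
    fix x assume x: "\<bar>x\<bar> \<le> R"
    have Cx: "C * x\<^sup>2 = C0 * x\<^sup>2 + (L + p) * (2 / e) * x\<^sup>2" by (simp add: C_def algebra_simps)
    have nn: "C0 * x\<^sup>2 \<ge> 0" "(L + p) * (2 / e) * x\<^sup>2 \<ge> 0" using C0 L p_gt1 e by auto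
    consider "x \<le> 0" | "0 < x" "x \<le> e / 2" | "e / 2 < x" by linarith
    then show "\<bar>G x - p * x\<bar> \<le> C * x\<^sup>2"
    proof cases
      case 1
      then have "G x = p * x" using G_0 by (cases "x = 0") (auto simp: G_def)
      then show ?thesis using nn Cx by simp
    next
      case 2
      obtain z where z: "min x 0 \<le> z" "z \<le> max x 0" "G x - G 0 = G1 z * (x - 0)" by (rule G_mvt)
      have "\<bar>G1 z - p\<bar> \<le> C0 * x"
      proof (cases "z = 0")
        case True then show ?thesis using C0 2 by (simp add: G1_def)
      next
        case False
        then have "\<bar>g' z - p\<bar> \<le> C0 * z" using b1[of z] z 2 by auto
        also have "\<dots> \<le> C0 * x" using z 2 C0 by auto
        finally show ?thesis using z 2 by (simp add: G1_def)
      qed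
      then have "\<bar>G1 z - p\<bar> * x \<le> C0 * x * x" using 2 by (intro mult_right_mono) auto
      moreover have "\<bar>G x - p * x\<bar> = \<bar>(G1 z - p) * x\<bar>" using z(3) G_0 by (simp add: algebra_simps)
      ultimately have "\<bar>G x - p * x\<bar> \<le> C0 * x\<^sup>2" using 2 by (simp add: abs_mult power2_eq_square)
      then show ?thesis using nn Cx by linarith
    next
      case 3
      have "\<bar>G x\<bar> \<le> L * x" using L(2)[rule_format, of x 0] x 3 e G_0 by simp
      then have "\<bar>G x - p * x\<bar> \<le> (L + p) * x" using 3 e p_gt1
        by (simp add: abs_le_iff algebra_simps) (smt (verit) mult_nonneg_nonneg)
      also have "\<dots> \<le> (L + p) * (x * (2 / e) * x)"
      proof (rule mult_left_mono)
        have "1 \<le> x * (2 / e)" using 3 e by (simp add: field_simps)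
        then have "1 * x \<le> x * (2 / e) * x" using 3 e by (intro mult_right_mono) auto
        then show "x \<le> x * (2 / e) * x" by simp
      qed (use L p_gt1 in auto)
      also have "\<dots> = (L + p) * (2 / e) * x\<^sup>2" by (simp add: power2_eq_square)
      finally show ?thesis using nn Cx by linarith
    qed
  qed
qed

text \<open>Subtracting \<open>exp (\<lambda> t)\<close> and clamping the nonlinearity near \<open>0\<close> gives a contraction for the weight
  \<open>exp (2 \<lambda> t)\<close> on the whole line, because \<open>p exp (- 2 \<lambda> h) < 1 + 2 \<lambda>\<close>.\<close>

lemma strong_unstable_solution:
  "\<exists>f D T0. continuous_on UNIV f \<and> D > 0 \<and> (\<forall>t. \<bar>f t - exp (lm * t)\<bar> \<le> D * exp (2 * lm * t)) \<and>
    (\<forall>t\<le>T0. f t > 0) \<and>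
    (\<forall>t\<le>T0 + h. (f has_real_derivative - f t + G (f (t - h))) (at t))"
proof -
  note l = lam_props(1)
  define \<beta> where "\<beta> = 2 * lm"
  have b: "\<beta> > 0" "p * exp (- \<beta> * h) < 1 + \<beta>" using l beyond_lam[of \<beta>] by (simp_all add: \<beta>_def)
  \<comment> \<open>Half of the gap in p exp (- \<beta> h) < 1 + \<beta>: the slope of
    \<open>G\<close> near 0 may exceed p by q and the operator still contracts.\<close>
  define q where "q = (1 + \<beta> - p * exp (- \<beta> * h)) / 2"
  have q: "q > 0" using b by (simp add: q_def)
  have "q * exp (- \<beta> * h) \<le> q * 1" using b h_pos q by (intro mult_left_mono) auto
  then have pq: "(p + q) * exp (- \<beta> * h) < 1 + \<beta>" using b by (simp add: q_def field_simps)
  obtain \<delta> where d: "\<delta> > 0" "\<And>x y. \<bar>x\<bar> \<le> \<delta> \<Longrightarrow> \<bar>y\<bar> \<le> \<delta> \<Longrightarrow> \<bar>G x - G y - p * (x - y)\<bar> \<le> q * \<bar>x - y\<bar>"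
  proof -
    obtain \<delta> where d: "\<delta> > 0" "\<forall>a x y. \<bar>a\<bar> \<le> 0 \<longrightarrow> \<bar>x - a\<bar> \<le> \<delta> \<longrightarrow> \<bar>y - a\<bar> \<le> \<delta> \<longrightarrow>
      \<bar>G x - G y - G1 a * (x - y)\<bar> \<le> q * \<bar>x - y\<bar>"
      using G_uniform_diff[OF q, of 0] by blast
    show ?thesis using that[OF d(1)] d(2)[rule_format, of 0] by (simp add: G1_def)
  qed
  obtain C where C: "C > 0" "\<And>x. \<bar>x\<bar> \<le> \<delta> \<Longrightarrow> \<bar>G x - p * x\<bar> \<le> C * x\<^sup>2" using G_quadratic[of \<delta>] by blast
  \<comment> \<open>Clamping to [- \<delta>, \<delta>] makes the remainder globally Lipschitz with
    the small constant q; where the solution stays below \<delta> the original equation is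
    recovered.\<close>
  define cl where "cl x = max (- \<delta>) (min \<delta> x)" for x
  have cl: "\<bar>cl x\<bar> \<le> \<delta>" "\<bar>cl x\<bar> \<le> \<bar>x\<bar>" "\<bar>cl x - cl y\<bar> \<le> \<bar>x - y\<bar>" for x y using d by (auto simp: cl_def)
  have cl_id: "\<bar>x\<bar> \<le> \<delta> \<Longrightarrow> cl x = x" for x by (auto simp: cl_def)
  define r where "r x = G (cl x) - p * cl x" for x
  have r_lip: "\<bar>r x - r y\<bar> \<le> q * \<bar>x - y\<bar>" for x y
  proof -
    have "r x - r y = G (cl x) - G (cl y) - p * (cl x - cl y)" by (simp add: r_def algebra_simps)
    then have "\<bar>r x - r y\<bar> \<le> q * \<bar>cl x - cl y\<bar>" using d(2)[of "cl x" "cl y"] cl by simp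
    also have "\<dots> \<le> q * \<bar>x - y\<bar>" using q cl by simp
    finally show ?thesis .
  qed
  have r_quad: "\<bar>r x\<bar> \<le> C * x\<^sup>2" for x
  proof -
    have "\<bar>r x\<bar> \<le> C * (cl x)\<^sup>2" using C(2)[of "cl x"] cl by (simp add: r_def)
    also have "\<dots> \<le> C * x\<^sup>2" using C(1) cl(2)[of x] by (simp add: abs_le_square_iff)
    finally show ?thesis .
  qed
  have r_cont: "continuous_on UNIV r" unfolding r_def cl_def
    by (intro continuous_intros continuous_on_compose2[OF G_continuous[of UNIV]]) auto
  define z where "z y u = p * y u + r (exp (lm * u) + y u)" for y u
  define TT where "TT y t = past_avg 1 (z y) (t - h)" for y t
  define \<theta> where "\<theta> = (p + q) * exp (- \<beta> * h) / (1 + \<beta>)"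
  have th: "0 \<le> \<theta>" "\<theta> < 1" using pq b p_gt1 q by (auto simp: \<theta>_def)
  \<comment> \<open>The fixed point of D -> \<theta> D + C exp (- \<beta> h) / (1 + \<beta>), so
    that the ball of radius D is mapped into itself.\<close>
  define D where "D = C * exp (- \<beta> * h) / (1 + \<beta>) / (1 - \<theta>)"
  have D0: "D > 0" using C b th by (simp add: D_def)
  have Deq: "\<theta> * D + C * exp (- \<beta> * h) / (1 + \<beta>) = D" 
  proof -
    have "\<theta> * (A / (1 - \<theta>)) + A = A / (1 - \<theta>)" for A using th by (simp add: field_simps)
    then show ?thesis unfolding D_def .
  qed
  have zc: "continuous_on UNIV (z y)" if "continuous_on UNIV y" for y
    unfolding z_def by (intro continuous_intros that continuous_on_compose2[OF r_cont]) auto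
  have zb: "\<bar>z y u\<bar> \<le> ((p + q) * D + C) * exp (\<beta> * u)" if "\<And>t. \<bar>y t\<bar> \<le> D * exp (\<beta> * t)" for y u
  proof -
    have "\<bar>r (exp (lm * u) + y u)\<bar> \<le> \<bar>r (exp (lm * u))\<bar> + q * \<bar>y u\<bar>" using r_lip[of "exp (lm * u) + y u" "exp (lm * u)"] by simp
    also have "\<bar>r (exp (lm * u))\<bar> \<le> C * exp (\<beta> * u)" using r_quad[of "exp (lm * u)"] by (simp add: \<beta>_def exp_double[symmetric] mult.assoc)
    finally have "\<bar>z y u\<bar> \<le> p * \<bar>y u\<bar> + (C * exp (\<beta> * u) + q * \<bar>y u\<bar>)"
      using abs_triangle_ineq[of "p * y u" "r (exp (lm * u) + y u)"] p_gt1 by (simp add: z_def abs_mult)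
    also have "\<dots> = (p + q) * \<bar>y u\<bar> + C * exp (\<beta> * u)" by (simp add: algebra_simps)
    also have "\<dots> \<le> (p + q) * (D * exp (\<beta> * u)) + C * exp (\<beta> * u)" using that[of u] p_gt1 q C(1) by (intro add_mono mult_left_mono) auto
    finally show ?thesis by (simp add: algebra_simps)
  qed
  have b1: "1 + \<beta> > 0" using b by simp
  have shift: "exp (b * (t - h)) = exp (- b * h) * exp (b * t)" for b t
    by (simp add: exp_add[symmetric] right_diff_distrib)
  have "\<exists>y. continuous_on UNIV y \<and> (\<forall>t. \<bar>y t\<bar> \<le> D * exp (\<beta> * t)) \<and> TT y = y"
  proof (rule weighted_fixpoint[of "\<lambda>t. exp (\<beta> * t)" D \<theta> TT])
    show "continuous_on UNIV (\<lambda>t. exp (\<beta> * t))" by (intro continuous_intros)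
    show "0 < exp (\<beta> * t)" for t by simp
    show "0 \<le> D" "0 \<le> \<theta>" "\<theta> < 1" using D0 th by auto
  next
    fix y assume y: "continuous_on UNIV y" "\<And>t. \<bar>y t\<bar> \<le> D * exp (\<beta> * t)"
    have "continuous_on UNIV (past_avg 1 (z y))"
      by (rule past_avg_continuous[OF zc[OF y(1)] b1]) (use zb[OF y(2)] in blast)
    then have "continuous_on UNIV (TT y)" unfolding TT_def
      by (rule continuous_on_compose2) (auto intro!: continuous_intros)
    moreover have "\<bar>TT y t\<bar> \<le> D * exp (\<beta> * t)" for t
    proof -
      have "\<bar>TT y t\<bar> \<le> ((p + q) * D + C) / (1 + \<beta>) * exp (\<beta> * (t - h))"
        unfolding TT_def by (rule past_avg_bound[OF b1 zc[OF y(1)] zb[OF y(2)]])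
      also have "\<dots> = (\<theta> * D + C * exp (- \<beta> * h) / (1 + \<beta>)) * exp (\<beta> * t)"
        unfolding shift \<theta>_def by (simp add: add_divide_distrib distrib_left distrib_right mult_ac)
      finally show ?thesis using Deq by simp
    qed
    ultimately show "continuous_on UNIV (TT y) \<and> (\<forall>t. \<bar>TT y t\<bar> \<le> D * exp (\<beta> * t))" by blast
  next
    fix y y' E t assume y: "continuous_on UNIV y" "\<And>t. \<bar>y t\<bar> \<le> D * exp (\<beta> * t)"
      and y': "continuous_on UNIV y'" "\<And>t. \<bar>y' t\<bar> \<le> D * exp (\<beta> * t)"
      and E: "E \<ge> 0" "\<And>t. \<bar>y t - y' t\<bar> \<le> E * exp (\<beta> * t)"
    have "TT y t - TT y' t = past_avg 1 (\<lambda>u. z y u - z y' u) (t - h)"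
      unfolding TT_def by (rule past_avg_diff[symmetric])
        (rule past_avg_integrable[OF b1 zc[OF y(1)] zb[OF y(2)]], rule past_avg_integrable[OF b1 zc[OF y'(1)] zb[OF y'(2)]])
    also have "\<bar>\<dots>\<bar> \<le> ((p + q) * E) / (1 + \<beta>) * exp (\<beta> * (t - h))"
    proof (rule past_avg_bound[OF b1])
      show "continuous_on UNIV (\<lambda>u. z y u - z y' u)" by (intro continuous_intros zc y y')
      fix u
      have "\<bar>z y u - z y' u\<bar> \<le> \<bar>p * (y u - y' u)\<bar> + \<bar>r (exp (lm * u) + y u) - r (exp (lm * u) + y' u)\<bar>"
        unfolding z_def by (simp add: right_diff_distrib)
      also have "\<dots> \<le> p * \<bar>y u - y' u\<bar> + q * \<bar>y u - y' u\<bar>"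
        using r_lip[of "exp (lm * u) + y u" "exp (lm * u) + y' u"] p_gt1 by (simp add: abs_mult)
      also have "\<dots> = (p + q) * \<bar>y u - y' u\<bar>" by (simp add: distrib_right)
      also have "\<dots> \<le> (p + q) * (E * exp (\<beta> * u))" using E p_gt1 q by (intro mult_left_mono) auto
      finally show "\<bar>z y u - z y' u\<bar> \<le> (p + q) * E * exp (\<beta> * u)" by (simp add: mult.assoc)
    qed
    also have "\<dots> = \<theta> * E * exp (\<beta> * t)"
      unfolding shift \<theta>_def by (simp add: mult_ac)
    finally show "\<bar>TT y t - TT y' t\<bar> \<le> \<theta> * E * exp (\<beta> * t)" .
  qed
  then obtain y where y: "continuous_on UNIV y" "\<And>t. \<bar>y t\<bar> \<le> D * exp (\<beta> * t)" "TT y = y" by blast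
  define f where "f t = exp (lm * t) + y t" for t
  have y_deriv: "(y has_real_derivative z y (t - h) - y t) (at t)" for t
  proof -
    have "(past_avg 1 (z y) has_real_derivative z y (t - h) - 1 * past_avg 1 (z y) (t - h)) (at (t - h))"
      by (rule past_avg_deriv[OF zc[OF y(1)] b1]) (use zb[OF y(2)] in blast)
    then have "(past_avg 1 (z y) has_real_derivative z y (t - h) - y t) (at (t - h))"
      using fun_cong[OF y(3), of t] by (simp add: TT_def)
    from DERIV_delay[OF this]
    have "((\<lambda>t. past_avg 1 (z y) (t - h)) has_real_derivative z y (t - h) - y t) (at t)" .
    moreover have "(\<lambda>t. past_avg 1 (z y) (t - h)) = y" using y(3) by (auto simp: TT_def fun_eq_iff)
    ultimately show ?thesis by simp
  qed
  have f_deriv: "(f has_real_derivative - f t + (p * f (t - h) + r (f (t - h)))) (at t)" for t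
  proof -
    have "lm * exp (lm * t) = - exp (lm * t) + p * exp (lm * (t - h))"
    proof -
      have "p * exp (lm * (t - h)) = (p * exp (- lm * h)) * exp (lm * t)" unfolding shift by simp
      then show ?thesis by (simp only: lam_props(2)) (simp add: algebra_simps)
    qed
    then show ?thesis unfolding f_def
      by (auto intro!: derivative_eq_intros y_deriv simp: z_def algebra_simps)
  qed
  \<comment> \<open>The first bound makes |y(t)| at most half of exp (\<lambda> t), which gives
    positivity; with the second, f stays below \<delta> and the clamp is inactive.\<close>
  define c where "c = min (1 / (2 * (D + 1))) (\<delta> / 2)"
  define T0 where "T0 = ln c / lm"
  have c0: "c > 0" using D0 d by (simp add: c_def)
  have small: "exp (lm * t) \<le> c" if "t \<le> T0" for t
  proof -
    have "lm * t \<le> ln c" using that l by (simp add: T0_def field_simps)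
    then show ?thesis using c0 by (metis exp_ln exp_le_cancel_iff)
  qed
  have ybd: "\<bar>y t\<bar> \<le> exp (lm * t) / 2" if "t \<le> T0" for t
  proof -
    have "D * exp (lm * t) \<le> D * (1 / (2 * (D + 1)))" using small[OF that] D0 by (intro mult_left_mono) (auto simp: c_def)
    also have "\<dots> \<le> 1/2" using D0 by (simp add: field_simps)
    finally have "D * exp (lm * t) * exp (lm * t) \<le> 1/2 * exp (lm * t)" by (intro mult_right_mono) auto
    moreover have "exp (\<beta> * t) = exp (lm * t) * exp (lm * t)" by (simp add: \<beta>_def exp_add[symmetric])
    ultimately have "D * exp (\<beta> * t) \<le> 1/2 * exp (lm * t)" by (simp only: mult.assoc)
    then show ?thesis using y(2)[of t] by linarith
  qed
  show ?thesis
  proof (rule exI[of _ f], rule exI[of _ D], rule exI[of _ T0], intro conjI allI impI)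
    show "continuous_on UNIV f" unfolding f_def by (intro continuous_intros y)
    show "D > 0" by fact
    show "\<bar>f t - exp (lm * t)\<bar> \<le> D * exp (2 * lm * t)" for t using y(2)[of t] by (simp add: f_def \<beta>_def)
    show fp: "f t > 0" if "t \<le> T0" for t
      using ybd[OF that] exp_gt_zero[of "lm * t"] unfolding f_def by linarith
    fix t assume t: "t \<le> T0 + h"
    have "exp (lm * (t - h)) \<le> \<delta> / 2" using small[of "t - h"] t by (simp add: c_def)
    then have "\<bar>f (t - h)\<bar> \<le> \<delta>" using ybd[of "t - h"] t unfolding f_def by linarith
    then show "(f has_real_derivative - f t + G (f (t - h))) (at t)"
      using f_deriv[of t] by (simp add: r_def cl_id)
  qed
qed

end

section \<open>The heteroclinic solution\<close>

lemma DERIV_advance: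
  fixes f :: "real \<Rightarrow> real"
  assumes "(f has_real_derivative D) (at (c + t))"
  shows "((\<lambda>t. f (c + t)) has_real_derivative D) (at t)"
  using DERIV_shift[of f D t c] assms by (simp add: add.commute)

lemma bounded_if_bounded_left_tendsto:
  fixes f :: "real \<Rightarrow> real"
  assumes "continuous_on UNIV f" "\<And>t. t \<le> a \<Longrightarrow> \<bar>f t\<bar> \<le> B" "(f \<longlongrightarrow> L) at_top"
  shows "\<exists>C>0. \<forall>t. \<bar>f t\<bar> \<le> C"
proof -
  have "\<forall>\<^sub>F t in at_top. dist (f t) L < 1" using assms(3) by (rule tendstoD) simp
  then obtain N where N: "\<And>t. t \<ge> N \<Longrightarrow> \<bar>f t - L\<bar> < 1"
    unfolding eventually_at_top_linorder dist_real_def by blast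
  have "bounded (f ` {a..N})"
    by (intro compact_imp_bounded compact_continuous_image continuous_on_subset[OF assms(1)]) auto
  then obtain C where "\<forall>x\<in>f ` {a..N}. norm x \<le> C" unfolding bounded_iff by blast
  then have C: "\<bar>f t\<bar> \<le> C" if "t \<in> {a..N}" for t using that by simp
  have "\<bar>f t\<bar> \<le> \<bar>B\<bar> + \<bar>C\<bar> + \<bar>L\<bar> + 1" for t
  proof -
    consider "t \<le> a" | "t \<in> {a..N}" | "t \<ge> N" by fastforce
    then show ?thesis
    proof cases
      case 1 then show ?thesis using assms(2)[of t] by linarith
    next
      case 2 then show ?thesis using C[of t] by linarith
    next
      case 3 then show ?thesis using N[of t] by linarith
    qed
  qed
  then show ?thesis by (intro exI[of _ "\<bar>B\<bar> + \<bar>C\<bar> + \<bar>L\<bar> + 1"]) auto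
qed

context wave
begin

text \<open>The unstable solution is continued past T0 by the method of steps, and global
  attractivity, applied to its positive history on an interval of length \<open>h\<close>, supplies
  the limit \<open>K\<close>.\<close>

lemma heteroclinic_ode:
  "\<exists>\<psi>. (\<forall>t. \<psi> t > 0) \<and> (\<forall>t. (\<psi> has_real_derivative - \<psi> t + G (\<psi> (t - h))) (at t)) \<and>
    (\<exists>D>0. \<forall>t. \<bar>\<psi> t - exp (lm * t)\<bar> \<le> D * exp (2 * lm * t)) \<and> (\<psi> \<longlongrightarrow> K) at_top \<and>
    (\<exists>B>0. \<forall>t. \<bar>\<psi> t\<bar> \<le> B)"
proof -
  note l = lam_props(1)
  obtain f D T0 where f: "continuous_on UNIV f" "D > 0" "\<And>t. \<bar>f t - exp (lm * t)\<bar> \<le> D * exp (2 * lm * t)"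
    "\<And>t. t \<le> T0 \<Longrightarrow> f t > 0"
    "\<And>t. t \<le> T0 + h \<Longrightarrow> (f has_real_derivative - f t + G (f (t - h))) (at t)"
    using strong_unstable_solution by blast
  define phi where "phi s = f (T0 + s)" for s
  have phic: "continuous_on {-h..0} phi" unfolding phi_def
    by (rule continuous_on_compose2[OF f(1)]) (auto intro!: continuous_intros)
  obtain u where u: "continuous_on UNIV u" "\<And>t. t \<in> {-h..0} \<Longrightarrow> u t = phi t"
    "\<And>t. t \<ge> 0 \<Longrightarrow> (u has_real_derivative - u t + G (u (t - h))) (at t within {0..})"
    using dde_steps[OF h_pos G_continuous phic] by blast
  have u0: "u 0 > 0" using u(2)[of 0] h_pos f(4)[of T0] by (simp add: phi_def)
  have hist: "u t \<ge> 0" if "t \<in> {-h..0}" for t using u(2)[OF that] f(4)[of "T0 + t"] that by (simp add: phi_def)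
  have ulow: "u t \<ge> exp (- t) * u 0" if "t \<ge> 0" for t
    by (rule dde_nonneg[OF h_pos G_nonneg hist u(3) that])
  have upos: "u t > 0" if "t \<ge> 0" for t
    using ulow[OF that] u0 by (smt (verit) exp_gt_zero mult_pos_pos)
  have unn: "u t \<ge> 0" if "t \<ge> -h" for t
    using hist[of t] upos[of t] that by (cases "t \<le> 0") (auto simp: less_imp_le)
  have "dde_solution g h phi u"
    unfolding dde_solution_def
  proof (intro conjI ballI allI impI)
    show "continuous_on {-h..} u" by (rule continuous_on_subset[OF u(1)]) simp
    fix t :: real assume "0 \<le> t"
    then have "G (u (t - h)) = g (u (t - h))" using unn[of "t - h"] by (simp add: G_def)
    then show "(u has_real_derivative - u t + g (u (t - h))) (at t within {0..})" using u(3)[OF \<open>0 \<le> t\<close>] by simp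
  qed (use u(2) in auto)
  moreover have "\<forall>s\<in>{-h..0}. phi s \<ge> 0" using hist u(2) by metis
  moreover have "\<exists>s\<in>{-h..0}. phi s \<noteq> 0" using u0 u(2)[of 0] h_pos by (intro bexI[of _ 0]) auto
  ultimately have uK: "(u \<longlongrightarrow> K) at_top" using K_glob phic unfolding globally_attracting_def by blast
  \<comment> \<open>The two pieces coincide on a whole interval around T0, not only at T0, so the
    derivative there can be taken from one of them.\<close>
  have agree: "u t = f (T0 + t)" if t: "-h \<le> t" "t \<le> h" for t
  proof (cases "t \<le> 0")
    case True then show ?thesis using u(2)[of t] t by (simp add: phi_def)
  next
    case False
    have "\<bar>(\<lambda>x. u x - f (T0 + x)) t\<bar> \<le> 0"
    proof (rule relax_bound[where s = 0 and v = "\<lambda>x. u x - f (T0 + x)" and q = "\<lambda>_. 0"])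
      show "0 \<le> t" using False by simp
      show "\<bar>u 0 - f (T0 + 0)\<bar> \<le> 0" using u(2)[of 0] h_pos by (simp add: phi_def)
      fix x assume x: "x \<in> {0..t}"
      have 1: "(u has_real_derivative - u x + G (u (x - h))) (at x within {0..t})"
        by (rule DERIV_subset[OF u(3)]) (use x in auto)
      have "(f has_real_derivative - f (T0 + x) + G (f (T0 + (x - h)))) (at (T0 + x))"
        using f(5)[of "T0 + x"] x t by (simp add: add_diff_eq)
      from has_field_derivative_at_within[OF DERIV_advance[OF this]]
      have 2: "((\<lambda>x. f (T0 + x)) has_real_derivative - f (T0 + x) + G (f (T0 + (x - h)))) (at x within {0..t})" .
      have 3: "u (x - h) = f (T0 + (x - h))" using u(2)[of "x - h"] x t by (simp add: phi_def)
      show "((\<lambda>x. u x - f (T0 + x)) has_real_derivative - (u x - f (T0 + x)) + 0) (at x within {0..t})"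
        using DERIV_diff[OF 1 2] 3 by simp
    qed auto
    then show ?thesis by simp
  qed
  define \<psi> where "\<psi> t = (if t \<le> T0 then f t else u (t - T0))" for t
  have psi_f: "\<psi> t = f t" if "t \<le> T0 + h" for t using agree[of "t - T0"] that h_pos by (auto simp: \<psi>_def)
  have psi_u: "\<psi> t = u (t - T0)" if "t \<ge> T0 - h" for t using agree[of "t - T0"] that h_pos by (auto simp: \<psi>_def)
  have pos: "\<psi> t > 0" for t using f(4)[of t] upos[of "t - T0"] by (simp add: \<psi>_def)
  have der: "(\<psi> has_real_derivative - \<psi> t + G (\<psi> (t - h))) (at t)" for t
  proof (cases "t \<le> T0")
    case True
    have "(\<psi> has_real_derivative - f t + G (f (t - h))) (at t)"
      by (rule has_field_derivative_transform_within_open[OF f(5), of _ "{..<T0+h}"])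
        (use True h_pos psi_f in auto)
    then show ?thesis using psi_f True h_pos by simp
  next
    case False
    have "at (t - T0) within {0..} = at (t - T0)" using False by (intro at_within_interior) auto
    then have "(u has_real_derivative - u (t - T0) + G (u (t - T0 - h))) (at (t - T0))"
      using u(3)[of "t - T0"] False by simp
    from DERIV_delay[OF this]
    have "((\<lambda>t. u (t - T0)) has_real_derivative - u (t - T0) + G (u (t - T0 - h))) (at t)" .
    then have "(\<psi> has_real_derivative - u (t - T0) + G (u (t - T0 - h))) (at t)"
      by (rule has_field_derivative_transform_within_open[of _ _ _ "{T0<..}"])
        (use False h_pos psi_u in auto)
    then show ?thesis using psi_u[of t] psi_u[of "t - h"] False h_pos by (simp add: algebra_simps)
  qed
  have psic: "continuous_on UNIV \<psi>" using der by (meson DERIV_isCont continuous_at_imp_continuous_on)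
  have lim: "(\<psi> \<longlongrightarrow> K) at_top"
  proof -
    have "filterlim (\<lambda>t. t - T0) at_top at_top" by real_asymp
    from filterlim_compose[OF uK this] have "((\<lambda>t. u (t - T0)) \<longlongrightarrow> K) at_top" .
    moreover have "\<forall>\<^sub>F t in at_top. u (t - T0) = \<psi> t"
      using eventually_ge_at_top[of "T0 - h"] by eventually_elim (simp add: psi_u)
    ultimately show ?thesis by (rule Lim_transform_eventually)
  qed
  have "\<bar>\<psi> t\<bar> \<le> exp (lm * T0) + D * exp (2 * lm * T0)" if "t \<le> T0" for t
  proof -
    have "exp (lm * t) \<le> exp (lm * T0)" "D * exp (2 * lm * t) \<le> D * exp (2 * lm * T0)"
      using that l f(2) by auto
    then show ?thesis using f(3)[of t] that exp_gt_zero[of "lm * t"] unfolding \<psi>_def by (simp only: if_True)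
  qed
  from bounded_if_bounded_left_tendsto[OF psic this lim]
  obtain B where B: "B > 0" "\<And>t. \<bar>\<psi> t\<bar> \<le> B" by blast
  \<comment> \<open>Beyond T0 the error is only known to be at most B + exp (\<lambda> t); the two
    extra summands dominate these two terms because t > T0.\<close>
  define D' where "D' = D + B * exp (- 2 * lm * T0) + exp (- lm * T0)"
  have "\<bar>\<psi> t - exp (lm * t)\<bar> \<le> D' * exp (2 * lm * t)" for t
  proof (cases "t \<le> T0")
    case True
    have "D * exp (2 * lm * t) \<le> D' * exp (2 * lm * t)" using B by (intro mult_right_mono) (auto simp: D'_def)
    then show ?thesis using order_trans[OF f(3)[of t]] True by (simp add: \<psi>_def)
  next
    case False
    have 1: "exp (- 2 * lm * T0) * exp (2 * lm * t) \<ge> 1" using False l by (simp add: exp_add[symmetric])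
    have "lm * t \<le> - lm * T0 + 2 * lm * t" using mult_left_mono[of T0 t lm] False l by (simp add: algebra_simps)
    then have 2: "exp (- lm * T0) * exp (2 * lm * t) \<ge> exp (lm * t)" by (simp add: exp_add[symmetric])
    have "\<bar>\<psi> t - exp (lm * t)\<bar> \<le> B * 1 + exp (lm * t)" using B(2)[of t] exp_gt_zero[of "lm * t"] by linarith
    also have "\<dots> \<le> B * (exp (- 2 * lm * T0) * exp (2 * lm * t)) + exp (- lm * T0) * exp (2 * lm * t)"
      using 1 2 B by (intro add_mono mult_left_mono) auto
    also have "\<dots> \<le> D' * exp (2 * lm * t)" using f(2) by (simp add: D'_def algebra_simps)
    finally show ?thesis .
  qed
  moreover have "D' > 0" using f(2) B by (simp add: D'_def add_pos_pos)
  ultimately show ?thesis using pos der lim B by (intro exI[of _ \<psi>]) blast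
qed

definition heteroclinic where "heteroclinic = (SOME \<psi>. (\<forall>t. \<psi> t > 0) \<and> (\<forall>t. (\<psi> has_real_derivative - \<psi> t + G (\<psi> (t - h))) (at t)) \<and>
    (\<exists>D>0. \<forall>t. \<bar>\<psi> t - exp (lm * t)\<bar> \<le> D * exp (2 * lm * t)) \<and> (\<psi> \<longlongrightarrow> K) at_top \<and>
    (\<exists>B>0. \<forall>t. \<bar>\<psi> t\<bar> \<le> B))"

lemma heteroclinic: "heteroclinic t > 0" "(heteroclinic has_real_derivative - heteroclinic t + G (heteroclinic (t - h))) (at t)"
    "\<exists>D>0. \<forall>t. \<bar>heteroclinic t - exp (lm * t)\<bar> \<le> D * exp (2 * lm * t)" "(heteroclinic \<longlongrightarrow> K) at_top"
    "\<exists>B>0. \<forall>t. \<bar>heteroclinic t\<bar> \<le> B"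
proof -
  from someI_ex[OF heteroclinic_ode, folded heteroclinic_def]
  show "heteroclinic t > 0" "(heteroclinic has_real_derivative - heteroclinic t + G (heteroclinic (t - h))) (at t)"
    "\<exists>D>0. \<forall>t. \<bar>heteroclinic t - exp (lm * t)\<bar> \<le> D * exp (2 * lm * t)" "(heteroclinic \<longlongrightarrow> K) at_top"
    "\<exists>B>0. \<forall>t. \<bar>heteroclinic t\<bar> \<le> B" by auto
qed

lemma heteroclinic_continuous: "continuous_on UNIV heteroclinic"
  using heteroclinic(2) by (meson DERIV_isCont continuous_at_imp_continuous_on)

text \<open>Stability in the form used later: for \<delta> \<le> K the initial data are
  automatically nonnegative, so that solutions for \<open>G\<close> are solutions for
  \<open>g\<close>, and any bound E replaces the supremum. The maximum with 1 makes the constant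
  positive.\<close>

lemma stable_K:
  "\<exists>\<delta>>0. \<exists>\<gamma>>0. \<exists>M>0. \<forall>u E t. continuous_on UNIV u \<longrightarrow>
     (\<forall>t\<ge>0. (u has_real_derivative - u t + G (u (t - h))) (at t within {0..})) \<longrightarrow>
     (\<forall>s\<in>{-h..0}. \<bar>u s - K\<bar> \<le> E) \<longrightarrow> E \<le> \<delta> \<longrightarrow> t \<ge> 0 \<longrightarrow> \<bar>u t - K\<bar> \<le> M * exp (- \<gamma> * t) * E"
proof -
  obtain d M \<gamma> where d: "d > 0" "\<gamma> > 0" and st: "\<And>phi u. continuous_on {-h..0} phi \<Longrightarrow> (\<forall>s\<in>{-h..0}. phi s \<ge> 0 \<and> \<bar>phi s - K\<bar> \<le> d)
            \<Longrightarrow> dde_solution g h phi u \<Longrightarrow>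
            (\<forall>t\<ge>0. \<bar>u t - K\<bar> \<le> M * exp (- \<gamma> * t) * (SUP s\<in>{-h..0}. \<bar>phi s - K\<bar>))"
    using K_stable unfolding exp_asymp_stable_def by blast
  define \<delta> where "\<delta> = min d K"
  show ?thesis
  proof (rule exI[of _ \<delta>], rule conjI[rotated], rule exI[of _ \<gamma>], rule conjI[rotated], rule exI[of _ "max M 1"], rule conjI[rotated], intro allI impI)
    show "\<delta> > 0" "\<gamma> > 0" "max M 1 > 0" using d K_pos by (auto simp: \<delta>_def)
    fix u E t assume u0: "continuous_on UNIV u"
      "\<forall>t\<ge>0. (u has_real_derivative - u t + G (u (t - h))) (at t within {0..})"
      "\<forall>s\<in>{-h..0}. \<bar>u s - K\<bar> \<le> E" "E \<le> \<delta>" "t \<ge> (0::real)"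
    note u = u0(1) u0(2)[rule_format] u0(3)[rule_format] u0(4,5)
    have hist: "u s \<ge> 0" if "s \<in> {-h..0}" for s using u(3)[OF that] u(4) by (simp add: \<delta>_def abs_le_iff)
    have unn: "u s \<ge> 0" if "s \<ge> -h" for s
    proof (cases "s \<le> 0")
      case True then show ?thesis using hist that by auto
    next
      case False
      have "u s \<ge> exp (- s) * u 0"
        by (rule dde_nonneg[OF h_pos G_nonneg hist u(2)]) (use False in auto)
      moreover have "u 0 \<ge> 0" using hist[of 0] h_pos by auto
      ultimately show ?thesis by (smt (verit) exp_ge_zero mult_nonneg_nonneg)
    qed
    have "dde_solution g h u u"
      unfolding dde_solution_def
    proof (intro conjI ballI allI impI)
      show "continuous_on {-h..} u" by (rule continuous_on_subset[OF u(1)]) simp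
      fix t :: real assume t: "0 \<le> t"
      then have "G (u (t - h)) = g (u (t - h))" using unn[of "t - h"] by (simp add: G_def)
      then show "(u has_real_derivative - u t + g (u (t - h))) (at t within {0..})" using u(2)[OF t] by simp
    qed auto
    moreover have "\<forall>s\<in>{-h..0}. u s \<ge> 0 \<and> \<bar>u s - K\<bar> \<le> d"
      using hist u(3,4) by (force simp: \<delta>_def)
    ultimately have *: "\<bar>u t - K\<bar> \<le> M * exp (- \<gamma> * t) * (SUP s\<in>{-h..0}. \<bar>u s - K\<bar>)"
      using st[of u u] continuous_on_subset[OF u(1)] u(5) by blast
    have S: "(SUP s\<in>{-h..0}. \<bar>u s - K\<bar>) \<le> E"
      by (rule cSUP_least) (use u(3) h_pos in auto)
    have bdd: "bdd_above ((\<lambda>s. \<bar>u s - K\<bar>) ` {-h..0})" using u(3) by (intro bdd_aboveI2)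
    have S0: "0 \<le> (SUP s\<in>{-h..0}. \<bar>u s - K\<bar>)"
      using cSUP_upper2[OF bdd, of 0] h_pos by auto
    have "M * exp (- \<gamma> * t) * (SUP s\<in>{-h..0}. \<bar>u s - K\<bar>) \<le> max M 1 * exp (- \<gamma> * t) * (SUP s\<in>{-h..0}. \<bar>u s - K\<bar>)"
      using S0 by (intro mult_right_mono) auto
    also have "\<dots> \<le> max M 1 * exp (- \<gamma> * t) * E" using S by (intro mult_left_mono) auto
    finally show "\<bar>u t - K\<bar> \<le> max M 1 * exp (- \<gamma> * t) * E" using * by linarith
  qed
qed

text \<open>Once the solution is near \<open>K\<close> it inherits the rate of exponential
  stability. All smaller rates are kept because the final rate has further restrictions to
  meet.\<close>

lemma heteroclinic_K: "\<exists>\<gamma>0>0. \<forall>\<gamma>. 0 < \<gamma> \<and> \<gamma> \<le> \<gamma>0 \<longrightarrow> (\<exists>C>0. \<forall>t. \<bar>heteroclinic t - K\<bar> \<le> C * exp (- \<gamma> * t))"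
proof -
  obtain \<delta> \<gamma>0 M where st: "\<delta> > 0" "\<gamma>0 > 0" "M > 0" and st4: "\<forall>u E t. continuous_on UNIV u \<longrightarrow>
     (\<forall>t\<ge>0. (u has_real_derivative - u t + G (u (t - h))) (at t within {0..})) \<longrightarrow>
     (\<forall>s\<in>{-h..0}. \<bar>u s - K\<bar> \<le> E) \<longrightarrow> E \<le> \<delta> \<longrightarrow> t \<ge> 0 \<longrightarrow> \<bar>u t - K\<bar> \<le> M * exp (- \<gamma>0 * t) * E"
    using stable_K by blast
  obtain B where B: "B > 0" "\<And>t. \<bar>heteroclinic t\<bar> \<le> B" using heteroclinic(5) by blast
  have "\<forall>\<^sub>F t in at_top. dist (heteroclinic t) K < \<delta>" using heteroclinic(4) st(1) by (rule tendstoD)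
  then obtain N where N: "\<And>t. t \<ge> N \<Longrightarrow> \<bar>heteroclinic t - K\<bar> < \<delta>"
    unfolding eventually_at_top_linorder dist_real_def by blast
  define T where "T = N + h"
  have dec: "\<bar>heteroclinic t - K\<bar> \<le> M * exp (- \<gamma>0 * (t - T)) * \<delta>" if t: "t \<ge> T" for t
  proof -
    have "\<bar>(\<lambda>s. heteroclinic (s + T)) (t - T) - K\<bar> \<le> M * exp (- \<gamma>0 * (t - T)) * \<delta>"
    proof (rule st4[rule_format])
      show "continuous_on UNIV (\<lambda>s. heteroclinic (s + T))"
        by (rule continuous_on_compose2[OF heteroclinic_continuous]) (auto intro!: continuous_intros)
      fix s :: real
      have "((\<lambda>s. heteroclinic (s + T)) has_real_derivative - heteroclinic (s + T) + G (heteroclinic (s + T - h))) (at s)"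
        using DERIV_advance[of heteroclinic _ T s] heteroclinic(2)[of "s + T"] by (simp add: add.commute)
      from has_field_derivative_at_within[OF this]
      show "((\<lambda>s. heteroclinic (s + T)) has_real_derivative - heteroclinic (s + T) + G (heteroclinic (s - h + T))) (at s within {0..})"
        by (simp add: algebra_simps)
    next
      fix s assume "s \<in> {-h..0}"
      then show "\<bar>heteroclinic (s + T) - K\<bar> \<le> \<delta>" using N[of "s + T"] by (simp add: T_def less_imp_le)
    qed (use t in auto)
    then show ?thesis by simp
  qed
  show ?thesis
  proof (rule exI[of _ \<gamma>0], rule conjI[rotated], intro allI impI)
    fix \<gamma> assume g: "0 < \<gamma> \<and> \<gamma> \<le> \<gamma>0"
    define C where "C = (M * \<delta> + B + K) * exp (\<gamma> * T)"
    show "\<exists>C>0. \<forall>t. \<bar>heteroclinic t - K\<bar> \<le> C * exp (- \<gamma> * t)"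
    proof (intro exI[of _ C] conjI allI)
      show "C > 0" using st B K_pos by (simp add: C_def add_pos_pos)
      fix t
      have Ce: "C * exp (- \<gamma> * t) = (M * \<delta> + B + K) * exp (- \<gamma> * (t - T))"
        by (simp add: C_def exp_add[symmetric] algebra_simps)
      have MB: "M * \<delta> > 0" using st by simp
      show "\<bar>heteroclinic t - K\<bar> \<le> C * exp (- \<gamma> * t)"
      proof (cases "t \<ge> T")
        case True
        have "\<gamma> * (t - T) \<le> \<gamma>0 * (t - T)" using g True by (intro mult_right_mono) auto
        then have "exp (- \<gamma>0 * (t - T)) \<le> exp (- \<gamma> * (t - T))" by simp
        then have "M * \<delta> * exp (- \<gamma>0 * (t - T)) \<le> (M * \<delta> + B + K) * exp (- \<gamma> * (t - T))"
          using st B K_pos MB by (intro mult_mono) auto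
        then show ?thesis using dec[OF True] Ce by (simp add: mult_ac)
      next
        case False
        have "\<gamma> * (t - T) \<le> 0" using g False by (simp add: mult_nonneg_nonpos)
        then have "1 \<le> exp (- \<gamma> * (t - T))" by simp
        then have le: "(M * \<delta> + B + K) * 1 \<le> (M * \<delta> + B + K) * exp (- \<gamma> * (t - T))"
          using MB B K_pos by (intro mult_left_mono) auto
        have "\<bar>heteroclinic t - K\<bar> \<le> B + K" using B(2)[of t] K_pos by linarith
        also have "\<dots> \<le> (M * \<delta> + B + K) * 1" using MB by simp
        finally show ?thesis unfolding Ce using le by (rule order_trans)
      qed
    qed
  qed fact
qed

text \<open>Both sides are bounded and solve the same equation v' = - v + z, so their difference is
  a multiple of exp (- t) that is bounded at -\<infinity>, hence zero.\<close>

lemma heteroclinic_conv: "heteroclinic t = past_avg 1 (\<lambda>u. G (heteroclinic u)) (t - h)"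
proof -
  define v where "v t = past_avg 1 (\<lambda>u. G (heteroclinic u)) (t - h)" for t
  obtain B where B: "B > 0" "\<And>t. \<bar>heteroclinic t\<bar> \<le> B" using heteroclinic(5) by blast
  obtain L where L: "L > 0" "\<forall>x y. \<bar>x\<bar> \<le> B \<longrightarrow> \<bar>y\<bar> \<le> B \<longrightarrow> \<bar>G x - G y\<bar> \<le> L * \<bar>x - y\<bar>"
    using G_lipschitz[of B] by blast
  have Gb: "\<bar>G (heteroclinic u)\<bar> \<le> L * B * exp (0 * u)" for u
  proof -
    have "\<bar>G (heteroclinic u)\<bar> \<le> L * \<bar>heteroclinic u\<bar>" using L(2)[rule_format, of "heteroclinic u" 0] B G_0 by simp
    also have "\<dots> \<le> L * B" using L(1) B(2) by (intro mult_left_mono) auto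
    finally show ?thesis by simp
  qed
  have zc: "continuous_on UNIV (\<lambda>u. G (heteroclinic u))"
    by (rule continuous_on_compose2[OF G_continuous[of UNIV] heteroclinic_continuous]) auto
  have "(past_avg 1 (\<lambda>u. G (heteroclinic u)) has_real_derivative G (heteroclinic x) - 1 * past_avg 1 (\<lambda>u. G (heteroclinic u)) x) (at x)" for x
    by (rule past_avg_deriv[OF zc, of 1 0]) (use Gb in \<open>auto intro!: exI[of _ "L * B"]\<close>)
  then have vd: "(v has_real_derivative G (heteroclinic (t - h)) - v t) (at t)" for t
    using DERIV_delay[of "past_avg 1 (\<lambda>u. G (heteroclinic u))" _ t h] by (simp add: v_def[abs_def])
  have vb: "\<bar>v t\<bar> \<le> L * B" for t
    using past_avg_bound[of 1 0 "\<lambda>u. G (heteroclinic u)" "t - h" "L * B"] zc Gb by (simp add: v_def)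
  define d where "d t = (heteroclinic t - v t) * exp t" for t
  have "(d has_real_derivative 0) (at t)" for t
    unfolding d_def by (auto intro!: derivative_eq_intros heteroclinic(2) vd simp: algebra_simps)
  then have const: "d t = d s" for s t
    using DERIV_isconst_all by blast
  have "((\<lambda>s. (B + L * B) * exp s) \<longlongrightarrow> 0) at_bot" by real_asymp
  then have "(d \<longlongrightarrow> 0) at_bot"
  proof (rule Lim_null_comparison[rotated])
    show "\<forall>\<^sub>F s in at_bot. norm (d s) \<le> (B + L * B) * exp s"
    proof (rule always_eventually, rule allI)
      fix s
      have "\<bar>heteroclinic s - v s\<bar> \<le> B + L * B" using B(2)[of s] vb[of s] by linarith
      then show "norm (d s) \<le> (B + L * B) * exp s" by (simp add: d_def abs_mult mult_right_mono)
    qed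
  qed
  moreover have "d = (\<lambda>s. d t)" using const by (intro ext)
  ultimately have "((\<lambda>s. d t) \<longlongrightarrow> 0) (at_bot :: real filter)" by simp
  then have "d t = 0" by (simp add: tendsto_const_iff)
  then show ?thesis by (simp add: d_def v_def)
qed

end

section \<open>The linearization along the heteroclinic solution\<close>

definition wt :: "real \<Rightarrow> real \<Rightarrow> real \<Rightarrow> real" where
  "wt \<beta> \<gamma> t = min (exp (\<beta> * t)) (exp (- \<gamma> * t))"

lemma wt_pos: "wt \<beta> \<gamma> t > 0" by (simp add: wt_def)

lemma wt_continuous: "continuous_on S (wt \<beta> \<gamma>)"
  unfolding wt_def by (intro continuous_intros)

context wave
begin

definition lin_coeff where "lin_coeff u = G1 (heteroclinic u)"

lemma lin_coeff_continuous: "continuous_on S lin_coeff"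
  unfolding lin_coeff_def by (rule continuous_on_compose2[OF G1_continuous[of UNIV] continuous_on_subset[OF heteroclinic_continuous]]) auto

lemma lin_coeff_bounded: "\<exists>L>0. \<forall>u. \<bar>lin_coeff u\<bar> \<le> L"
proof -
  obtain B where B: "B > 0" "\<forall>t. \<bar>heteroclinic t\<bar> \<le> B" using heteroclinic(5) by blast
  obtain L where "L > 0" "\<forall>x. \<bar>x\<bar> \<le> B \<longrightarrow> \<bar>G1 x\<bar> \<le> L" using G_lipschitz[of B] by blast
  then show ?thesis using B unfolding lin_coeff_def by blast
qed

lemma heteroclinic_at_bot: "(heteroclinic \<longlongrightarrow> 0) at_bot"
proof -
  obtain D where D: "D > 0" "\<And>t. \<bar>heteroclinic t - exp (lm * t)\<bar> \<le> D * exp (2 * lm * t)" using heteroclinic(3) by blast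
  have l: "lm > 0" by (rule lam_props)
  have "((\<lambda>t. exp (lm * t) + D * exp (2 * lm * t)) \<longlongrightarrow> 0) at_bot" using l by real_asymp
  then show ?thesis
  proof (rule Lim_null_comparison[rotated], intro always_eventually allI)
    fix t show "norm (heteroclinic t) \<le> exp (lm * t) + D * exp (2 * lm * t)"
      using D(2)[of t] exp_gt_zero[of "lm * t"] by (simp only: real_norm_def)
  qed
qed

text \<open>Growing at a large rate \<open>B\<close> to the right of \<open>T0\<close>, this weight makes the linearized delay operator
  contracting on the whole line; the true decay at \<open>+\<infinity>\<close> is recovered afterwards from \<open>tail_step\<close>.\<close>

definition step_weight where
  "step_weight B T0 t = exp (2 * lm * t + (B - 2 * lm) * max 0 (t - T0))"

text \<open>Left of T0 + h the coefficient is close to p and the estimate at the equilibrium 0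
  applies; further right the delay alone contracts, since the weight at t - h is exp (- B h) times
  the weight at t.\<close>

lemma step_weight_contraction:
  "\<exists>B T0 \<theta>. B \<ge> 2 * lm \<and> 0 \<le> \<theta> \<and> \<theta> < 1 \<and>
    (\<forall>Y D t. continuous_on UNIV Y \<longrightarrow> D \<ge> 0 \<longrightarrow> (\<forall>u. \<bar>Y u\<bar> \<le> D * step_weight B T0 u) \<longrightarrow>
      \<bar>past_avg 1 (\<lambda>u. lin_coeff u * Y u) (t - h)\<bar> \<le> \<theta> * D * step_weight B T0 t)"
proof -
  define \<beta> where "\<beta> = 2 * lm"
  have l: "lm > 0" by (rule lam_props)
  have b: "\<beta> > 0" "p * exp (- \<beta> * h) < 1 + \<beta>" using l beyond_lam[of \<beta>] by (simp_all add: \<beta>_def)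
  define q where "q = (1 + \<beta> - p * exp (- \<beta> * h)) / 2"
  have q: "q > 0" using b by (simp add: q_def)
  have "q * exp (- \<beta> * h) \<le> q * 1" using b h_pos q by (intro mult_left_mono) auto
  then have pq: "(p + q) * exp (- \<beta> * h) < 1 + \<beta>" using b by (simp add: q_def field_simps)
  define \<theta> where "\<theta> = (p + q) * exp (- \<beta> * h) / (1 + \<beta>)"
  have th: "0 < \<theta>" "\<theta> < 1" using pq b p_gt1 q by (auto simp: \<theta>_def)
  obtain \<delta> where d: "\<delta> > 0" "\<forall>a x. \<bar>a\<bar> \<le> 0 \<longrightarrow> \<bar>x - a\<bar> \<le> \<delta> \<longrightarrow> \<bar>G1 x - G1 a\<bar> \<le> q"
    using G_uniform_diff[OF q, of 0] by blast
  have "\<forall>\<^sub>F t in at_bot. dist (heteroclinic t) 0 < \<delta>" using heteroclinic_at_bot d(1) by (rule tendstoD)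
  then obtain T0 where "\<forall>t\<le>T0. \<bar>heteroclinic t\<bar> < \<delta>" unfolding eventually_at_bot_linorder by auto
  then have T0: "\<bar>lin_coeff u\<bar> \<le> p + q" if "u \<le> T0" for u
    using d(2)[rule_format, of 0 "heteroclinic u"] that p_gt1 by (force simp: lin_coeff_def G1_def[of 0] abs_le_iff)
  obtain L where L: "L > 0" "\<And>u. \<bar>lin_coeff u\<bar> \<le> L" using lin_coeff_bounded by blast
  \<comment> \<open>Chosen so that L exp (- B h) \<le> \<theta>. The maximum with \<beta> keeps the
    weight above exp (\<beta> t).\<close>
  define B where "B = max \<beta> (ln (L / \<theta>) / h)"
  have Bth: "L * exp (- B * h) \<le> \<theta>"
  proof -
    have "ln (L / \<theta>) \<le> B * h" using h_pos by (simp add: B_def pos_divide_le_eq[symmetric])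
    then have "L / \<theta> \<le> exp (B * h)" using L th by (metis divide_pos_pos exp_le_cancel_iff exp_ln)
    then show ?thesis using th by (simp add: exp_minus field_simps)
  qed
  have Bb: "B \<ge> \<beta>" by (simp add: B_def)
  have b1: "1 + \<beta> > 0" using b by simp
  let ?W = "step_weight B T0"
  have Wb: "exp (\<beta> * t) \<le> ?W t" for t using Bb by (simp add: step_weight_def \<beta>_def)
  show ?thesis
  proof (rule exI[of _ B], rule exI[of _ T0], rule exI[of _ \<theta>], intro conjI allI impI)
    show "B \<ge> 2 * lm" "0 \<le> \<theta>" "\<theta> < 1" using Bb th by (auto simp: \<beta>_def)
    fix Y D t assume Y: "continuous_on UNIV Y" "D \<ge> 0" and Yb: "\<forall>u. \<bar>Y u\<bar> \<le> D * ?W u"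
    have cont: "continuous_on UNIV (\<lambda>u. lin_coeff u * Y u)" by (intro continuous_intros lin_coeff_continuous Y)
    show "\<bar>past_avg 1 (\<lambda>u. lin_coeff u * Y u) (t - h)\<bar> \<le> \<theta> * D * ?W t"
    proof (cases "t \<le> T0 + h")
      case True
      have "\<bar>past_avg 1 (\<lambda>u. lin_coeff u * Y u) (t - h)\<bar> \<le> ((p + q) * D) / (1 + \<beta>) * exp (\<beta> * (t - h))"
      proof (rule past_avg_bound[OF b1 cont])
        fix u assume u: "u \<le> t - h"
        then have "?W u = exp (\<beta> * u)" using True by (simp add: step_weight_def \<beta>_def)
        then have "\<bar>lin_coeff u\<bar> * \<bar>Y u\<bar> \<le> (p + q) * (D * exp (\<beta> * u))"
          using T0[of u] u True Yb[rule_format, of u] p_gt1 q by (intro mult_mono) auto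
        then show "\<bar>lin_coeff u * Y u\<bar> \<le> (p + q) * D * exp (\<beta> * u)" by (simp add: abs_mult mult.assoc)
      qed
      also have "exp (\<beta> * (t - h)) = exp (- \<beta> * h) * exp (\<beta> * t)" by (simp add: exp_add[symmetric] right_diff_distrib)
      also have "((p + q) * D) / (1 + \<beta>) * (exp (- \<beta> * h) * exp (\<beta> * t)) = \<theta> * D * exp (\<beta> * t)"
        by (simp add: \<theta>_def mult_ac)
      also have "\<dots> \<le> \<theta> * D * ?W t" using Wb th Y by (intro mult_left_mono) auto
      finally show ?thesis .
    next
      case False
      \<comment> \<open>Up to t - h the weight lies below a pure exponential of rate \<beta> that
        matches it at u = t - h, so the bound for averages of exponentials applies.\<close>
      define Z where "Z = L * D * exp (- B * h) * ?W t * exp (- \<beta> * (t - h))"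
      have "\<bar>past_avg 1 (\<lambda>u. lin_coeff u * Y u) (t - h)\<bar> \<le> Z / (1 + \<beta>) * exp (\<beta> * (t - h))"
      proof (rule past_avg_bound[OF b1 cont])
        fix u assume u: "u \<le> t - h"
        have "(B - \<beta>) * max 0 (u - T0) \<le> (B - \<beta>) * (t - h - T0)"
          using u False Bb by (intro mult_left_mono) auto
        then have "?W u \<le> exp (- B * h) * ?W t * exp (- \<beta> * (t - h)) * exp (\<beta> * u)"
          using False h_pos by (simp add: step_weight_def exp_add[symmetric] \<beta>_def[symmetric] algebra_simps)
        then have "D * ?W u \<le> D * (exp (- B * h) * ?W t * exp (- \<beta> * (t - h)) * exp (\<beta> * u))"
          using Y by (intro mult_left_mono) auto
        then have "\<bar>Y u\<bar> \<le> D * (exp (- B * h) * ?W t * exp (- \<beta> * (t - h)) * exp (\<beta> * u))"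
          using Yb order_trans by blast
        then have "\<bar>lin_coeff u\<bar> * \<bar>Y u\<bar> \<le> L * (D * (exp (- B * h) * ?W t * exp (- \<beta> * (t - h)) * exp (\<beta> * u)))"
          using L by (intro mult_mono) auto
        then show "\<bar>lin_coeff u * Y u\<bar> \<le> Z * exp (\<beta> * u)" by (simp add: abs_mult Z_def mult_ac)
      qed
      also have "\<dots> = (L * exp (- B * h)) * (D * ?W t) / (1 + \<beta>)"
        by (simp add: Z_def exp_minus mult_ac)
      also have "\<dots> \<le> (L * exp (- B * h)) * (D * ?W t) / 1"
        using b L Y by (intro divide_left_mono) (auto simp: step_weight_def)
      also have "\<dots> \<le> \<theta> * (D * ?W t)"
        using Bth Y by (simp add: mult_right_mono step_weight_def)
      finally show ?thesis by (simp add: mult.assoc)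
    qed
  qed
qed

text \<open>The linear solution \<open>v\<close> is compared with \<open>(u - K) / \<epsilon>\<close>, where \<open>u\<close> solves the nonlinear equation with
  initial function \<open>K + \<epsilon> v\<close>: exponential stability is only assumed for the nonlinear equation.\<close>

lemma tail_step:
  "\<exists>T>0. \<exists>N. \<exists>C>0. \<forall>s v e E F. N \<le> s \<longrightarrow> continuous_on UNIV v \<longrightarrow> E \<ge> 0 \<longrightarrow> F \<ge> 0 \<longrightarrow>
     (\<forall>x\<in>{s-h..s}. \<bar>v x\<bar> \<le> E) \<longrightarrow>
     (\<forall>x\<in>{s..s+T}. (v has_real_derivative - v x + (lin_coeff (x - h) * v (x - h) + e x)) (at x)) \<longrightarrow>
     (\<forall>x\<in>{s..s+T}. \<bar>e x\<bar> \<le> F) \<longrightarrow>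
     (\<forall>x\<in>{s-h..s+T}. \<bar>v x\<bar> \<le> C * (E + F)) \<and> (\<forall>x\<in>{s+T-h..s+T}. \<bar>v x\<bar> \<le> E / 2 + C * F)"
proof -
  obtain \<delta> \<gamma>0 M where st: "\<delta> > 0" "\<gamma>0 > 0" "M > 0" and st4: "\<forall>u E t. continuous_on UNIV u \<longrightarrow>
     (\<forall>t\<ge>0. (u has_real_derivative - u t + G (u (t - h))) (at t within {0..})) \<longrightarrow>
     (\<forall>s\<in>{-h..0}. \<bar>u s - K\<bar> \<le> E) \<longrightarrow> E \<le> \<delta> \<longrightarrow> t \<ge> 0 \<longrightarrow> \<bar>u t - K\<bar> \<le> M * exp (- \<gamma>0 * t) * E"
    using stable_K by blast
  obtain L0 where L0: "L0 > 0" "\<And>u. \<bar>lin_coeff u\<bar> \<le> L0" using lin_coeff_bounded by blast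
  define \<Gamma> where "\<Gamma> = G1 K"
  define L where "L = max L0 \<bar>\<Gamma>\<bar>"
  have L: "L > 0" "\<And>u. \<bar>lin_coeff u\<bar> \<le> L" "\<bar>\<Gamma>\<bar> \<le> L" using L0 by (auto simp: L_def intro: le_max_iff_disj[THEN iffD2])
  define M' where "M' = max M 1"
  have M': "M' \<ge> 1" "M' \<ge> M" by (auto simp: M'_def)
  \<comment> \<open>After time T - h stability has reduced deviations to a quarter; the extra h
    makes this hold on a full history interval.\<close>
  define T where "T = h + max 1 (ln (4 * M') / \<gamma>0)"
  have T: "T > h" "T > 0" using h_pos by (auto simp: T_def)
  have decay: "M' * exp (- \<gamma>0 * t) \<le> 1/4" if "t \<ge> T - h" for t
  proof -
    have "ln (4 * M') / \<gamma>0 \<le> t" using that by (simp add: T_def)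
    then have "ln (4 * M') \<le> \<gamma>0 * t" using st by (simp add: pos_divide_le_eq mult.commute)
    then have "4 * M' \<le> exp (\<gamma>0 * t)" using M' by (metis exp_le_cancel_iff exp_ln less_le_trans mult_pos_pos zero_less_numeral zero_less_one)
    then show ?thesis by (simp add: exp_minus field_simps)
  qed
  obtain n where n: "T \<le> real n * h" using reals_Archimedean3[OF h_pos] less_imp_le by blast
  define C where "C = (1 + L) ^ n"
  have C1: "C \<ge> 1" using L by (simp add: C_def one_le_power)
  \<comment> \<open>Calibrated so that the linearization error, amplified by C over the time T, is a
    quarter of E + F.\<close>
  define \<omega> where "\<omega> = 1 / (4 * C * (C + M'))"
  have om: "\<omega> > 0" using C1 M' by (simp add: \<omega>_def)
  obtain \<delta>2 where d2: "\<delta>2 > 0" "\<forall>a x y. \<bar>a\<bar> \<le> K \<longrightarrow> \<bar>x - a\<bar> \<le> \<delta>2 \<longrightarrow> \<bar>y - a\<bar> \<le> \<delta>2 \<longrightarrow>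
      \<bar>G x - G y - G1 a * (x - y)\<bar> \<le> \<omega> * \<bar>x - y\<bar>" "\<forall>a x. \<bar>a\<bar> \<le> K \<longrightarrow> \<bar>x - a\<bar> \<le> \<delta>2 \<longrightarrow> \<bar>G1 x - G1 a\<bar> \<le> \<omega>"
    using G_uniform_diff[OF om, of K] by blast
  have "\<forall>\<^sub>F t in at_top. dist (heteroclinic t) K < \<delta>2" using heteroclinic(4) d2(1) by (rule tendstoD)
  then obtain N0 where N0: "\<And>t. t \<ge> N0 \<Longrightarrow> \<bar>heteroclinic t - K\<bar> < \<delta>2"
    unfolding eventually_at_top_linorder dist_real_def by blast
  define N where "N = N0 + h"
  have near: "\<bar>lin_coeff (x - h) - \<Gamma>\<bar> \<le> \<omega>" if "x \<ge> N" for x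
    using d2(3)[rule_format, of K "heteroclinic (x - h)"] N0[of "x - h"] that K_pos by (simp add: N_def lin_coeff_def \<Gamma>_def less_imp_le)
  show ?thesis
  proof (rule exI[of _ T], rule conjI, rule T(2), rule exI[of _ N], rule exI[of _ "C + 1"], rule conjI, use C1 in simp, intro allI impI)
    fix s v e E F
    assume s: "N \<le> s" and vc: "continuous_on UNIV v" and E: "E \<ge> 0" and F: "F \<ge> 0"
      and hist: "\<forall>x\<in>{s-h..s}. \<bar>v x\<bar> \<le> E"
      and der: "\<forall>x\<in>{s..s+T}. (v has_real_derivative - v x + (lin_coeff (x - h) * v (x - h) + e x)) (at x)"
      and e: "\<forall>x\<in>{s..s+T}. \<bar>e x\<bar> \<le> F"
    have growth: "\<bar>v x\<bar> \<le> C * (E + F)" if x: "x \<in> {s-h..s+T}" for x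
    proof -
      have "\<forall>t. s - h \<le> t \<and> t \<le> s + T \<and> t \<le> s + real n * h \<longrightarrow> \<bar>v t\<bar> \<le> (1 + L) ^ n * (E + F)"
      proof (rule delay_growth[OF h_pos _ F E])
        show "0 \<le> L" using L by simp
        fix x assume x: "x \<in> {s..s+T}"
        show "(v has_real_derivative - v x + (lin_coeff (x - h) * v (x - h) + e x)) (at x within {s..s+T})"
          using der x has_field_derivative_at_within by blast
        have "\<bar>lin_coeff (x - h) * v (x - h)\<bar> \<le> L * \<bar>v (x - h)\<bar>" using L(2) by (simp add: abs_mult mult_right_mono)
        then show "\<bar>lin_coeff (x - h) * v (x - h) + e x\<bar> \<le> L * \<bar>v (x - h)\<bar> + F" using e x by (smt (verit))
      qed (use hist in auto)
      then show ?thesis using x n by (auto simp: C_def)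
    qed
    have fin: "\<bar>v x\<bar> \<le> E / 2 + (C + 1) * F" if x: "x \<in> {s+T-h..s+T}" for x
    \<comment> \<open>The amplitude below is normalised by E + F, so the trivial case is
      separated.\<close>
    proof (cases "E + F = 0")
      case True
      then have "\<bar>v x\<bar> \<le> 0" using growth[of x] x T by auto
      then show ?thesis using E F C1 by (smt (verit) divide_nonneg_nonneg mult_nonneg_nonneg)
    next
      case False
      define E' where "E' = E + F"
      have E': "E' > 0" "E \<le> E'" using False E F by (auto simp: E'_def)
      \<comment> \<open>An amplitude for which K + \<epsilon> v starts in the stability region and
        its solution remains where the linearization at \<open>K\<close> is accurate to
        \<omega>.\<close>
      define \<epsilon> where "\<epsilon> = min \<delta> (\<delta>2 / M') / E'"
      have eps: "\<epsilon> > 0" using E' st d2 M' by (simp add: \<epsilon>_def)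
      have epsE: "\<epsilon> * E' = min \<delta> (\<delta>2 / M')" using E' by (simp add: \<epsilon>_def)
      have epsE1: "\<epsilon> * E' \<le> \<delta>" using epsE by simp
      have "\<epsilon> * E' \<le> \<delta>2 / M'" using epsE by simp
      then have epsE2: "M' * (\<epsilon> * E') \<le> \<delta>2" using M' by (simp add: field_simps)
      define phi where "phi t = K + \<epsilon> * v (s + t)" for t
      have phic: "continuous_on {-h..0} phi" unfolding phi_def
        by (intro continuous_intros continuous_on_compose2[OF vc]) auto
      obtain u where u: "continuous_on UNIV u" "\<forall>t\<in>{-h..0}. u t = phi t"
        "\<forall>t\<ge>0. (u has_real_derivative - u t + G (u (t - h))) (at t within {0..})"
        using dde_steps[OF h_pos G_continuous phic] by blast
      have uh: "\<forall>t\<in>{-h..0}. \<bar>u t - K\<bar> \<le> \<epsilon> * E'"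
      proof
        fix t assume t: "t \<in> {-h..0}"
        then have "\<bar>v (s + t)\<bar> \<le> E'" using hist[rule_format, of "s + t"] E' by simp
        then show "\<bar>u t - K\<bar> \<le> \<epsilon> * E'" using u(2) t eps by (simp add: phi_def abs_mult)
      qed
      have ub: "\<bar>u t - K\<bar> \<le> M' * exp (- \<gamma>0 * t) * (\<epsilon> * E')" if "t \<ge> 0" for t
      proof -
        have "\<bar>u t - K\<bar> \<le> M * exp (- \<gamma>0 * t) * (\<epsilon> * E')"
          using st4[rule_format, OF u(1) _ _ epsE1 that] u(3) uh by blast
        also have "\<dots> \<le> M' * exp (- \<gamma>0 * t) * (\<epsilon> * E')" using M' eps E' by (intro mult_right_mono) auto
        finally show ?thesis .
      qed
      have ub2: "\<bar>u t - K\<bar> \<le> M' * (\<epsilon> * E')" if "t \<ge> -h" for t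
      proof (cases "t \<le> 0")
        case True
        have "1 * (\<epsilon> * E') \<le> M' * (\<epsilon> * E')" using M' eps E' by (intro mult_right_mono) auto
        then show ?thesis using uh that True by (smt (verit) atLeastAtMost_iff mult_1)
      next
        case False
        have "M' * exp (- \<gamma>0 * t) * (\<epsilon> * E') \<le> M' * 1 * (\<epsilon> * E')"
          using M' eps E' False st by (intro mult_right_mono mult_left_mono) auto
        then show ?thesis using ub[of t] False by simp
      qed
      define q where "q x = (u (x - s) - K) / \<epsilon>" for x
      have qb: "\<bar>q x\<bar> \<le> M' * E'" if "x \<ge> s - h" for x
        using ub2[of "x - s"] that eps by (simp add: q_def field_simps)
      \<comment> \<open>The quotient q solves the linear equation with constant coefficient \<Gamma>
        up to this nonlinear remainder, which \<omega> makes small relative to E'.\<close>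
      define e1 where "e1 x = (G (u (x - h - s)) - G K - \<Gamma> * (u (x - h - s) - K)) / \<epsilon>" for x
      have e1b: "\<bar>e1 x\<bar> \<le> \<omega> * (M' * E')" if x: "x \<ge> s" for x
      proof -
        have "\<bar>G (u (x - h - s)) - G K - \<Gamma> * (u (x - h - s) - K)\<bar> \<le> \<omega> * \<bar>u (x - h - s) - K\<bar>"
          using d2(2)[rule_format, of K "u (x - h - s)" K] ub2[of "x - h - s"] x epsE2 K_pos d2(1) by (simp add: \<Gamma>_def)
        also have "\<dots> \<le> \<omega> * (M' * (\<epsilon> * E'))" using ub2[of "x - h - s"] x om by (intro mult_left_mono) auto
        finally show ?thesis using eps by (simp add: e1_def field_simps)
      qed
      have qd: "(q has_real_derivative - q x + (\<Gamma> * q (x - h) + e1 x)) (at x within {s..s+T})" if x: "x \<in> {s..s+T}" for x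
      proof -
        have "((\<lambda>x. u (x - s)) has_real_derivative - u (x - s) + G (u (x - s - h))) (at x within {s..s+T})"
        proof -
          have "(u has_real_derivative - u (x - s) + G (u (x - s - h))) (at (x - s) within {0..})" using u(3) x by simp
          then have "(u has_real_derivative - u (x - s) + G (u (x - s - h))) (at (x - s) within (\<lambda>x. x - s) ` {s..s+T})"
            by (rule DERIV_subset) auto
          then have "(u \<circ> (\<lambda>x. x - s) has_real_derivative (- u (x - s) + G (u (x - s - h))) * 1) (at x within {s..s+T})"
            by (rule DERIV_image_chain) (auto intro!: derivative_eq_intros)
          then show ?thesis by (simp add: o_def)
        qed
        then have "(q has_real_derivative (- u (x - s) + G (u (x - s - h))) / \<epsilon>) (at x within {s..s+T})"
          unfolding q_def by (auto intro!: derivative_eq_intros DERIV_cdivide)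
        moreover have "(- u (x - s) + G (u (x - s - h))) / \<epsilon> = - q x + (\<Gamma> * q (x - h) + e1 x)"
        proof -
          have "x - s - h = x - h - s" by simp
          then show ?thesis using eps G_K by (simp add: q_def e1_def field_simps)
        qed
        ultimately show ?thesis by simp
      qed
      \<comment> \<open>Forcing of the equation for v - q: \<omega> C E' from replacing
        \<open>lin_coeff\<close> by \<Gamma> along v, \<omega> M' E' from \<open>e1\<close>, and F
        itself. The initial difference is zero.\<close>
      define F2 where "F2 = \<omega> * (C + M') * E' + F"
      have F2: "F2 \<ge> 0" using om C1 M' E' F by (simp add: F2_def)
      have "\<forall>t. s - h \<le> t \<and> t \<le> s + T \<and> t \<le> s + real n * h \<longrightarrow> \<bar>(\<lambda>x. v x - q x) t\<bar> \<le> (1 + L) ^ n * (0 + F2)"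
      proof (rule delay_growth[OF h_pos _ F2])
        show "0 \<le> L" using L by simp
        show "\<bar>v x - q x\<bar> \<le> 0" if "x \<in> {s-h..s}" for x
        proof -
          have "u (x - s) = phi (x - s)" using u(2) that by auto
          then show ?thesis using eps by (simp add: q_def phi_def)
        qed
        fix x assume x: "x \<in> {s..s+T}"
        have "(v has_real_derivative - v x + (lin_coeff (x - h) * v (x - h) + e x)) (at x within {s..s+T})"
          using der x has_field_derivative_at_within by blast
        from DERIV_diff[OF this qd[OF x]]
        show "((\<lambda>x. v x - q x) has_real_derivative - (v x - q x) +
           (\<Gamma> * (v (x - h) - q (x - h)) + ((lin_coeff (x - h) - \<Gamma>) * v (x - h) + e x - e1 x))) (at x within {s..s+T})"
          by (simp add: algebra_simps)
        have 1: "\<bar>(lin_coeff (x - h) - \<Gamma>) * v (x - h)\<bar> \<le> \<omega> * (C * E')"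
          using near[of x] growth[of "x - h"] x s h_pos om C1 E' unfolding abs_mult E'_def by (intro mult_mono) auto
        have 2: "\<bar>\<Gamma> * (v (x - h) - q (x - h))\<bar> \<le> L * \<bar>v (x - h) - q (x - h)\<bar>" using L(3) by (simp add: abs_mult mult_right_mono)
        have F2eq: "F2 = \<omega> * (C * E') + \<omega> * (M' * E') + F" by (simp add: F2_def algebra_simps)
        have 3: "\<bar>e1 x\<bar> \<le> \<omega> * (M' * E')" "\<bar>e x\<bar> \<le> F" using e1b e x by auto
        have "\<bar>a + (b + c - d)\<bar> \<le> A + (B + D + c')" if "\<bar>a\<bar> \<le> A" "\<bar>b\<bar> \<le> B" "\<bar>c\<bar> \<le> c'" "\<bar>d\<bar> \<le> D"
          for a b c d A B c' D :: real using that by linarith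
        from this[OF 2 1 3(2,1)]
        show "\<bar>\<Gamma> * (v (x - h) - q (x - h)) + ((lin_coeff (x - h) - \<Gamma>) * v (x - h) + e x - e1 x)\<bar> \<le> L * \<bar>v (x - h) - q (x - h)\<bar> + F2"
          unfolding F2eq .
      qed simp
      then have "\<bar>v x - q x\<bar> \<le> C * F2" using x n T h_pos by (auto simp: C_def)
      also have "C * F2 = E' / 4 + C * F"
      proof -
        have "C * (\<omega> * (C + M') * E') = E' / 4" 
        proof -
          have "C * (C + M') > 0" using C1 M' by simp
          then have "C * (C + M') * \<omega> = 1 / 4" using C1 M' by (simp add: \<omega>_def mult.assoc)
          then have "C * (C + M') * \<omega> * E' = E' / 4" by simp
          then show ?thesis by (simp only: mult_ac)
        qed
        then show ?thesis by (simp add: F2_def distrib_left)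
      qed
      finally have 1: "\<bar>v x - q x\<bar> \<le> E' / 4 + C * F" .
      have "\<bar>u (x - s) - K\<bar> \<le> M' * exp (- \<gamma>0 * (x - s)) * (\<epsilon> * E')" using ub[of "x - s"] x T by auto
      also have "\<dots> \<le> 1/4 * (\<epsilon> * E')" using decay[of "x - s"] x eps E' by (intro mult_right_mono) auto
      finally have "\<bar>q x\<bar> \<le> E' / 4" using eps by (simp add: q_def field_simps)
      then have "\<bar>v x\<bar> \<le> E' / 2 + C * F" using 1 by linarith
      \<comment> \<open>Two quarters of E + F have accumulated; the half of F among them is pushed
        into the last term, hence the constant C + 1.\<close>
      then show ?thesis using F by (simp add: E'_def algebra_simps add_divide_distrib)
    qed
    have "C * (E + F) \<le> (C + 1) * (E + F)" using E F by (intro mult_right_mono) auto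
    then show "(\<forall>x\<in>{s-h..s+T}. \<bar>v x\<bar> \<le> (C + 1) * (E + F)) \<and> (\<forall>x\<in>{s+T-h..s+T}. \<bar>v x\<bar> \<le> E / 2 + (C + 1) * F)"
      using order_trans[OF growth] fin by blast
  qed
qed

lemma wt_le_step_weight: "B \<ge> 2 * lm \<Longrightarrow> exp (2 * lm * t) \<le> step_weight B T0 t"
  by (simp add: step_weight_def)

lemma lin_coeff_past_continuous:
  assumes "continuous_on UNIV y" "\<And>u. \<bar>y u\<bar> \<le> D * step_weight B T0 u" "B \<ge> 2 * lm" "D \<ge> 0"
  shows "continuous_on UNIV (\<lambda>t. past_avg 1 (\<lambda>u. lin_coeff u * y u) (t - h))"
    and "((\<lambda>t. past_avg 1 (\<lambda>u. lin_coeff u * y u) (t - h)) has_real_derivative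
       lin_coeff (t - h) * y (t - h) - past_avg 1 (\<lambda>u. lin_coeff u * y u) (t - h)) (at t)"
proof -
  obtain L where L: "L > 0" "\<And>u. \<bar>lin_coeff u\<bar> \<le> L" using lin_coeff_bounded by blast
  have c: "continuous_on UNIV (\<lambda>u. lin_coeff u * y u)" by (intro continuous_intros lin_coeff_continuous assms)
  have l: "lm > 0" by (rule lam_props)
  have b: "\<exists>Z. \<forall>u\<le>x. \<bar>lin_coeff u * y u\<bar> \<le> Z * exp (0 * u)" for x
  proof (intro exI allI impI)
    fix u assume u: "u \<le> x"
    have "step_weight B T0 u \<le> step_weight B T0 x"
    proof -
      have "(B - 2 * lm) * max 0 (u - T0) \<le> (B - 2 * lm) * max 0 (x - T0)" using u assms(3) by (intro mult_left_mono) auto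
      moreover have "2 * lm * u \<le> 2 * lm * x" using u l by simp
      ultimately show ?thesis by (simp add: step_weight_def)
    qed
    then have "D * step_weight B T0 u \<le> D * step_weight B T0 x" using assms(4) by (rule mult_left_mono)
    then have "\<bar>lin_coeff u\<bar> * \<bar>y u\<bar> \<le> L * (D * step_weight B T0 x)"
      using L assms(2)[of u] by (intro mult_mono) (auto intro: order_trans)
    then show "\<bar>lin_coeff u * y u\<bar> \<le> (L * (D * step_weight B T0 x)) * exp (0 * u)" by (simp add: abs_mult)
  qed
  have 1: "(1::real) + 0 > 0" by simp
  show "continuous_on UNIV (\<lambda>t. past_avg 1 (\<lambda>u. lin_coeff u * y u) (t - h))"
    by (rule continuous_on_compose2[OF past_avg_continuous[OF c 1 b]]) (auto intro!: continuous_intros)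
  have "(past_avg 1 (\<lambda>u. lin_coeff u * y u) has_real_derivative
       lin_coeff (t - h) * y (t - h) - 1 * past_avg 1 (\<lambda>u. lin_coeff u * y u) (t - h)) (at (t - h))"
    by (rule past_avg_deriv[OF c 1 b])
  from DERIV_delay[OF this] show "((\<lambda>t. past_avg 1 (\<lambda>u. lin_coeff u * y u) (t - h)) has_real_derivative
       lin_coeff (t - h) * y (t - h) - past_avg 1 (\<lambda>u. lin_coeff u * y u) (t - h)) (at t)" by simp
qed

text \<open>Iterating the contraction forces y to 0. The condition at -\<infinity> is essential: the
  derivative of \<open>heteroclinic\<close>, the mode of translation in time, also solves the
  homogeneous equation, but it is of the order exp (\<lambda> t).\<close>

lemma linear_unique:
  assumes y: "continuous_on UNIV y" "\<And>t. \<bar>y t\<bar> \<le> D * exp (2 * lm * t)"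
    and eq: "\<And>t. y t = past_avg 1 (\<lambda>u. lin_coeff u * y u) (t - h)"
  shows "y t = 0"
proof -
  obtain B T0 \<theta> where B: "B \<ge> 2 * lm" "0 \<le> \<theta>" "\<theta> < 1" and con: "\<forall>Y D t. continuous_on UNIV Y \<longrightarrow> D \<ge> 0 \<longrightarrow> (\<forall>u. \<bar>Y u\<bar> \<le> D * step_weight B T0 u) \<longrightarrow>
      \<bar>past_avg 1 (\<lambda>u. lin_coeff u * Y u) (t - h)\<bar> \<le> \<theta> * D * step_weight B T0 t"
    using step_weight_contraction by blast
  have D0: "D \<ge> 0" using y(2)[of 0] by simp
  have "\<forall>t. \<bar>y t\<bar> \<le> (\<theta> ^ n * D) * step_weight B T0 t" for n
  proof (induction n)
    case 0
    show ?case
    proof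
      fix t have "D * exp (2 * lm * t) \<le> D * step_weight B T0 t" using wt_le_step_weight[OF B(1)] D0 by (intro mult_left_mono)
      then show "\<bar>y t\<bar> \<le> (\<theta> ^ 0 * D) * step_weight B T0 t" using y(2)[of t] by simp
    qed
  next
    case (Suc n)
    show ?case
    proof
      fix t
      have "\<bar>past_avg 1 (\<lambda>u. lin_coeff u * y u) (t - h)\<bar> \<le> \<theta> * (\<theta> ^ n * D) * step_weight B T0 t"
        using con[rule_format, OF y(1) _ Suc[rule_format]] B D0 by simp
      then show "\<bar>y t\<bar> \<le> (\<theta> ^ Suc n * D) * step_weight B T0 t" using eq[of t] by (simp add: mult.assoc)
    qed
  qed
  moreover have "(\<lambda>n. (\<theta> ^ n * D) * step_weight B T0 t) \<longlonglongrightarrow> 0 * D * step_weight B T0 t"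
    using B by (intro tendsto_intros LIMSEQ_power_zero) auto
  ultimately have "\<bar>y t\<bar> \<le> 0 * D * step_weight B T0 t"
    by (intro LIMSEQ_le_const) auto
  then show ?thesis by simp
qed

text \<open>A solution comes from the contraction in \<open>step_weight\<close>, which permits
  growth at +\<infinity>; iterating \<open>tail_step\<close> over blocks of length T then shows that
  this very solution decays.\<close>

lemma linear_inverse:
  "\<exists>\<gamma>>0. \<gamma> \<le> 1/4 \<and> (\<exists>C>0. \<forall>t. \<bar>heteroclinic t - K\<bar> \<le> C * exp (- \<gamma> * t)) \<and>
    (\<exists>C>0. \<forall>f F. continuous_on UNIV f \<longrightarrow> F \<ge> 0 \<longrightarrow> (\<forall>t. \<bar>f t\<bar> \<le> F * wt (2 * lm) \<gamma> t) \<longrightarrow>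
       (\<exists>y. continuous_on UNIV y \<and> (\<forall>t. \<bar>y t\<bar> \<le> C * F * wt (2 * lm) \<gamma> t) \<and>
          (\<forall>t. y t = past_avg 1 (\<lambda>u. lin_coeff u * y u) (t - h) + f t)))"
proof -
  have l: "lm > 0" by (rule lam_props)
  obtain B T0 \<theta> where B: "B \<ge> 2 * lm" "0 \<le> \<theta>" "\<theta> < 1" and con: "\<forall>Y D t. continuous_on UNIV Y \<longrightarrow> D \<ge> 0 \<longrightarrow> (\<forall>u. \<bar>Y u\<bar> \<le> D * step_weight B T0 u) \<longrightarrow>
      \<bar>past_avg 1 (\<lambda>u. lin_coeff u * Y u) (t - h)\<bar> \<le> \<theta> * D * step_weight B T0 t"
    using step_weight_contraction by blast
  obtain T N0 C2 where T: "T > 0" "C2 > 0" and tail: "\<forall>s v e E F. N0 \<le> s \<longrightarrow> continuous_on UNIV v \<longrightarrow> E \<ge> 0 \<longrightarrow> F \<ge> 0 \<longrightarrow>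
     (\<forall>x\<in>{s-h..s}. \<bar>v x\<bar> \<le> E) \<longrightarrow>
     (\<forall>x\<in>{s..s+T}. (v has_real_derivative - v x + (lin_coeff (x - h) * v (x - h) + e x)) (at x)) \<longrightarrow>
     (\<forall>x\<in>{s..s+T}. \<bar>e x\<bar> \<le> F) \<longrightarrow>
     (\<forall>x\<in>{s-h..s+T}. \<bar>v x\<bar> \<le> C2 * (E + F)) \<and> (\<forall>x\<in>{s+T-h..s+T}. \<bar>v x\<bar> \<le> E / 2 + C2 * F)"
    using tail_step by blast
  obtain \<gamma>0 where g0: "\<gamma>0 > 0" "\<forall>\<gamma>. 0 < \<gamma> \<and> \<gamma> \<le> \<gamma>0 \<longrightarrow> (\<exists>C>0. \<forall>t. \<bar>heteroclinic t - K\<bar> \<le> C * exp (- \<gamma> * t))"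
    using heteroclinic_K by blast
  obtain L where L: "L > 0" "\<And>u. \<bar>lin_coeff u\<bar> \<le> L" using lin_coeff_bounded by blast
  \<comment> \<open>Three demands: the decay of \<open>heteroclinic\<close>, the integrability of
    the weighted kernels, and a factor exp (- \<gamma> T) \<ge> 3/4 per block, which leaves room
    above the factor 1/2 of \<open>tail_step\<close>.\<close>
  define \<gamma> where "\<gamma> = min (min \<gamma>0 (1/4)) (ln (4/3) / T)"
  have g: "\<gamma> > 0" "\<gamma> \<le> \<gamma>0" "\<gamma> \<le> 1/4" "\<gamma> \<le> ln (4/3) / T"
  proof -
    show "\<gamma> > 0" using g0(1) T by (simp add: \<gamma>_def)
  qed (unfold \<gamma>_def, linarith+)
  define N where "N = max N0 0"
  define \<rho> where "\<rho> = exp (- \<gamma> * T)"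
  have rho: "\<rho> \<ge> 3/4" "\<rho> > 0"
  proof -
    have "\<gamma> * T \<le> ln (4/3)" using g(4) T by (simp add: pos_le_divide_eq)
    then have "exp (- ln (4/3)) \<le> \<rho>" unfolding \<rho>_def by simp
    then show "\<rho> \<ge> 3/4" by (simp add: exp_minus)
  qed (simp add: \<rho>_def)
  let ?W = "step_weight B T0"
  let ?w = "wt (2 * lm) \<gamma>"
  define c3 where "c3 = L * exp (\<gamma> * h) * exp (- \<gamma> * N)"
  \<comment> \<open>The first two summands bound the initial history; the last gives C2 c3 \<le> P0
    / 4, so that P0 / 2 + C2 c3 \<le> (3/4) P0 closes the induction over blocks.\<close>
  define P0 where "P0 = ?W N / (1 - \<theta>) + 1 + 4 * C2 * c3"
  define C4 where "C4 = C2 * (P0 + c3) * exp (\<gamma> * T) * exp (\<gamma> * N)"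
  \<comment> \<open>For t < N the growing weight and \<open>wt\<close> are comparable, both being of
    the order exp (2 \<lambda> t) at -\<infinity>.\<close>
  define C5 where "C5 = exp ((B - 2 * lm) * max 0 (N - T0)) * exp ((2 * lm + \<gamma>) * N) / (1 - \<theta>)"
  define C where "C = C4 + 1 + C5"
  have c3: "c3 > 0" using L by (simp add: c3_def)
  have P0: "P0 > 0" "P0 \<ge> 4 * C2 * c3" "?W N / (1 - \<theta>) + 1 \<le> P0"
  proof -
    have "?W N / (1 - \<theta>) > 0" using B by (simp add: step_weight_def)
    moreover have "C2 * c3 > 0" using T c3 by simp
    ultimately show "P0 > 0" "P0 \<ge> 4 * C2 * c3" "?W N / (1 - \<theta>) + 1 \<le> P0" unfolding P0_def by linarith+
  qed
  have C45: "C4 > 0" "C5 > 0" using T P0 c3 B by (auto simp: C4_def C5_def)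
  have mono_W: "?W u \<le> ?W x" if "u \<le> x" for u x
  proof -
    have "(B - 2 * lm) * max 0 (u - T0) \<le> (B - 2 * lm) * max 0 (x - T0)" using that B(1) by (intro mult_left_mono) auto
    moreover have "2 * lm * u \<le> 2 * lm * x" using that l by simp
    ultimately show ?thesis by (simp add: step_weight_def)
  qed
  have main: "\<exists>y. continuous_on UNIV y \<and> (\<forall>t. \<bar>y t\<bar> \<le> C * F * ?w t) \<and>
          (\<forall>t. y t = past_avg 1 (\<lambda>u. lin_coeff u * y u) (t - h) + f t)"
    if f: "continuous_on UNIV f" "F \<ge> 0" "\<And>t. \<bar>f t\<bar> \<le> F * ?w t" for f F
  proof -
    have w1: "?w t \<le> exp (- \<gamma> * t)" "?w t \<le> exp (2 * lm * t)" "?w t \<le> 1" for t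
    proof -
      have "2 * lm * t \<le> 0 \<or> - \<gamma> * t \<le> 0" using l g(1) by (cases "t \<le> 0") (auto simp: mult_nonneg_nonpos)
      then show "?w t \<le> 1" unfolding wt_def by (auto simp: min_le_iff_disj)
    qed (simp_all add: wt_def)
    have fW: "\<bar>f t\<bar> \<le> F * ?W t" for t
      using f(3)[of t] mult_left_mono[OF order_trans[OF w1(2) wt_le_step_weight[OF B(1)]] f(2)] by (rule order_trans)
    define TT where "TT y t = past_avg 1 (\<lambda>u. lin_coeff u * y u) (t - h) + f t" for y t
    define \<delta> where "\<delta> = F / (1 - \<theta>)"
    have d: "\<delta> \<ge> 0" "\<theta> * \<delta> + F = \<delta>" using f(2) B by (auto simp: \<delta>_def field_simps)
    have "\<exists>y. continuous_on UNIV y \<and> (\<forall>t. \<bar>y t\<bar> \<le> \<delta> * ?W t) \<and> TT y = y"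
    proof (rule weighted_fixpoint[of ?W \<delta> \<theta>])
      show "continuous_on UNIV ?W" unfolding step_weight_def by (intro continuous_intros)
      show "?W t > 0" for t by (simp add: step_weight_def)
      show "0 \<le> \<delta>" "0 \<le> \<theta>" "\<theta> < 1" using d B by auto
    next
      fix y assume y: "continuous_on UNIV y" "\<And>t. \<bar>y t\<bar> \<le> \<delta> * ?W t"
      have "\<bar>TT y t\<bar> \<le> \<delta> * ?W t" for t
      proof -
        have "\<bar>past_avg 1 (\<lambda>u. lin_coeff u * y u) (t - h)\<bar> \<le> \<theta> * \<delta> * ?W t"
          using con[rule_format, OF y(1) d(1) y(2)] .
        then have "\<bar>TT y t\<bar> \<le> \<theta> * \<delta> * ?W t + F * ?W t" using fW[of t] unfolding TT_def by linarith
        also have "\<dots> = (\<theta> * \<delta> + F) * ?W t" by (simp add: distrib_right)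
        finally show ?thesis by (simp only: d(2))
      qed
      then show "continuous_on UNIV (TT y) \<and> (\<forall>t. \<bar>TT y t\<bar> \<le> \<delta> * ?W t)"
        unfolding TT_def using lin_coeff_past_continuous(1)[OF y B(1) d(1)] f(1) by (auto intro!: continuous_intros)
    next
      fix y y' E t assume y: "continuous_on UNIV y" "\<And>t. \<bar>y t\<bar> \<le> \<delta> * ?W t"
        and y': "continuous_on UNIV y'" "\<And>t. \<bar>y' t\<bar> \<le> \<delta> * ?W t"
        and E: "E \<ge> 0" "\<And>t. \<bar>y t - y' t\<bar> \<le> E * ?W t"
      have I: "set_integrable lborel {..x} (\<lambda>u. exp (1 * u) * (lin_coeff u * y u))" if "continuous_on UNIV y" "\<And>t. \<bar>y t\<bar> \<le> \<delta> * ?W t" for y x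
      proof (rule past_avg_integrable[where b = 0])
        show "continuous_on UNIV (\<lambda>u. lin_coeff u * y u)" by (intro continuous_intros lin_coeff_continuous that)
        fix u assume "u \<le> x"
        then have "\<delta> * ?W u \<le> \<delta> * ?W x" using mono_W d by (intro mult_left_mono)
        then have "\<bar>lin_coeff u\<bar> * \<bar>y u\<bar> \<le> L * (\<delta> * ?W x)"
          using L that(2)[of u] by (intro mult_mono) (auto intro: order_trans)
        then show "\<bar>lin_coeff u * y u\<bar> \<le> (L * (\<delta> * ?W x)) * exp (0 * u)" by (simp add: abs_mult)
      qed simp
      have "TT y t - TT y' t = past_avg 1 (\<lambda>u. lin_coeff u * y u - lin_coeff u * y' u) (t - h)"
        unfolding TT_def using past_avg_diff[OF I[OF y] I[OF y']] by simp
      also have "(\<lambda>u. lin_coeff u * y u - lin_coeff u * y' u) = (\<lambda>u. lin_coeff u * (y u - y' u))" by (simp add: right_diff_distrib)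
      finally show "\<bar>TT y t - TT y' t\<bar> \<le> \<theta> * E * ?W t"
        using con[rule_format, OF continuous_on_diff[OF y(1) y'(1)] E] by simp
    qed
    then obtain y where y: "continuous_on UNIV y" "\<And>t. \<bar>y t\<bar> \<le> \<delta> * ?W t" and fixed: "TT y = y" by blast
    have yeq: "y t = past_avg 1 (\<lambda>u. lin_coeff u * y u) (t - h) + f t" for t
      using fun_cong[OF fixed, of t] unfolding TT_def by (rule sym)
    \<comment> \<open>The forcing f is merely continuous, so the differential equation is written
      for y - f, which is an average and hence differentiable; f reappears in the source
      \<open>e\<close>.\<close>
    define v where "v t = past_avg 1 (\<lambda>u. lin_coeff u * y u) (t - h)" for t
    have yv: "y t = v t + f t" for t unfolding v_def by (rule yeq)
    have vc: "continuous_on UNIV v" unfolding v_def by (rule lin_coeff_past_continuous(1)[OF y B(1) d(1)])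
    define e where "e x = lin_coeff (x - h) * f (x - h)" for x
    have vd: "(v has_real_derivative - v x + (lin_coeff (x - h) * v (x - h) + e x)) (at x)" for x
    proof -
      have "(v has_real_derivative lin_coeff (x - h) * y (x - h) - v x) (at x)"
        using lin_coeff_past_continuous(2)[OF y B(1) d(1), of x] unfolding v_def[abs_def] .
      then show ?thesis by (simp add: yv e_def algebra_simps)
    qed
    define s where "s n = N + real n * T" for n :: nat
    have exps: "exp (- \<gamma> * s n) = exp (- \<gamma> * N) * \<rho> ^ n" for n
      by (simp add: s_def \<rho>_def exp_of_nat_mult[symmetric] exp_add[symmetric] algebra_simps)
    have eb: "\<forall>x\<in>{s n..s n + T}. \<bar>e x\<bar> \<le> c3 * F * \<rho> ^ n" for n
    proof
      fix x assume x: "x \<in> {s n..s n + T}"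
      have "- \<gamma> * (x - h) \<le> \<gamma> * h + - \<gamma> * s n" using x g(1) by (simp add: algebra_simps)
      then have "exp (- \<gamma> * (x - h)) \<le> exp (\<gamma> * h) * exp (- \<gamma> * s n)" by (simp only: exp_add[symmetric] exp_le_cancel_iff)
      then have "?w (x - h) \<le> exp (\<gamma> * h) * exp (- \<gamma> * s n)" using w1(1)[of "x - h"] by linarith
      then have "F * ?w (x - h) \<le> F * (exp (\<gamma> * h) * exp (- \<gamma> * s n))" using f(2) by (rule mult_left_mono)
      then have "\<bar>f (x - h)\<bar> \<le> F * (exp (\<gamma> * h) * exp (- \<gamma> * s n))" using f(3)[of "x - h"] by linarith
      then have "\<bar>lin_coeff (x - h)\<bar> * \<bar>f (x - h)\<bar> \<le> L * (F * (exp (\<gamma> * h) * exp (- \<gamma> * s n)))"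
        using L by (intro mult_mono) auto
      then show "\<bar>e x\<bar> \<le> c3 * F * \<rho> ^ n" unfolding e_def abs_mult exps c3_def by (simp add: mult_ac)
    qed
    have Fc: "c3 * F * \<rho> ^ n \<ge> 0" "P0 * F * \<rho> ^ n \<ge> 0" for n using c3 P0 f(2) rho by auto
    have sN: "s n \<ge> N0" for n using T by (simp add: s_def N_def max_def add_increasing2)
    have iter: "\<forall>x\<in>{s n - h..s n}. \<bar>v x\<bar> \<le> P0 * F * \<rho> ^ n" for n
    proof (induction n)
      case 0
      show ?case
      proof
        fix x assume x: "x \<in> {s 0 - h..s 0}"
        have "x \<le> N" using x by (simp add: s_def)
        then have "\<delta> * ?W x \<le> \<delta> * ?W N" using mono_W d(1) by (intro mult_left_mono)
        then have "\<bar>y x\<bar> \<le> \<delta> * ?W N" using y(2)[of x] by linarith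
        moreover have "\<bar>f x\<bar> \<le> F" using f(3)[of x] mult_left_mono[OF w1(3) f(2), of x] by simp
        ultimately have "\<bar>v x\<bar> \<le> \<delta> * ?W N + F" using yv[of x] by linarith
        also have "\<dots> = F * (?W N / (1 - \<theta>) + 1)" by (simp add: \<delta>_def algebra_simps)
        also have "\<dots> \<le> F * P0" using P0 f(2) by (intro mult_left_mono) auto
        finally show "\<bar>v x\<bar> \<le> P0 * F * \<rho> ^ 0" by (simp add: mult.commute)
      qed
    next
      case (Suc n)
      have sT: "s (Suc n) = s n + T" by (simp add: s_def algebra_simps)
      have "\<forall>x\<in>{s n + T - h..s n + T}. \<bar>v x\<bar> \<le> P0 * F * \<rho> ^ n / 2 + C2 * (c3 * F * \<rho> ^ n)"
        using tail[rule_format, OF sN vc Fc(2) Fc(1) Suc[rule_format] vd eb[rule_format]] by blast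
      moreover have "P0 * F * \<rho> ^ n / 2 + C2 * (c3 * F * \<rho> ^ n) \<le> P0 * F * \<rho> ^ Suc n"
      proof -
        have "P0 / 2 + C2 * c3 \<le> P0 * (3/4)" using P0(2) by simp
        also have "\<dots> \<le> P0 * \<rho>" using rho P0 by (intro mult_left_mono) auto
        finally have "(P0 / 2 + C2 * c3) * (F * \<rho> ^ n) \<le> (P0 * \<rho>) * (F * \<rho> ^ n)"
          using f(2) rho by (intro mult_right_mono) auto
        then show ?thesis by (simp add: algebra_simps)
      qed
      ultimately show ?case unfolding sT by fastforce
    qed
    have vtail: "\<bar>v t\<bar> \<le> C4 * F * exp (- \<gamma> * t)" if t: "t \<ge> N" for t
    proof -
      define n where "n = nat \<lfloor>(t - N) / T\<rfloor>"
      have "real n \<le> (t - N) / T" "(t - N) / T \<le> real n + 1" using t T unfolding n_def by (auto; linarith)+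
      then have n: "s n \<le> t" "t \<le> s n + T" using T by (simp_all add: s_def field_simps)
      have "\<forall>x\<in>{s n - h..s n + T}. \<bar>v x\<bar> \<le> C2 * (P0 * F * \<rho> ^ n + c3 * F * \<rho> ^ n)"
        using tail[rule_format, OF sN vc Fc(2) Fc(1) iter[rule_format] vd eb[rule_format]] by blast
      then have "\<bar>v t\<bar> \<le> C2 * (P0 * F * \<rho> ^ n + c3 * F * \<rho> ^ n)" using n h_pos by auto
      also have "\<dots> = C2 * (P0 + c3) * F * \<rho> ^ n" by (simp add: algebra_simps)
      also have "\<dots> \<le> C2 * (P0 + c3) * F * (exp (\<gamma> * T) * exp (\<gamma> * N) * exp (- \<gamma> * t))"
      proof (rule mult_left_mono)
        have "\<rho> ^ n = exp (\<gamma> * N) * exp (- \<gamma> * s n)" unfolding exps by (simp add: mult.assoc[symmetric] exp_add[symmetric])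
        also have "\<dots> \<le> exp (\<gamma> * T) * exp (\<gamma> * N) * exp (- \<gamma> * t)"
          using n(2) g(1) mult_left_mono[of t "s n + T" \<gamma>] by (simp add: exp_add[symmetric] algebra_simps)
        finally show "\<rho> ^ n \<le> exp (\<gamma> * T) * exp (\<gamma> * N) * exp (- \<gamma> * t)" .
      qed (use T P0 c3 f(2) in auto)
      finally show ?thesis by (simp add: C4_def mult_ac)
    qed
    have "\<bar>y t\<bar> \<le> C * F * ?w t" for t
    proof (cases "t \<ge> N")
      case True
      then have "t \<ge> 0" by (simp add: N_def)
      then have "- \<gamma> * t \<le> 2 * lm * t" using g(1) l by (smt (verit) mult_minus_left mult_nonneg_nonneg)
      then have wt: "?w t = exp (- \<gamma> * t)" by (simp add: wt_def)
      have "\<bar>y t\<bar> \<le> C4 * F * exp (- \<gamma> * t) + F * exp (- \<gamma> * t)"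
        using yv[of t] vtail[OF True] f(3)[of t] unfolding wt by linarith
      also have "\<dots> = (C4 + 1) * F * ?w t" by (simp add: wt algebra_simps)
      also have "\<dots> \<le> C * F * ?w t" using C45 f(2) wt_pos[of "2*lm" \<gamma> t]
        by (intro mult_right_mono) (auto simp: C_def)
      finally show ?thesis .
    next
      case False
      have "?W t \<le> exp ((B - 2 * lm) * max 0 (N - T0)) * exp (2 * lm * t)"
      proof -
        have "(B - 2 * lm) * max 0 (t - T0) \<le> (B - 2 * lm) * max 0 (N - T0)" using False B(1) by (intro mult_left_mono) auto
        then show ?thesis by (simp add: step_weight_def exp_add[symmetric])
      qed
      also have "\<dots> \<le> exp ((B - 2 * lm) * max 0 (N - T0)) * (exp ((2 * lm + \<gamma>) * N) * ?w t)"
      proof (rule mult_left_mono)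
        have N0: "N \<ge> 0" by (simp add: N_def)
        have "(2 * lm + \<gamma>) * t \<le> (2 * lm + \<gamma>) * N" using False l g(1) by (intro mult_left_mono) auto
        then have 1: "exp (2 * lm * t) \<le> exp ((2 * lm + \<gamma>) * N) * exp (- \<gamma> * t)"
          by (simp add: exp_add[symmetric] algebra_simps)
        have "(2 * lm + \<gamma>) * N \<ge> 0" using l g(1) N0 by auto
        then have 2: "exp (2 * lm * t) \<le> exp ((2 * lm + \<gamma>) * N) * exp (2 * lm * t)" by simp
        show "exp (2 * lm * t) \<le> exp ((2 * lm + \<gamma>) * N) * ?w t" using 1 2 by (simp add: wt_def min_def)
      qed simp
      finally have "\<delta> * ?W t \<le> \<delta> * (exp ((B - 2 * lm) * max 0 (N - T0)) * (exp ((2 * lm + \<gamma>) * N) * ?w t))"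
        using d(1) by (rule mult_left_mono)
      also have "\<dots> = C5 * F * ?w t" by (simp add: \<delta>_def C5_def)
      also have "\<dots> \<le> C * F * ?w t" using C45 f(2) wt_pos[of "2*lm" \<gamma> t]
        by (intro mult_right_mono) (auto simp: C_def)
      finally show ?thesis using y(2)[of t] by linarith
    qed
    then show ?thesis using y(1) yeq by blast
  qed
  have C0: "C > 0" using C45 by (simp add: C_def)
  show ?thesis
    by (rule exI[of _ \<gamma>], intro conjI g(1,3) g0(2)[rule_format] exI[of _ C] C0 allI impI)
      (use main g in auto)
qed

end

section \<open>Perturbation of the kernel\<close>

context wave
begin

definition decay_rate :: real where
  "decay_rate = (SOME \<gamma>. \<gamma> > 0 \<and> \<gamma> \<le> 1/4 \<and> (\<exists>C>0. \<forall>t. \<bar>heteroclinic t - K\<bar> \<le> C * exp (- \<gamma> * t)) \<and>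
    (\<exists>C>0. \<forall>f F. continuous_on UNIV f \<longrightarrow> F \<ge> 0 \<longrightarrow> (\<forall>t. \<bar>f t\<bar> \<le> F * wt (2 * lm) \<gamma> t) \<longrightarrow>
       (\<exists>y. continuous_on UNIV y \<and> (\<forall>t. \<bar>y t\<bar> \<le> C * F * wt (2 * lm) \<gamma> t) \<and>
          (\<forall>t. y t = past_avg 1 (\<lambda>u. lin_coeff u * y u) (t - h) + f t))))"

abbreviation ww where "ww \<equiv> wt (2 * lm) decay_rate"

lemma decay_rate: "decay_rate > 0" "decay_rate \<le> 1/4" "\<exists>C>0. \<forall>t. \<bar>heteroclinic t - K\<bar> \<le> C * exp (- decay_rate * t)"
  "\<exists>C>0. \<forall>f F. continuous_on UNIV f \<longrightarrow> F \<ge> 0 \<longrightarrow> (\<forall>t. \<bar>f t\<bar> \<le> F * ww t) \<longrightarrow>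
       (\<exists>y. continuous_on UNIV y \<and> (\<forall>t. \<bar>y t\<bar> \<le> C * F * ww t) \<and>
          (\<forall>t. y t = past_avg 1 (\<lambda>u. lin_coeff u * y u) (t - h) + f t))"
  using someI_ex[OF linear_inverse, folded decay_rate_def] by auto

definition om where "om s = exp (decay_rate * s) + exp (- (2 * lm) * s)"

lemma om_ge1: "om s \<ge> 1" and om_lam: "exp (- lm * s) \<le> om s"
proof -
  have l: "lm > 0" by (rule lam_props)
  show "om s \<ge> 1"
  proof (cases "s \<ge> 0")
    case True then have "exp (decay_rate * s) \<ge> 1" using decay_rate(1) by simp
    then show ?thesis unfolding om_def using exp_gt_zero[of "- (2 * lm) * s"] by linarith
  next
    case False then have "exp (- (2 * lm) * s) \<ge> 1" using l by (simp add: mult_nonneg_nonpos)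
    then show ?thesis unfolding om_def using exp_gt_zero[of "decay_rate * s"] by linarith
  qed
  show "exp (- lm * s) \<le> om s"
  proof (cases "s \<ge> 0")
    case True
    then have "- lm * s \<le> decay_rate * s" using decay_rate(1) l by (intro mult_right_mono) auto
    then have "exp (- lm * s) \<le> exp (decay_rate * s)" by (simp only: exp_le_cancel_iff)
    then show ?thesis unfolding om_def using exp_gt_zero[of "- (2 * lm) * s"] by linarith
  next
    case False
    then have "- lm * s \<le> - (2 * lm) * s" using l by (intro mult_right_mono_neg) auto
    then have "exp (- lm * s) \<le> exp (- (2 * lm) * s)" by (simp only: exp_le_cancel_iff)
    then show ?thesis unfolding om_def using exp_gt_zero[of "decay_rate * s"] by linarith
  qed
qed

text \<open>Whichever exponential is the smaller one at t, the shifted weight is at most that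
  exponential shifted, and \<open>om\<close> is the sum of both shift factors.\<close>

lemma ww_shift: "ww (t - s) \<le> ww t * om s"
proof -
  have 1: "exp (2 * lm * (t - s)) \<le> exp (2 * lm * t) * om s"
  proof -
    have "exp (2 * lm * (t - s)) = exp (2 * lm * t) * exp (- (2 * lm) * s)" by (simp add: exp_add[symmetric] algebra_simps)
    also have "\<dots> \<le> exp (2 * lm * t) * om s" by (intro mult_left_mono) (auto simp: om_def)
    finally show ?thesis .
  qed
  have 2: "exp (- decay_rate * (t - s)) \<le> exp (- decay_rate * t) * om s"
  proof -
    have "exp (- decay_rate * (t - s)) = exp (- decay_rate * t) * exp (decay_rate * s)" by (simp add: exp_add[symmetric] algebra_simps)
    also have "\<dots> \<le> exp (- decay_rate * t) * om s" by (intro mult_left_mono) (auto simp: om_def)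
    finally show ?thesis .
  qed
  show ?thesis
  proof (cases "exp (2 * lm * t) \<le> exp (- decay_rate * t)")
    case True then have "ww t = exp (2 * lm * t)" by (simp add: wt_def)
    then show ?thesis using 1 by (simp add: wt_def min_le_iff_disj)
  next
    case False then have "ww t = exp (- decay_rate * t)" by (simp add: wt_def)
    then show ?thesis using 2 by (simp add: wt_def min_le_iff_disj)
  qed
qed

lemma ww_le: "ww t \<le> 1" "ww t \<le> exp (lm * t)" "ww t \<le> exp (2 * lm * t)" "ww t \<le> exp (- decay_rate * t)"
proof -
  have l: "lm > 0" by (rule lam_props)
  show "ww t \<le> exp (2 * lm * t)" "ww t \<le> exp (- decay_rate * t)" by (auto simp: wt_def)
  show "ww t \<le> 1"
    using l decay_rate(1) by (cases "t \<le> 0") (auto simp: wt_def min_le_iff_disj mult_nonneg_nonpos)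
  show "ww t \<le> exp (lm * t)"
  proof (cases "t \<le> 0")
    case True then have "2 * lm * t \<le> lm * t" using l by simp
    then show ?thesis by (simp add: wt_def min_le_iff_disj)
  next
    case False then have "1 \<le> exp (lm * t)" using l by simp
    then show ?thesis using \<open>ww t \<le> 1\<close> by linarith
  qed
qed

abbreviation kn where "kn f \<equiv> knorm decay_rate (2 * lm) f"

abbreviation kdist where "kdist \<epsilon> \<epsilon>' \<equiv> kn (\<lambda>s. wave_kernel \<epsilon> s - wave_kernel \<epsilon>' s)"

lemma kn_nonneg: "kn f \<ge> 0"
  unfolding knorm_def by (intro integral_nonneg_AE AE_I2) auto

section \<open>Convolution estimates in the weighted space\<close>

lemma wave_kernel_int:
  assumes "0 \<le> \<epsilon>" "\<epsilon> \<le> eps1" "continuous_on UNIV z" "\<And>s. \<bar>z (t - s)\<bar> \<le> V * om s"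
  shows "integrable lborel (\<lambda>s. wave_kernel \<epsilon> s * z (t - s))" "\<bar>conv (wave_kernel \<epsilon>) z t\<bar> \<le> V * kn (wave_kernel \<epsilon>)"
  by (rule conv_integrable[OF wave_kernel_measurable[OF decay_rate(1,2)] assms(3) wave_kernel_integrable[OF decay_rate(1,2) assms(1,2)] assms(4)[unfolded om_def]])
    (rule conv_bound[OF wave_kernel_measurable[OF decay_rate(1,2)] assms(3) wave_kernel_integrable[OF decay_rate(1,2) assms(1,2)] assms(4)[unfolded om_def]])

lemma wave_kernel_diff_bound:
  assumes e: "0 \<le> \<epsilon>" "\<epsilon> \<le> eps1" "0 \<le> \<epsilon>'" "\<epsilon>' \<le> eps1" and z: "continuous_on UNIV z" "\<And>s. \<bar>z (t - s)\<bar> \<le> V * om s"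
  shows "\<bar>conv (wave_kernel \<epsilon>) z t - conv (wave_kernel \<epsilon>') z t\<bar> \<le> V * kdist \<epsilon> \<epsilon>'"
proof -
  have "conv (wave_kernel \<epsilon>) z t - conv (wave_kernel \<epsilon>') z t = conv (\<lambda>s. wave_kernel \<epsilon> s - wave_kernel \<epsilon>' s) z t"
    using conv_kernel_diff[OF wave_kernel_int(1)[OF e(1,2) z] wave_kernel_int(1)[OF e(3,4) z]] by simp
  moreover have "(\<lambda>s. wave_kernel \<epsilon> s - wave_kernel \<epsilon>' s) \<in> borel_measurable borel"
    using wave_kernel_measurable[OF decay_rate(1,2)] by (intro borel_measurable_diff)
  ultimately show ?thesis
    using conv_bound[OF _ z(1) wave_kernel_diff_integrable[OF decay_rate(1,2) e] z(2)[unfolded om_def]] by simp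
qed

lemma bounded_om: "\<bar>z (t - s)\<bar> \<le> Z \<Longrightarrow> \<bar>z (t - s)\<bar> \<le> Z * om s" for z :: "real \<Rightarrow> real"
  using mult_left_mono[OF om_ge1[of s], of Z] by linarith

lemma wave_kernel_bound_ww:
  assumes "0 \<le> \<epsilon>" "\<epsilon> \<le> eps1" "continuous_on UNIV z" "\<And>u. \<bar>z u\<bar> \<le> Z * ww u" "Z \<ge> 0"
  shows "\<bar>conv (wave_kernel \<epsilon>) z t\<bar> \<le> Z * kn (wave_kernel \<epsilon>) * ww t"
proof -
  have "\<bar>z (t - s)\<bar> \<le> (Z * ww t) * om s" for s
    using order_trans[OF assms(4)[of "t - s"] mult_left_mono[OF ww_shift assms(5)]] by (simp add: mult.assoc)
  from wave_kernel_int(2)[OF assms(1,2,3) this] show ?thesis by (simp add: mult_ac)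
qed

lemma wave_kernel_diff_bound_ww:
  assumes "0 \<le> \<epsilon>" "\<epsilon> \<le> eps1" "0 \<le> \<epsilon>'" "\<epsilon>' \<le> eps1" "continuous_on UNIV z" "\<And>u. \<bar>z u\<bar> \<le> Z * ww u" "Z \<ge> 0"
  shows "\<bar>conv (wave_kernel \<epsilon>) z t - conv (wave_kernel \<epsilon>') z t\<bar> \<le> Z * kdist \<epsilon> \<epsilon>' * ww t"
proof -
  have "\<bar>z (t - s)\<bar> \<le> (Z * ww t) * om s" for s
    using order_trans[OF assms(6)[of "t - s"] mult_left_mono[OF ww_shift assms(7)]] by (simp add: mult.assoc)
  from wave_kernel_diff_bound[OF assms(1-5) this] show ?thesis by (simp add: mult_ac)
qed

text \<open>Since every kernel of the family reproduces constants and maps \<open>p exp (\<lambda> t)\<close> to the same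
  function, a kernel difference sees only the deviation of \<open>z\<close> from either of these two.\<close>

lemma wave_kernel_diff_bound_profile:
  assumes e: "0 \<le> \<epsilon>" "\<epsilon> \<le> eps1" "0 \<le> \<epsilon>'" "\<epsilon>' \<le> eps1" and z: "continuous_on UNIV z" "\<And>u. \<bar>z u\<bar> \<le> Z"
    and zl: "\<And>u. \<bar>z u - p * exp (lm * u)\<bar> \<le> C * exp (2 * lm * u)"
    and zr: "\<And>u. \<bar>z u - K\<bar> \<le> C * exp (- decay_rate * u)"
  shows "\<bar>conv (wave_kernel \<epsilon>) z t - conv (wave_kernel \<epsilon>') z t\<bar> \<le> C * kdist \<epsilon> \<epsilon>' * ww t"
proof -
  have C0: "C \<ge> 0" using zr[of 0] by simp
  have zi: "integrable lborel (\<lambda>s. wave_kernel \<epsilon> s * z (t - s))" if "0 \<le> \<epsilon>" "\<epsilon> \<le> eps1" for \<epsilon>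
    by (rule wave_kernel_int(1)[OF that z(1), where V = Z], rule bounded_om, rule z(2))
  have A: "\<bar>conv (wave_kernel \<epsilon>) z t - conv (wave_kernel \<epsilon>') z t\<bar> \<le> V * kdist \<epsilon> \<epsilon>'"
    if b: "continuous_on UNIV b" "\<And>s. \<bar>b (t - s)\<bar> \<le> Vb * om s" and eq: "conv (wave_kernel \<epsilon>) b t = conv (wave_kernel \<epsilon>') b t"
      and V: "\<And>s. \<bar>z (t - s) - b (t - s)\<bar> \<le> V * om s" for b V Vb
  proof -
    have bi: "integrable lborel (\<lambda>s. wave_kernel \<epsilon> s * b (t - s))" if "0 \<le> \<epsilon>" "\<epsilon> \<le> eps1" for \<epsilon>
      by (rule wave_kernel_int(1)[OF that b])
    have "conv (wave_kernel \<epsilon>) (\<lambda>u. z u - b u) t - conv (wave_kernel \<epsilon>') (\<lambda>u. z u - b u) t = conv (wave_kernel \<epsilon>) z t - conv (wave_kernel \<epsilon>') z t"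
      using conv_diff[OF zi[OF e(1,2)] bi[OF e(1,2)]] conv_diff[OF zi[OF e(3,4)] bi[OF e(3,4)]] eq by simp
    moreover have "\<bar>conv (wave_kernel \<epsilon>) (\<lambda>u. z u - b u) t - conv (wave_kernel \<epsilon>') (\<lambda>u. z u - b u) t\<bar> \<le> V * kdist \<epsilon> \<epsilon>'"
      by (rule wave_kernel_diff_bound[OF e]) (use V in \<open>auto intro!: continuous_intros z b\<close>)
    ultimately show ?thesis by simp
  qed
  have 1: "\<bar>conv (wave_kernel \<epsilon>) z t - conv (wave_kernel \<epsilon>') z t\<bar> \<le> (C * exp (2 * lm * t)) * kdist \<epsilon> \<epsilon>'"
  proof (rule A[of "\<lambda>u. p * exp (lm * u)" "p * exp (lm * t)"])
    show "continuous_on UNIV (\<lambda>u. p * exp (lm * u))" by (intro continuous_intros)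
    show "\<bar>p * exp (lm * (t - s))\<bar> \<le> p * exp (lm * t) * om s" for s
    proof -
      have "p * exp (lm * (t - s)) = p * exp (lm * t) * exp (- lm * s)" by (simp add: exp_add[symmetric] algebra_simps)
      also have "\<dots> \<le> p * exp (lm * t) * om s" using p_gt1 om_lam by (intro mult_left_mono) auto
      finally show ?thesis using p_gt1 by simp
    qed
    show "conv (wave_kernel \<epsilon>) (\<lambda>u. p * exp (lm * u)) t = conv (wave_kernel \<epsilon>') (\<lambda>u. p * exp (lm * u)) t"
      using conv_wave_kernel_exp[OF e(1,2)] conv_wave_kernel_exp[OF e(3,4)] by simp
    show "\<bar>z (t - s) - p * exp (lm * (t - s))\<bar> \<le> C * exp (2 * lm * t) * om s" for s
    proof -
      have "C * exp (2 * lm * (t - s)) = C * exp (2 * lm * t) * exp (- (2 * lm) * s)" by (simp add: exp_add[symmetric] algebra_simps)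
      also have "\<dots> \<le> C * exp (2 * lm * t) * om s" using C0 by (intro mult_left_mono) (auto simp: om_def)
      finally show ?thesis using zl[of "t - s"] by linarith
    qed
  qed
  have 2: "\<bar>conv (wave_kernel \<epsilon>) z t - conv (wave_kernel \<epsilon>') z t\<bar> \<le> (C * exp (- decay_rate * t)) * kdist \<epsilon> \<epsilon>'"
  proof (rule A[of "\<lambda>u. K" "K"])
    show "\<bar>K\<bar> \<le> K * om s" for s using K_pos om_ge1[of s] by simp
    show "conv (wave_kernel \<epsilon>) (\<lambda>u. K) t = conv (wave_kernel \<epsilon>') (\<lambda>u. K) t"
      using conv_wave_kernel_const[OF e(1,2)] conv_wave_kernel_const[OF e(3,4)] by simp
    show "\<bar>z (t - s) - K\<bar> \<le> C * exp (- decay_rate * t) * om s" for s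
    proof -
      have "C * exp (- decay_rate * (t - s)) = C * exp (- decay_rate * t) * exp (decay_rate * s)" by (simp add: exp_add[symmetric] algebra_simps)
      also have "\<dots> \<le> C * exp (- decay_rate * t) * om s" using C0 by (intro mult_left_mono) (auto simp: om_def)
      finally show ?thesis using zr[of "t - s"] by linarith
    qed
  qed (intro continuous_intros)
  show ?thesis
  proof (cases "exp (2 * lm * t) \<le> exp (- decay_rate * t)")
    case True then have "ww t = exp (2 * lm * t)" by (simp add: wt_def)
    then show ?thesis using 1 by (simp add: mult_ac)
  next
    case False then have "ww t = exp (- decay_rate * t)" by (simp add: wt_def)
    then show ?thesis using 2 by (simp add: mult_ac)
  qed
qed

text \<open>The choice asks for some bound only; uniqueness in the weighted class identifies the
  chosen solution with the one that satisfies the quantitative bound.\<close>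

definition sol where
  "sol f = (SOME y. continuous_on UNIV y \<and> (\<exists>D. \<forall>t. \<bar>y t\<bar> \<le> D * ww t) \<and>
          (\<forall>t. y t = past_avg 1 (\<lambda>u. lin_coeff u * y u) (t - h) + f t))"

lemma ww_bounded_unique:
  assumes "continuous_on UNIV y" "\<And>t. \<bar>y t\<bar> \<le> D * ww t" "\<And>t. y t = past_avg 1 (\<lambda>u. lin_coeff u * y u) (t - h) + f t"
    "continuous_on UNIV y'" "\<And>t. \<bar>y' t\<bar> \<le> D' * ww t" "\<And>t. y' t = past_avg 1 (\<lambda>u. lin_coeff u * y' u) (t - h) + f t"
  shows "y = y'"
proof -
  obtain L where L: "L > 0" "\<And>u. \<bar>lin_coeff u\<bar> \<le> L" using lin_coeff_bounded by blast
  have D: "D \<ge> 0" if "\<And>t. \<bar>y t\<bar> \<le> D * ww t" for y D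
  proof -
    have "0 \<le> D * ww 0" using that[of 0] by linarith
    then show ?thesis using wt_pos[of "2 * lm" decay_rate 0] by (simp add: zero_le_mult_iff)
  qed
  have int: "set_integrable lborel {..x} (\<lambda>u. exp (1 * u) * (lin_coeff u * y u))"
    if "continuous_on UNIV y" "\<And>t. \<bar>y t\<bar> \<le> D * ww t" for y D x
  proof (rule past_avg_integrable[where b = 0])
    show "continuous_on UNIV (\<lambda>u. lin_coeff u * y u)" by (intro continuous_intros lin_coeff_continuous that)
    fix u
    have "\<bar>y u\<bar> \<le> D * 1" using that(2)[of u] mult_left_mono[OF ww_le(1)[of u] D[OF that(2)]] by linarith
    then have "\<bar>lin_coeff u\<bar> * \<bar>y u\<bar> \<le> L * (D * 1)" using L by (intro mult_mono) auto
    then show "\<bar>lin_coeff u * y u\<bar> \<le> (L * D) * exp (0 * u)" by (simp add: abs_mult)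
  qed simp
  have "y t - y' t = 0" for t
  proof (rule linear_unique[where D = "D + D'" and y = "\<lambda>t. y t - y' t"])
    show "continuous_on UNIV (\<lambda>t. y t - y' t)" by (intro continuous_intros assms)
    fix t
    have "\<bar>y t - y' t\<bar> \<le> (D + D') * ww t" using assms(2)[of t] assms(5)[of t] by (simp add: distrib_right)
    also have "\<dots> \<le> (D + D') * exp (2 * lm * t)" using D[OF assms(2)] D[OF assms(5)] ww_le(3) by (intro mult_left_mono) auto
    finally show "\<bar>y t - y' t\<bar> \<le> (D + D') * exp (2 * lm * t)" .
    have "y t - y' t = past_avg 1 (\<lambda>u. lin_coeff u * y u) (t - h) - past_avg 1 (\<lambda>u. lin_coeff u * y' u) (t - h)"
      using assms(3)[of t] assms(6)[of t] by linarith
    also have "\<dots> = past_avg 1 (\<lambda>u. lin_coeff u * y u - lin_coeff u * y' u) (t - h)"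
      using past_avg_diff[OF int[OF assms(1,2)] int[OF assms(4,5)]] by simp
    also have "(\<lambda>u. lin_coeff u * y u - lin_coeff u * y' u) = (\<lambda>u. lin_coeff u * (y u - y' u))" by (simp add: right_diff_distrib)
    finally show "y t - y' t = past_avg 1 (\<lambda>u. lin_coeff u * (y u - y' u)) (t - h)" .
  qed
  then show ?thesis by (intro ext) simp
qed

lemma sol_props:
  "\<exists>C>0. \<forall>f F. continuous_on UNIV f \<longrightarrow> F \<ge> 0 \<longrightarrow> (\<forall>t. \<bar>f t\<bar> \<le> F * ww t) \<longrightarrow>
     continuous_on UNIV (sol f) \<and> (\<forall>t. \<bar>sol f t\<bar> \<le> C * F * ww t) \<and>
          (\<forall>t. sol f t = past_avg 1 (\<lambda>u. lin_coeff u * sol f u) (t - h) + f t)"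
proof -
  obtain C where C: "C > 0" and ex: "\<forall>f F. continuous_on UNIV f \<longrightarrow> F \<ge> 0 \<longrightarrow> (\<forall>t. \<bar>f t\<bar> \<le> F * ww t) \<longrightarrow>
       (\<exists>y. continuous_on UNIV y \<and> (\<forall>t. \<bar>y t\<bar> \<le> C * F * ww t) \<and>
          (\<forall>t. y t = past_avg 1 (\<lambda>u. lin_coeff u * y u) (t - h) + f t))" using decay_rate(4) by blast
  show ?thesis
  proof (rule exI[of _ C], rule conjI[OF C], intro allI impI conjI)
    fix f F assume f: "continuous_on UNIV f" "F \<ge> 0" "\<forall>t. \<bar>f t\<bar> \<le> F * ww t"
    obtain y where y: "continuous_on UNIV y" "\<forall>t. \<bar>y t\<bar> \<le> C * F * ww t"
      "\<forall>t. y t = past_avg 1 (\<lambda>u. lin_coeff u * y u) (t - h) + f t" using ex f by blast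
    then have "\<exists>y. continuous_on UNIV y \<and> (\<exists>D. \<forall>t. \<bar>y t\<bar> \<le> D * ww t) \<and>
          (\<forall>t. y t = past_avg 1 (\<lambda>u. lin_coeff u * y u) (t - h) + f t)" by blast
    from someI_ex[OF this, folded sol_def] obtain D where s: "continuous_on UNIV (sol f)" "\<forall>t. \<bar>sol f t\<bar> \<le> D * ww t"
          "\<forall>t. sol f t = past_avg 1 (\<lambda>u. lin_coeff u * sol f u) (t - h) + f t" by blast
    have eq: "sol f = y"
      by (rule ww_bounded_unique[OF s(1) s(2)[rule_format] s(3)[rule_format] y(1) y(2)[rule_format] y(3)[rule_format]])
    show "continuous_on UNIV (sol f)" by (rule s(1))
    fix t
    show "\<bar>sol f t\<bar> \<le> C * F * ww t" unfolding eq by (rule y(2)[rule_format])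
    show "sol f t = past_avg 1 (\<lambda>u. lin_coeff u * sol f u) (t - h) + f t" by (rule s(3)[rule_format])
  qed
qed

lemma wave_kernel_conv_continuous:
  assumes e: "0 \<le> \<epsilon>" "\<epsilon> \<le> eps1" and z: "continuous_on UNIV z" "\<And>u. \<bar>z u\<bar> \<le> Z"
  shows "continuous_on UNIV (conv (wave_kernel \<epsilon>) z)"
proof (cases "\<epsilon> = 0")
  case True
  have "continuous_on UNIV (past_avg 1 z)"
    by (rule past_avg_continuous[OF z(1), of 1 0]) (use z(2) in auto)
  then show ?thesis unfolding True conv_wave_kernel_0[abs_def]
    by (rule continuous_on_compose2) (auto intro!: continuous_intros)
next
  case False
  then have ep: "\<epsilon> > 0" using e by simp
  have l: "lm > 0" by (rule lam_props)
  have a: "ka \<epsilon> + 0 > 0" and b: "1 / kq \<epsilon> > 0" using param_bounds[OF e] kq_pos[OF e ep] by auto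
  have "continuous_on UNIV (past_avg (ka \<epsilon>) z)"
    by (rule past_avg_continuous[OF z(1) a]) (use z(2) in auto)
  then have 1: "continuous_on UNIV (\<lambda>t. past_avg (ka \<epsilon>) z (t - kd \<epsilon>))"
    by (rule continuous_on_compose2) (auto intro!: continuous_intros)
  have "continuous_on UNIV (future_avg (1 / kq \<epsilon>) z)"
  proof (intro continuous_at_imp_continuous_on ballI)
    fix x show "isCont (future_avg (1 / kq \<epsilon>) z) x"
      by (rule DERIV_isCont[OF future_avg_deriv[OF z(1) b]]) (use z(2) in auto)
  qed
  then have 2: "continuous_on UNIV (\<lambda>t. future_avg (1 / kq \<epsilon>) z (t - kd \<epsilon>))"
    by (rule continuous_on_compose2) (auto intro!: continuous_intros)
  have "conv (wave_kernel \<epsilon>) z = (\<lambda>t. kA \<epsilon> * (past_avg (ka \<epsilon>) z (t - kd \<epsilon>) + future_avg (1 / kq \<epsilon>) z (t - kd \<epsilon>)))"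
    by (intro ext conv_wave_kernel_pos[OF e ep z(1), of Z 0]) (use z(2) l in auto)
  then show ?thesis using 1 2 by (auto intro!: continuous_intros)
qed

text \<open>Two regimes in which a perturbed profile stays positive: right of T0 a perturbation
  below m is harmless, left of T0 the leading term exp (\<lambda> t) dominates an error D exp (2
  \<lambda> t).\<close>

lemma heteroclinic_lower: "\<exists>T0 m. m > 0 \<and> (\<forall>t\<ge>T0. heteroclinic t \<ge> m) \<and> (\<forall>t\<le>T0. D * exp (lm * t) \<le> 1/2)"
proof -
  have l: "lm > 0" by (rule lam_props)
  have "((\<lambda>t. D * exp (lm * t)) \<longlongrightarrow> 0) at_bot" using l by real_asymp
  then have "\<forall>\<^sub>F t in at_bot. D * exp (lm * t) < 1/2" by (rule order_tendstoD) simp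
  then obtain T0 where T0: "\<forall>t\<le>T0. D * exp (lm * t) < 1/2" unfolding eventually_at_bot_linorder by auto
  have "\<forall>\<^sub>F t in at_top. heteroclinic t > K / 2" using K_pos by (intro order_tendstoD(1)[OF heteroclinic(4)]) simp
  then obtain N where N: "\<forall>t\<ge>N. heteroclinic t > K / 2" unfolding eventually_at_top_linorder by auto
  have "\<exists>x\<in>{T0..max T0 N}. \<forall>y\<in>{T0..max T0 N}. heteroclinic x \<le> heteroclinic y"
    by (rule continuous_attains_inf) (auto intro: continuous_on_subset[OF heteroclinic_continuous])
  then obtain x where x: "\<forall>y\<in>{T0..max T0 N}. heteroclinic x \<le> heteroclinic y" by blast
  define m where "m = min (K / 2) (heteroclinic x)"
  have "heteroclinic t \<ge> m" if "t \<ge> T0" for t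
  proof (cases "t \<le> N")
    case True then show ?thesis using x that by (simp add: m_def min_le_iff_disj)
  next
    case False then show ?thesis using N[rule_format, of t] by (simp add: m_def min_le_iff_disj)
  qed
  moreover have "m > 0" using K_pos heteroclinic(1)[of x] by (simp add: m_def)
  ultimately show ?thesis using T0 less_imp_le by blast
qed

text \<open>For \<Psi> = \<open>heteroclinic\<close> + y the profile equation is the linearized
  equation for y with forcing \<open>RR\<close>, that is, y = sol (RR y). The forcing has a small
  Lipschitz constant in y for two separate reasons: the kernels are close, and the linearization
  error is small on a small ball.\<close>

lemma profiles:
  "\<exists>\<epsilon>2>0. \<epsilon>2 \<le> eps1 \<and> (\<exists>\<Psi> C. C > 0 \<and>
     (\<forall>\<epsilon>. 0 \<le> \<epsilon> \<and> \<epsilon> \<le> \<epsilon>2 \<longrightarrow> continuous_on UNIV (\<Psi> \<epsilon>) \<and>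
        (\<forall>t. \<Psi> \<epsilon> t > 0) \<and> (\<forall>t. \<Psi> \<epsilon> t \<le> C) \<and>
        (\<forall>t. \<bar>\<Psi> \<epsilon> t - exp (lm * t)\<bar> \<le> C * exp (2 * lm * t)) \<and>
        (\<forall>t. \<bar>\<Psi> \<epsilon> t - K\<bar> \<le> C * exp (- decay_rate * t)) \<and>
        (\<forall>t. \<bar>G (\<Psi> \<epsilon> t) - p * exp (lm * t)\<bar> \<le> C * exp (2 * lm * t)) \<and>
        (\<forall>t. \<bar>G (\<Psi> \<epsilon> t)\<bar> \<le> C) \<and>
        (\<forall>t. \<Psi> \<epsilon> t = conv (wave_kernel \<epsilon>) (\<lambda>u. G (\<Psi> \<epsilon> u)) t)) \<and>
     (\<forall>\<epsilon> \<epsilon>'. 0 \<le> \<epsilon> \<and> \<epsilon> \<le> \<epsilon>2 \<and> 0 \<le> \<epsilon>' \<and> \<epsilon>' \<le> \<epsilon>2 \<longrightarrow>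
        (\<forall>t. \<bar>\<Psi> \<epsilon> t - \<Psi> \<epsilon>' t\<bar> \<le> C * kdist \<epsilon> \<epsilon>')))"
proof -
  have l: "lm > 0" by (rule lam_props)
  have e0: "(0::real) \<le> 0" "0 \<le> eps1" using eps1(1) by auto
  obtain D where D: "D > 0" "\<And>t. \<bar>heteroclinic t - exp (lm * t)\<bar> \<le> D * exp (2 * lm * t)" using heteroclinic(3) by blast
  obtain CK where CK: "CK > 0" "\<And>t. \<bar>heteroclinic t - K\<bar> \<le> CK * exp (- decay_rate * t)" using decay_rate(3) by blast
  obtain B where B: "B > 0" "\<And>t. \<bar>heteroclinic t\<bar> \<le> B" using heteroclinic(5) by blast
  obtain L0 where L0: "L0 > 0" "\<And>u. \<bar>lin_coeff u\<bar> \<le> L0" using lin_coeff_bounded by blast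
  obtain CS where CS: "CS > 0" and sol: "\<forall>f F. continuous_on UNIV f \<longrightarrow> F \<ge> 0 \<longrightarrow> (\<forall>t. \<bar>f t\<bar> \<le> F * ww t) \<longrightarrow>
     continuous_on UNIV (sol f) \<and> (\<forall>t. \<bar>sol f t\<bar> \<le> CS * F * ww t) \<and>
          (\<forall>t. sol f t = past_avg 1 (\<lambda>u. lin_coeff u * sol f u) (t - h) + f t)" using sol_props by blast
  obtain T0 m where T0: "m > 0" "\<forall>t\<ge>T0. heteroclinic t \<ge> m" "\<forall>t\<le>T0. (D + 1) * exp (lm * t) \<le> 1/2"
    using heteroclinic_lower[of "D + 1"] by blast
  \<comment> \<open>Bounds \<open>heteroclinic\<close> + y for all y in the ball, and
    \<open>K\<close>, so that one Lipschitz constant and one quadratic constant serve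
    throughout.\<close>
  define R where "R = B + max 1 K"
  obtain \<Lambda> where \<Lambda>: "\<Lambda> > 0" "\<forall>x y. \<bar>x\<bar> \<le> R \<longrightarrow> \<bar>y\<bar> \<le> R \<longrightarrow> \<bar>G x - G y\<bar> \<le> \<Lambda> * \<bar>x - y\<bar>"
    using G_lipschitz[of R] by blast
  obtain Cq where Cq: "Cq > 0" "\<forall>x. \<bar>x\<bar> \<le> R \<longrightarrow> \<bar>G x - p * x\<bar> \<le> Cq * x\<^sup>2"
    using G_quadratic[of R] by blast
  define N0 where "N0 = kn (wave_kernel 0)"
  have N0: "N0 \<ge> 0" unfolding N0_def by (rule kn_nonneg)
  \<comment> \<open>The contraction factor will be 1/2: a quarter for the linearization error, fixed
    here, and a quarter for the kernel error, fixed by \<eta>.\<close>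
  define \<omega> where "\<omega> = 1 / (4 * CS * (N0 + 1))"
  have om0: "\<omega> > 0" using CS N0 by (simp add: \<omega>_def)
  have omN: "CS * (\<omega> * N0) \<le> 1/4"
  proof -
    have "CS * (\<omega> * N0) = (1/4) * (N0 / (N0 + 1))" using CS N0 by (simp add: \<omega>_def)
    also have "N0 / (N0 + 1) \<le> 1" using N0 by simp
    finally show ?thesis by simp
  qed
  obtain \<delta>1 where d1: "\<delta>1 > 0" "\<forall>a x y. \<bar>a\<bar> \<le> B \<longrightarrow> \<bar>x - a\<bar> \<le> \<delta>1 \<longrightarrow> \<bar>y - a\<bar> \<le> \<delta>1 \<longrightarrow>
      \<bar>G x - G y - G1 a * (x - y)\<bar> \<le> \<omega> * \<bar>x - y\<bar>"
    using G_uniform_diff[OF om0, of B] by blast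
  \<comment> \<open>\<delta> \<le> \<delta>1 validates the linearization estimate, and \<delta> < m
    keeps the profiles positive.\<close>
  define \<delta> where "\<delta> = min (min \<delta>1 1) (m / 2)"
  have d: "\<delta> > 0" "\<delta> \<le> \<delta>1" "\<delta> \<le> 1" "\<delta> < m"
  proof -
    show "\<delta> > 0" using d1(1) T0(1) by (simp add: \<delta>_def)
    show "\<delta> < m" using T0(1) unfolding \<delta>_def by linarith
  qed (unfold \<delta>_def, linarith+)
  define Ch where "Ch = 2 + D + B"
  define C0 where "C0 = Cq * Ch\<^sup>2 + p * (D + 1) + \<Lambda> * (CK + 1)"
  have C00: "C0 > 0" "Cq * Ch\<^sup>2 + p * (D + 1) \<le> C0" "\<Lambda> * (CK + 1) \<le> C0"
  proof -
    have "Cq * Ch\<^sup>2 \<ge> 0" "p * (D + 1) > 0" "\<Lambda> * (CK + 1) > 0" using Cq p_gt1 D \<Lambda> CK by auto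
    then show "C0 > 0" "Cq * Ch\<^sup>2 + p * (D + 1) \<le> C0" "\<Lambda> * (CK + 1) \<le> C0" unfolding C0_def by linarith+
  qed
  \<comment> \<open>The first entry limits the kernel part of the Lipschitz constant to a quarter;
    the second keeps the solution for the defect at y = 0 within half the radius.\<close>
  define \<eta> where "\<eta> = min (1 / (4 * CS * \<Lambda>)) (\<delta> / (2 * CS * C0))"
  have eta: "\<eta> > 0" using CS \<Lambda>(1) d C00 by (simp add: \<eta>_def)
  obtain d0 where d0: "d0 > 0" "\<forall>\<epsilon>'. 0 \<le> \<epsilon>' \<and> \<epsilon>' \<le> eps1 \<and> \<bar>\<epsilon>' - 0\<bar> < d0 \<longrightarrow> kdist \<epsilon>' 0 < \<eta>"
    using wave_kernel_knorm_continuous[OF decay_rate(1,2) e0 eta] by blast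
  define \<epsilon>2 where "\<epsilon>2 = min eps1 (d0 / 2)"
  have e2: "\<epsilon>2 > 0" "\<epsilon>2 \<le> eps1" using eps1(1) d0 by (simp_all add: \<epsilon>2_def)
  have Neps: "CS * (\<Lambda> * kdist \<epsilon> 0) \<le> 1/4" "CS * (C0 * kdist \<epsilon> 0) \<le> \<delta> / 2"
    if "0 \<le> \<epsilon>" "\<epsilon> \<le> \<epsilon>2" for \<epsilon>
  proof -
    have "\<bar>\<epsilon> - 0\<bar> < d0" using that d0(1) unfolding \<epsilon>2_def by linarith
    then have k: "kdist \<epsilon> 0 \<le> \<eta>" using d0(2) that e2 by (intro less_imp_le) auto
    have "CS * \<Lambda> * kdist \<epsilon> 0 \<le> CS * \<Lambda> * (1 / (4 * CS * \<Lambda>))"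
      using k CS \<Lambda>(1) by (intro mult_left_mono) (auto simp: \<eta>_def)
    then show "CS * (\<Lambda> * kdist \<epsilon> 0) \<le> 1/4" using CS \<Lambda>(1) by (simp add: mult.assoc)
    have "CS * C0 * kdist \<epsilon> 0 \<le> CS * C0 * (\<delta> / (2 * CS * C0))"
      using k CS C00(1) by (intro mult_left_mono) (auto simp: \<eta>_def)
    then show "CS * (C0 * kdist \<epsilon> 0) \<le> \<delta> / 2" using CS C00(1) by (simp add: mult.assoc)
  qed
  define ball where "ball y \<longleftrightarrow> continuous_on UNIV y \<and> (\<forall>t. \<bar>y t\<bar> \<le> \<delta> * ww t)" for y
  define z where "z y u = G (heteroclinic u + y u)" for y u
  have yb: "\<bar>y u\<bar> \<le> \<delta>" "\<bar>y u\<bar> \<le> ww u" if "ball y" for y u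
  proof -
    have "\<bar>y u\<bar> \<le> \<delta> * ww u" using that by (simp add: ball_def)
    moreover have "\<delta> * ww u \<le> \<delta> * 1" using d ww_le(1) by (intro mult_left_mono) auto
    moreover have "\<delta> * ww u \<le> 1 * ww u" using d wt_pos[of "2*lm" decay_rate u] by (intro mult_right_mono) auto
    ultimately show "\<bar>y u\<bar> \<le> \<delta>" "\<bar>y u\<bar> \<le> ww u" by linarith+
  qed
  have xR: "\<bar>heteroclinic u + y u\<bar> \<le> R" "\<bar>heteroclinic u\<bar> \<le> R" "\<bar>K\<bar> \<le> R" "\<bar>(0::real)\<bar> \<le> R" if "ball y" for y u
    using yb(1)[OF that, of u] B(2)[of u] B(1) d K_pos unfolding R_def by linarith+
  have zc: "continuous_on UNIV (z y)" if "ball y" for y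
    unfolding z_def using that
    by (intro continuous_on_compose2[OF G_continuous[of UNIV]] continuous_intros heteroclinic_continuous) (auto simp: ball_def)
  have x1: "\<bar>heteroclinic u + y u - exp (lm * u)\<bar> \<le> (D + 1) * exp (2 * lm * u)" if "ball y" for y u
    using D(2)[of u] order_trans[OF yb(2)[OF that, of u] ww_le(3)] by (simp add: distrib_right)
  have x2: "\<bar>heteroclinic u + y u - K\<bar> \<le> (CK + 1) * exp (- decay_rate * u)" if "ball y" for y u
    using CK(2)[of u] order_trans[OF yb(2)[OF that, of u] ww_le(4)] by (simp add: distrib_right)
  have x3: "\<bar>heteroclinic u + y u\<bar> \<le> Ch * exp (lm * u)" if "ball y" for y u
  proof -
    have "\<bar>heteroclinic u\<bar> \<le> (1 + D + B) * exp (lm * u)"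
    proof (cases "u \<le> 0")
      case True
      have "2 * lm * u \<le> lm * u" using True l by simp
      then have "D * exp (2 * lm * u) \<le> D * exp (lm * u)" using D(1) by simp
      then have "\<bar>heteroclinic u\<bar> \<le> (1 + D) * exp (lm * u)" using D(2)[of u] exp_gt_zero[of "lm * u"] unfolding distrib_right mult_1 by linarith
      also have "\<dots> \<le> (1 + D + B) * exp (lm * u)" using B by simp
      finally show ?thesis .
    next
      case False
      have "1 \<le> exp (lm * u)" using False l by simp
      then have "B * 1 \<le> (1 + D + B) * exp (lm * u)" using B D by (intro mult_mono) auto
      then show ?thesis using B(2)[of u] by linarith
    qed
    moreover have "\<bar>y u\<bar> \<le> exp (lm * u)" using yb(2)[OF that, of u] ww_le(2)[of u] by linarith
    ultimately show ?thesis by (simp add: Ch_def algebra_simps)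
  qed
  have z1: "\<bar>z y u - p * exp (lm * u)\<bar> \<le> C0 * exp (2 * lm * u)" if "ball y" for y u
  proof -
    let ?x = "heteroclinic u + y u"
    have "?x\<^sup>2 \<le> (Ch * exp (lm * u))\<^sup>2" using x3[OF that, of u] by (metis abs_ge_zero power2_abs power_mono)
    also have "\<dots> = Ch\<^sup>2 * exp (2 * lm * u)" by (simp add: power_mult_distrib exp_double[symmetric] mult.assoc)
    finally have "Cq * ?x\<^sup>2 \<le> Cq * (Ch\<^sup>2 * exp (2 * lm * u))" using Cq(1) by simp
    then have "\<bar>G ?x - p * ?x\<bar> \<le> Cq * (Ch\<^sup>2 * exp (2 * lm * u))" using Cq(2) xR(1)[OF that, of u] by fastforce
    moreover have "\<bar>p * ?x - p * exp (lm * u)\<bar> \<le> p * ((D + 1) * exp (2 * lm * u))"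
      using x1[OF that, of u] p_gt1 by (simp add: abs_mult right_diff_distrib[symmetric])
    ultimately have "\<bar>z y u - p * exp (lm * u)\<bar> \<le> Cq * (Ch\<^sup>2 * exp (2 * lm * u)) + p * ((D + 1) * exp (2 * lm * u))"
      unfolding z_def by linarith
    also have "\<dots> = (Cq * Ch\<^sup>2 + p * (D + 1)) * exp (2 * lm * u)" by (simp add: algebra_simps)
    also have "\<dots> \<le> C0 * exp (2 * lm * u)" using C00(2) by (intro mult_right_mono) auto
    finally show ?thesis .
  qed
  have z2: "\<bar>z y u - K\<bar> \<le> C0 * exp (- decay_rate * u)" if "ball y" for y u
  proof -
    have "\<bar>z y u - K\<bar> \<le> \<Lambda> * \<bar>heteroclinic u + y u - K\<bar>"
      using \<Lambda>(2)[rule_format, OF xR(1,3)[OF that]] G_K by (simp add: z_def)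
    also have "\<dots> \<le> \<Lambda> * ((CK + 1) * exp (- decay_rate * u))" using x2[OF that, of u] \<Lambda>(1) by (intro mult_left_mono) auto
    also have "\<dots> = (\<Lambda> * (CK + 1)) * exp (- decay_rate * u)" by simp
    also have "\<dots> \<le> C0 * exp (- decay_rate * u)" using C00(3) by (intro mult_right_mono) auto
    finally show ?thesis .
  qed
  have z3: "\<bar>z y u\<bar> \<le> \<Lambda> * R" if "ball y" for y u
  proof -
    have "\<bar>z y u\<bar> \<le> \<Lambda> * \<bar>heteroclinic u + y u\<bar>" using \<Lambda>(2)[rule_format, OF xR(1,4)[OF that]] G_0 by (simp add: z_def)
    also have "\<dots> \<le> \<Lambda> * R" using xR(1)[OF that] \<Lambda>(1) by (intro mult_left_mono) auto
    finally show ?thesis .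
  qed
  have lcb: "continuous_on UNIV (\<lambda>u. lin_coeff u * y u)" "\<bar>lin_coeff u * y u\<bar> \<le> L0" if "ball y" for y u
  proof -
    show "continuous_on UNIV (\<lambda>u. lin_coeff u * y u)" using that by (intro continuous_intros lin_coeff_continuous) (auto simp: ball_def)
    have "\<bar>lin_coeff u\<bar> * \<bar>y u\<bar> \<le> L0 * 1" using L0 yb(1)[OF that, of u] d by (intro mult_mono) auto
    then show "\<bar>lin_coeff u * y u\<bar> \<le> L0" by (simp add: abs_mult)
  qed
  \<comment> \<open>What remains of the profile equation once the linear part at \<epsilon> = 0 is
    split off. The first two terms lie in the weighted space only as a difference.\<close>
  define RR where "RR \<epsilon> y t = conv (wave_kernel \<epsilon>) (z y) t - heteroclinic t - conv (wave_kernel 0) (\<lambda>u. lin_coeff u * y u) t" for \<epsilon> y t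
  have het0: "heteroclinic t = conv (wave_kernel 0) (z (\<lambda>_. 0)) t" for t
    unfolding conv_wave_kernel_0 z_def using heteroclinic_conv[of t] by simp
  have b0: "ball (\<lambda>_. 0)" using d wt_pos by (simp add: ball_def less_imp_le)
  have Kint: "integrable lborel (\<lambda>s. wave_kernel \<epsilon> s * f (t - s))" if "0 \<le> \<epsilon>" "\<epsilon> \<le> eps1" "continuous_on UNIV f" "\<And>u. \<bar>f u\<bar> \<le> Z" for \<epsilon> f t Z
    by (rule wave_kernel_int(1)[OF that(1-3), where V = Z], rule bounded_om, rule that(4))
  have RRc: "continuous_on UNIV (RR \<epsilon> y)" if "0 \<le> \<epsilon>" "\<epsilon> \<le> \<epsilon>2" "ball y" for \<epsilon> y
    unfolding RR_def using that e2
    by (intro continuous_intros wave_kernel_conv_continuous[OF _ _ zc z3] wave_kernel_conv_continuous[OF e0 lcb] heteroclinic_continuous) auto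
  \<comment> \<open>The difference splits into the kernel difference acting on a, the increment of
    the nonlinearity, and the fixed kernel acting on the linearization error a - b.\<close>
  have RRdiff: "\<bar>RR \<epsilon> y t - RR \<epsilon> y' t\<bar> \<le> (\<Lambda> * kdist \<epsilon> 0 + \<omega> * N0) * E * ww t"
    if e: "0 \<le> \<epsilon>" "\<epsilon> \<le> \<epsilon>2" and y: "ball y" "ball y'" and E: "E \<ge> 0" "\<And>t. \<bar>y t - y' t\<bar> \<le> E * ww t" for \<epsilon> y y' E t
  proof -
    have e': "0 \<le> \<epsilon>" "\<epsilon> \<le> eps1" using e e2 by auto
    define a where "a = (\<lambda>u. z y u - z y' u)"
    define b where "b = (\<lambda>u. lin_coeff u * y u - lin_coeff u * y' u)"
    have ac: "continuous_on UNIV a" unfolding a_def by (intro continuous_intros zc y)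
    have bc: "continuous_on UNIV b" unfolding b_def by (intro continuous_intros lcb y)
    have ab: "\<bar>a u\<bar> \<le> \<Lambda> * E * ww u" for u
    proof -
      have "\<bar>a u\<bar> \<le> \<Lambda> * \<bar>y u - y' u\<bar>" using \<Lambda>(2)[rule_format, OF xR(1)[OF y(1)] xR(1)[OF y(2)], of u u] by (simp add: a_def z_def)
      also have "\<dots> \<le> \<Lambda> * (E * ww u)" using E \<Lambda>(1) by (intro mult_left_mono) auto
      finally show ?thesis by (simp add: mult.assoc)
    qed
    have abd: "\<bar>a u - b u\<bar> \<le> \<omega> * E * ww u" for u
    proof -
      have "\<bar>heteroclinic u + y u - heteroclinic u\<bar> \<le> \<delta>1" "\<bar>heteroclinic u + y' u - heteroclinic u\<bar> \<le> \<delta>1"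
        using yb(1)[OF y(1), of u] yb(1)[OF y(2), of u] d by auto
      from d1(2)[rule_format, OF B(2) this]
      have "\<bar>a u - b u\<bar> \<le> \<omega> * \<bar>y u - y' u\<bar>" by (simp add: a_def b_def z_def lin_coeff_def algebra_simps)
      also have "\<dots> \<le> \<omega> * (E * ww u)" using E om0 by (intro mult_left_mono) auto
      finally show ?thesis by (simp add: mult.assoc)
    qed
    have ca: "conv (wave_kernel \<epsilon>) a t = conv (wave_kernel \<epsilon>) (z y) t - conv (wave_kernel \<epsilon>) (z y') t"
      unfolding a_def by (rule conv_diff[OF Kint[OF e' zc[OF y(1)] z3[OF y(1)]] Kint[OF e' zc[OF y(2)] z3[OF y(2)]]])
    have cb: "conv (wave_kernel 0) b t = conv (wave_kernel 0) (\<lambda>u. lin_coeff u * y u) t - conv (wave_kernel 0) (\<lambda>u. lin_coeff u * y' u) t"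
      unfolding b_def by (rule conv_diff[OF Kint[OF e0 lcb[OF y(1)]] Kint[OF e0 lcb[OF y(2)]]])
    have ab3: "\<bar>a u\<bar> \<le> \<Lambda> * E" "\<bar>b u\<bar> \<le> \<Lambda> * E + \<omega> * E" for u
    proof -
      have w: "ww u \<le> 1" by (rule ww_le)
      have "\<Lambda> * E * ww u \<le> \<Lambda> * E * 1" using w \<Lambda>(1) E(1) by (intro mult_left_mono) auto
      moreover have "\<omega> * E * ww u \<le> \<omega> * E * 1" using w om0 E(1) by (intro mult_left_mono) auto
      ultimately show "\<bar>a u\<bar> \<le> \<Lambda> * E" "\<bar>b u\<bar> \<le> \<Lambda> * E + \<omega> * E" using ab[of u] abd[of u] by linarith+
    qed
    have cab: "conv (wave_kernel 0) (\<lambda>u. a u - b u) t = conv (wave_kernel 0) a t - conv (wave_kernel 0) b t"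
      by (rule conv_diff[OF Kint[OF e0 ac ab3(1)] Kint[OF e0 bc ab3(2)]])
    have "RR \<epsilon> y t - RR \<epsilon> y' t = (conv (wave_kernel \<epsilon>) a t - conv (wave_kernel 0) a t) + conv (wave_kernel 0) (\<lambda>u. a u - b u) t"
      unfolding RR_def cab ca cb by simp
    moreover have "\<bar>conv (wave_kernel \<epsilon>) a t - conv (wave_kernel 0) a t\<bar> \<le> (\<Lambda> * E) * kdist \<epsilon> 0 * ww t"
      by (rule wave_kernel_diff_bound_ww[OF e' e0 ac ab]) (use \<Lambda>(1) E in auto)
    moreover have "\<bar>conv (wave_kernel 0) (\<lambda>u. a u - b u) t\<bar> \<le> (\<omega> * E) * N0 * ww t"
      unfolding N0_def by (rule wave_kernel_bound_ww[OF e0 continuous_on_diff[OF ac bc] abd]) (use om0 E in auto)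
    ultimately have "\<bar>RR \<epsilon> y t - RR \<epsilon> y' t\<bar> \<le> (\<Lambda> * E) * kdist \<epsilon> 0 * ww t + (\<omega> * E) * N0 * ww t" by linarith
    then show ?thesis by (simp add: algebra_simps)
  qed
  have RReps: "\<bar>RR \<epsilon> y t - RR \<epsilon>' y t\<bar> \<le> C0 * kdist \<epsilon> \<epsilon>' * ww t"
    if "0 \<le> \<epsilon>" "\<epsilon> \<le> \<epsilon>2" "0 \<le> \<epsilon>'" "\<epsilon>' \<le> \<epsilon>2" "ball y" for \<epsilon> \<epsilon>' y t
    unfolding RR_def using wave_kernel_diff_bound_profile[OF _ _ _ _ zc[OF that(5)] z3[OF that(5)] z1[OF that(5)] z2[OF that(5)], of \<epsilon> \<epsilon>' t] that e2
    by auto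
  \<comment> \<open>For \<epsilon> = 0 the remainder at y = 0 vanishes by
    \<open>heteroclinic_conv\<close>, so for other \<epsilon> only the kernel difference is
    left.\<close>
  have R0: "\<bar>RR \<epsilon> (\<lambda>_. 0) t\<bar> \<le> C0 * kdist \<epsilon> 0 * ww t" if "0 \<le> \<epsilon>" "\<epsilon> \<le> \<epsilon>2" for \<epsilon> t
  proof -
    have "RR 0 (\<lambda>_. 0) t = 0" unfolding RR_def using het0[of t] by (simp add: conv_def)
    then show ?thesis using RReps[OF that _ _ b0, of 0 t] e2 by simp
  qed
  have half: "CS * ((\<Lambda> * kdist \<epsilon> 0 + \<omega> * N0) * E) \<le> E / 2" if "0 \<le> \<epsilon>" "\<epsilon> \<le> \<epsilon>2" "E \<ge> 0" for \<epsilon> E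
  proof -
    have "CS * (\<Lambda> * kdist \<epsilon> 0) + CS * (\<omega> * N0) \<le> 1/2" using Neps(1)[OF that(1,2)] omN by linarith
    from mult_right_mono[OF this that(3)] show ?thesis by (simp add: algebra_simps)
  qed
  have knn: "\<Lambda> * kdist \<epsilon> 0 + \<omega> * N0 \<ge> 0" for \<epsilon>
    using kn_nonneg[of "\<lambda>s. wave_kernel \<epsilon> s - wave_kernel 0 s"] \<Lambda>(1) om0 N0 by simp
  have RRb: "\<bar>RR \<epsilon> y t\<bar> \<le> (C0 * kdist \<epsilon> 0 + (\<Lambda> * kdist \<epsilon> 0 + \<omega> * N0) * \<delta>) * ww t"
    if "0 \<le> \<epsilon>" "\<epsilon> \<le> \<epsilon>2" "ball y" for \<epsilon> y t
  proof -
    have "\<bar>RR \<epsilon> y t - RR \<epsilon> (\<lambda>_. 0) t\<bar> \<le> (\<Lambda> * kdist \<epsilon> 0 + \<omega> * N0) * \<delta> * ww t"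
      by (rule RRdiff[OF that b0]) (use d that(3) in \<open>auto simp: ball_def\<close>)
    moreover have "\<bar>RR \<epsilon> (\<lambda>_. 0) t\<bar> \<le> C0 * kdist \<epsilon> 0 * ww t" by (rule R0[OF that(1,2)])
    ultimately have "\<bar>RR \<epsilon> y t\<bar> \<le> C0 * kdist \<epsilon> 0 * ww t + (\<Lambda> * kdist \<epsilon> 0 + \<omega> * N0) * \<delta> * ww t"
      by linarith
    then show ?thesis by (simp add: distrib_right)
  qed
  have RRF: "C0 * kdist \<epsilon> 0 + (\<Lambda> * kdist \<epsilon> 0 + \<omega> * N0) * \<delta> \<ge> 0" for \<epsilon>
    using knn[of \<epsilon>] kn_nonneg[of "\<lambda>s. wave_kernel \<epsilon> s - wave_kernel 0 s"] C00 d by simp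
  have solRR: "ball (sol (RR \<epsilon> y))" "sol (RR \<epsilon> y) t = past_avg 1 (\<lambda>u. lin_coeff u * sol (RR \<epsilon> y) u) (t - h) + RR \<epsilon> y t"
    if "0 \<le> \<epsilon>" "\<epsilon> \<le> \<epsilon>2" "ball y" for \<epsilon> y t
  proof -
    note s = sol[rule_format, OF RRc[OF that] RRF RRb[OF that]]
    note s1 = s[THEN conjunct1] and s2 = s[THEN conjunct2, THEN conjunct1, rule_format]
      and s3 = s[THEN conjunct2, THEN conjunct2, rule_format]
    let ?F = "C0 * kdist \<epsilon> 0 + (\<Lambda> * kdist \<epsilon> 0 + \<omega> * N0) * \<delta>"
    have F: "CS * ?F \<le> \<delta>"
      using half[OF that(1,2), of \<delta>] Neps(2)[OF that(1,2)] d unfolding distrib_left[of CS] by linarith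
    have "\<bar>sol (RR \<epsilon> y) u\<bar> \<le> \<delta> * ww u" for u
    proof -
      have "CS * ?F * ww u \<le> \<delta> * ww u" using F wt_pos[of "2*lm" decay_rate u] by (intro mult_right_mono) auto
      then show ?thesis by (rule order_trans[OF s2])
    qed
    then show "ball (sol (RR \<epsilon> y))" using s1 unfolding ball_def by blast
    show "sol (RR \<epsilon> y) t = past_avg 1 (\<lambda>u. lin_coeff u * sol (RR \<epsilon> y) u) (t - h) + RR \<epsilon> y t" by (rule s3)
  qed
  text \<open>The solution operator is linear, hence Lipschitz, by uniqueness.\<close>
  have sol_diff: "\<bar>y t - y' t\<bar> \<le> CS * F * ww t"
    if y: "ball y" "ball y'" and f: "continuous_on UNIV f" "continuous_on UNIV f'"
      and eq: "\<And>t. y t = past_avg 1 (\<lambda>u. lin_coeff u * y u) (t - h) + f t" "\<And>t. y' t = past_avg 1 (\<lambda>u. lin_coeff u * y' u) (t - h) + f' t"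
      and F: "F \<ge> 0" "\<And>t. \<bar>f t - f' t\<bar> \<le> F * ww t" for y y' f f' F t
  proof -
    define v where "v = sol (\<lambda>t. f t - f' t)"
    note s = sol[rule_format, OF continuous_on_diff[OF f] F, folded v_def]
    note s1 = s[THEN conjunct1] and s2 = s[THEN conjunct2, THEN conjunct1, rule_format]
      and s3 = s[THEN conjunct2, THEN conjunct2, rule_format]
    have int: "set_integrable lborel {..x} (\<lambda>u. exp (1 * u) * (lin_coeff u * y u))" if "ball y" for y x
      by (rule past_avg_integrable[where b = 0 and Z = L0]) (use lcb[OF that] in auto)
    have "(\<lambda>t. y t - y' t) = v"
    proof (rule ww_bounded_unique)
      show "continuous_on UNIV (\<lambda>t. y t - y' t)" using y by (intro continuous_intros) (auto simp: ball_def)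
      show "\<bar>y t - y' t\<bar> \<le> 2 * ww t" for t using yb(2)[OF y(1), of t] yb(2)[OF y(2), of t] by linarith
      show "y t - y' t = past_avg 1 (\<lambda>u. lin_coeff u * (y u - y' u)) (t - h) + (f t - f' t)" for t
      proof -
        have "past_avg 1 (\<lambda>u. lin_coeff u * (y u - y' u)) (t - h) = past_avg 1 (\<lambda>u. lin_coeff u * y u) (t - h) - past_avg 1 (\<lambda>u. lin_coeff u * y' u) (t - h)"
          using past_avg_diff[OF int[OF y(1)] int[OF y(2)]] by (simp add: right_diff_distrib)
        then show ?thesis using eq(1)[of t] eq(2)[of t] by linarith
      qed
      show "continuous_on UNIV v" by (rule s1)
      show "\<bar>v t\<bar> \<le> CS * F * ww t" for t by (rule s2)
      show "v t = past_avg 1 (\<lambda>u. lin_coeff u * v u) (t - h) + (f t - f' t)" for t by (rule s3)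
    qed
    from fun_cong[OF this, of t] show ?thesis using s2[of t] by simp
  qed
  have ex: "\<exists>y. ball y \<and> (\<forall>t. y t = past_avg 1 (\<lambda>u. lin_coeff u * y u) (t - h) + RR \<epsilon> y t)" if e: "0 \<le> \<epsilon>" "\<epsilon> \<le> \<epsilon>2" for \<epsilon>
  proof -
    have "\<exists>y. continuous_on UNIV y \<and> (\<forall>t. \<bar>y t\<bar> \<le> \<delta> * ww t) \<and> sol (RR \<epsilon> y) = y"
    proof (rule weighted_fixpoint[where \<theta> = "1/2"])
      show "continuous_on UNIV ww" by (rule wt_continuous)
      show "ww t > 0" for t by (rule wt_pos)
      show "\<delta> \<ge> 0" "(0::real) \<le> 1/2" "(1/2::real) < 1" using d by auto
    next
      fix y assume "continuous_on UNIV y" "\<And>t. \<bar>y t\<bar> \<le> \<delta> * ww t"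
      then have "ball y" by (simp add: ball_def)
      from solRR(1)[OF e this] show "continuous_on UNIV (sol (RR \<epsilon> y)) \<and> (\<forall>t. \<bar>sol (RR \<epsilon> y) t\<bar> \<le> \<delta> * ww t)"
        by (simp add: ball_def)
    next
      fix y y' E t assume "continuous_on UNIV y" "\<And>t. \<bar>y t\<bar> \<le> \<delta> * ww t" "continuous_on UNIV y'" "\<And>t. \<bar>y' t\<bar> \<le> \<delta> * ww t"
        and E: "E \<ge> 0" "\<And>t. \<bar>y t - y' t\<bar> \<le> E * ww t"
      then have y: "ball y" "ball y'" by (simp_all add: ball_def)
      have "\<bar>sol (RR \<epsilon> y) t - sol (RR \<epsilon> y') t\<bar> \<le> CS * ((\<Lambda> * kdist \<epsilon> 0 + \<omega> * N0) * E) * ww t"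
        by (rule sol_diff[OF solRR(1)[OF e y(1)] solRR(1)[OF e y(2)] RRc[OF e y(1)] RRc[OF e y(2)] solRR(2)[OF e y(1)] solRR(2)[OF e y(2)]])
          (use RRdiff[OF e y E] knn[of \<epsilon>] E(1) in auto)
      also have "\<dots> \<le> E / 2 * ww t" using half[OF e E(1)] wt_pos[of "2*lm" decay_rate t] by (intro mult_right_mono) auto
      finally show "\<bar>sol (RR \<epsilon> y) t - sol (RR \<epsilon> y') t\<bar> \<le> 1/2 * E * ww t" by simp
    qed
    then obtain y where y: "ball y" "sol (RR \<epsilon> y) = y" by (auto simp: ball_def)
    have "y t = past_avg 1 (\<lambda>u. lin_coeff u * y u) (t - h) + RR \<epsilon> y t" for t
      using solRR(2)[OF e y(1), of t] unfolding y(2) .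
    then show ?thesis using y(1) by blast
  qed
  then obtain Y where Y: "\<And>\<epsilon>. 0 \<le> \<epsilon> \<Longrightarrow> \<epsilon> \<le> \<epsilon>2 \<Longrightarrow> ball (Y \<epsilon>)"
    "\<And>\<epsilon> t. 0 \<le> \<epsilon> \<Longrightarrow> \<epsilon> \<le> \<epsilon>2 \<Longrightarrow> Y \<epsilon> t = past_avg 1 (\<lambda>u. lin_coeff u * Y \<epsilon> u) (t - h) + RR \<epsilon> (Y \<epsilon>) t"
    by metis
  have Ycont: "\<bar>Y \<epsilon> t - Y \<epsilon>' t\<bar> \<le> 2 * CS * C0 * kdist \<epsilon> \<epsilon>'"
    if e: "0 \<le> \<epsilon>" "\<epsilon> \<le> \<epsilon>2" "0 \<le> \<epsilon>'" "\<epsilon>' \<le> \<epsilon>2" for \<epsilon> \<epsilon>' t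
  proof -
    let ?N = "kdist \<epsilon> \<epsilon>'"
    have N: "?N \<ge> 0" by (rule kn_nonneg)
    note y = Y(1)[OF e(1,2)] and y' = Y(1)[OF e(3,4)]
    have NC: "CS * (C0 * ?N) \<ge> 0" using N CS C00 by simp
    \<comment> \<open>Each round halves the part of the distance that is not due to the kernels; the
      start 2 only uses that both functions lie in the ball. In the limit a bound proportional to
      \<open>kdist\<close> remains.\<close>
    have "\<forall>t. \<bar>Y \<epsilon> t - Y \<epsilon>' t\<bar> \<le> (2 * (1/2) ^ n + 2 * (CS * (C0 * ?N))) * ww t" for n
    proof (induction n)
      case 0
      show ?case
      proof
        fix t
        have "\<bar>Y \<epsilon> t - Y \<epsilon>' t\<bar> \<le> 2 * ww t" using yb(2)[OF y, of t] yb(2)[OF y', of t] by linarith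
        also have "\<dots> \<le> (2 * (1/2) ^ 0 + 2 * (CS * (C0 * ?N))) * ww t" using NC wt_pos[of "2*lm" decay_rate t] by (intro mult_right_mono) auto
        finally show "\<bar>Y \<epsilon> t - Y \<epsilon>' t\<bar> \<le> (2 * (1/2) ^ 0 + 2 * (CS * (C0 * ?N))) * ww t" .
      qed
    next
      case (Suc n)
      let ?E = "2 * (1/2) ^ n + 2 * (CS * (C0 * ?N))"
      have E: "?E \<ge> 0" using NC by simp
      let ?F = "(\<Lambda> * kdist \<epsilon> 0 + \<omega> * N0) * ?E + C0 * ?N"
      show ?case
      proof
        fix t
        have "\<bar>Y \<epsilon> t - Y \<epsilon>' t\<bar> \<le> CS * ?F * ww t"
        proof (rule sol_diff[OF y y' RRc[OF e(1,2) y] RRc[OF e(3,4) y'] Y(2)[OF e(1,2)] Y(2)[OF e(3,4)]])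
          show "0 \<le> ?F" using knn[of \<epsilon>] E N C00 by simp
          fix t
          show "\<bar>RR \<epsilon> (Y \<epsilon>) t - RR \<epsilon>' (Y \<epsilon>') t\<bar> \<le> ?F * ww t"
            using RRdiff[OF e(1,2) y y' E Suc[rule_format], of t] RReps[OF e y', of t] by (simp add: distrib_right)
        qed
        also have "\<dots> \<le> (2 * (1/2) ^ Suc n + 2 * (CS * (C0 * ?N))) * ww t"
        proof (rule mult_right_mono)
          have "CS * ?F = CS * ((\<Lambda> * kdist \<epsilon> 0 + \<omega> * N0) * ?E) + CS * (C0 * ?N)" by (rule distrib_left)
          also have "\<dots> \<le> ?E / 2 + CS * (C0 * ?N)" using half[OF e(1,2) E] by linarith
          also have "\<dots> = 2 * (1/2) ^ Suc n + 2 * (CS * (C0 * ?N))" by simp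
          finally show "CS * ?F \<le> 2 * (1/2) ^ Suc n + 2 * (CS * (C0 * ?N))" .
        qed (rule less_imp_le[OF wt_pos])
        finally show "\<bar>Y \<epsilon> t - Y \<epsilon>' t\<bar> \<le> (2 * (1/2) ^ Suc n + 2 * (CS * (C0 * ?N))) * ww t" .
      qed
    qed
    moreover have "(\<lambda>n. (2 * (1/2) ^ n + 2 * (CS * (C0 * ?N))) * ww t) \<longlonglongrightarrow> (2 * 0 + 2 * (CS * (C0 * ?N))) * ww t"
      by (intro tendsto_intros LIMSEQ_power_zero) auto
    ultimately have "\<bar>Y \<epsilon> t - Y \<epsilon>' t\<bar> \<le> (2 * 0 + 2 * (CS * (C0 * ?N))) * ww t"
      by (intro LIMSEQ_le_const) auto
    also have "\<dots> \<le> (2 * 0 + 2 * (CS * (C0 * ?N))) * 1" using NC ww_le(1) by (intro mult_left_mono) auto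
    finally show ?thesis by simp
  qed
  define \<Psi> where "\<Psi> \<epsilon> t = heteroclinic t + Y \<epsilon> t" for \<epsilon> t
  define C where "C = (D + 1) + (CK + 1) + C0 + R + \<Lambda> * R + 2 * CS * C0"
  have Cge: "D + 1 \<le> C" "CK + 1 \<le> C" "C0 \<le> C" "R \<le> C" "\<Lambda> * R \<le> C" "2 * CS * C0 \<le> C" "C > 0"
  proof -
    have "D + 1 > 0" "CK + 1 > 0" "C0 > 0" "R > 0" "\<Lambda> * R > 0" "2 * CS * C0 > 0"
      using D CK C00 B K_pos \<Lambda>(1) CS by (auto simp: R_def)
    then show "D + 1 \<le> C" "CK + 1 \<le> C" "C0 \<le> C" "R \<le> C" "\<Lambda> * R \<le> C" "2 * CS * C0 \<le> C" "C > 0"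
      unfolding C_def by linarith+
  qed
  have main: "continuous_on UNIV (\<Psi> \<epsilon>) \<and>
        (\<forall>t. \<Psi> \<epsilon> t > 0) \<and> (\<forall>t. \<Psi> \<epsilon> t \<le> C) \<and>
        (\<forall>t. \<bar>\<Psi> \<epsilon> t - exp (lm * t)\<bar> \<le> C * exp (2 * lm * t)) \<and>
        (\<forall>t. \<bar>\<Psi> \<epsilon> t - K\<bar> \<le> C * exp (- decay_rate * t)) \<and>
        (\<forall>t. \<bar>G (\<Psi> \<epsilon> t) - p * exp (lm * t)\<bar> \<le> C * exp (2 * lm * t)) \<and>
        (\<forall>t. \<bar>G (\<Psi> \<epsilon> t)\<bar> \<le> C) \<and>
        (\<forall>t. \<Psi> \<epsilon> t = conv (wave_kernel \<epsilon>) (\<lambda>u. G (\<Psi> \<epsilon> u)) t)" if e: "0 \<le> \<epsilon>" "\<epsilon> \<le> \<epsilon>2" for \<epsilon>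
  proof (intro conjI allI)
    note y = Y(1)[OF e]
    show "continuous_on UNIV (\<Psi> \<epsilon>)" unfolding \<Psi>_def using y by (intro continuous_intros heteroclinic_continuous) (auto simp: ball_def)
    fix t
    show "\<Psi> \<epsilon> t > 0"
    proof (cases "t \<ge> T0")
      case True
      then show ?thesis using T0(2)[rule_format, OF True] yb(1)[OF y, of t] d(4) unfolding \<Psi>_def by linarith
    next
      case False
      then have "(D + 1) * exp (lm * t) \<le> 1/2" using T0(3) by auto
      then have "(D + 1) * exp (lm * t) * exp (lm * t) \<le> 1/2 * exp (lm * t)" by (rule mult_right_mono) simp
      moreover have "(D + 1) * exp (2 * lm * t) = (D + 1) * exp (lm * t) * exp (lm * t)" by (simp add: exp_add[symmetric] mult.assoc)
      ultimately show ?thesis using x1[OF y, of t] exp_gt_zero[of "lm * t"] unfolding \<Psi>_def by linarith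
    qed
    show "\<Psi> \<epsilon> t \<le> C" using xR(1)[OF y, of t] Cge(4) unfolding \<Psi>_def by linarith
    show "\<bar>\<Psi> \<epsilon> t - exp (lm * t)\<bar> \<le> C * exp (2 * lm * t)"
      using order_trans[OF x1[OF y] mult_right_mono[OF Cge(1)]] unfolding \<Psi>_def by simp
    show "\<bar>\<Psi> \<epsilon> t - K\<bar> \<le> C * exp (- decay_rate * t)"
      using order_trans[OF x2[OF y] mult_right_mono[OF Cge(2)]] unfolding \<Psi>_def by simp
    show "\<bar>G (\<Psi> \<epsilon> t) - p * exp (lm * t)\<bar> \<le> C * exp (2 * lm * t)"
      using order_trans[OF z1[OF y] mult_right_mono[OF Cge(3)]] unfolding \<Psi>_def z_def by simp
    show "\<bar>G (\<Psi> \<epsilon> t)\<bar> \<le> C" using z3[OF y, of t] Cge(5) unfolding \<Psi>_def z_def by linarith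
    show "\<Psi> \<epsilon> t = conv (wave_kernel \<epsilon>) (\<lambda>u. G (\<Psi> \<epsilon> u)) t"
    proof -
      have "conv (wave_kernel \<epsilon>) (\<lambda>u. G (\<Psi> \<epsilon> u)) t = conv (wave_kernel \<epsilon>) (z (Y \<epsilon>)) t" by (simp add: \<Psi>_def z_def[abs_def])
      moreover have "Y \<epsilon> t = conv (wave_kernel 0) (\<lambda>u. lin_coeff u * Y \<epsilon> u) t + RR \<epsilon> (Y \<epsilon>) t" unfolding conv_wave_kernel_0 by (rule Y(2)[OF e])
      ultimately show ?thesis unfolding RR_def \<Psi>_def by linarith
    qed
  qed
  have cont: "\<bar>\<Psi> \<epsilon> t - \<Psi> \<epsilon>' t\<bar> \<le> C * kdist \<epsilon> \<epsilon>'"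
    if "0 \<le> \<epsilon>" "\<epsilon> \<le> \<epsilon>2" "0 \<le> \<epsilon>'" "\<epsilon>' \<le> \<epsilon>2" for \<epsilon> \<epsilon>' t
    using order_trans[OF Ycont[OF that] mult_right_mono[OF Cge(6) kn_nonneg]] unfolding \<Psi>_def by simp
  show ?thesis
    by (rule exI[of _ \<epsilon>2], intro conjI e2, rule exI[of _ \<Psi>], rule exI[of _ C], intro conjI Cge(7) allI impI)
      (use main cont in blast)+
qed

end

section \<open>Regularity, asymptotics and oscillation of profiles\<close>

lemma past_avg_nonpos:
  assumes "\<And>u. u \<le> x \<Longrightarrow> z u \<le> 0"
  shows "past_avg a z x \<le> 0"
proof -
  have "0 \<le> (LINT u|lborel. - (indicator {..x} u *\<^sub>R (exp (a * u) * z u)))"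
    by (rule integral_nonneg_AE) (use assms in \<open>auto intro!: AE_I2 simp: indicator_def mult_nonneg_nonpos\<close>)
  then have "(LINT u:{..x}|lborel. exp (a * u) * z u) \<le> 0"
    unfolding set_lebesgue_integral_def by simp
  then show ?thesis unfolding past_avg_def by (simp add: mult_nonneg_nonpos)
qed

lemma future_avg_nonpos:
  assumes "\<And>u. u \<ge> x \<Longrightarrow> z u \<le> 0"
  shows "future_avg b z x \<le> 0"
  unfolding future_avg_def by (rule past_avg_nonpos) (use assms in auto)

lemma future_avg_mult: "future_avg b (\<lambda>u. c * z u) x = c * future_avg b z x"
proof -
  have "exp (b * u) * (c * z (- u)) = c * (exp (b * u) * z (- u))" for u by simp
  then show ?thesis unfolding future_avg_def past_avg_def by (simp only: set_integral_mult_right) simp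
qed

lemma future_avg_diff:
  assumes z: "continuous_on UNIV z" "\<And>u. \<bar>z u\<bar> \<le> Z * exp (c * u)" "c < b"
    and z': "continuous_on UNIV z'" "\<And>u. \<bar>z' u\<bar> \<le> Z' * exp (c' * u)" "c' < b"
  shows "future_avg b (\<lambda>u. z u - z' u) x = future_avg b z x - future_avg b z' x"
proof -
  have int: "set_integrable lborel {..y} (\<lambda>u. exp (b * u) * z (- u))"
    if "continuous_on UNIV z" "\<And>u. \<bar>z u\<bar> \<le> Z * exp (c * u)" "c < b" for z c Z y
  proof (rule past_avg_integrable[where b = "- c" and Z = Z])
    show "continuous_on UNIV (\<lambda>u. z (- u))"
      by (rule continuous_on_compose2[OF that(1)]) (auto intro!: continuous_intros)
    show "\<bar>z (- u)\<bar> \<le> Z * exp (- c * u)" for u using that(2)[of "- u"] by simp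
  qed (use that in auto)
  show ?thesis unfolding future_avg_def by (rule past_avg_diff[OF int[OF z] int[OF z']])
qed

context wave
begin

context
  fixes \<epsilon> C :: real and \<Psi> :: "real \<Rightarrow> real"
  assumes e: "0 < \<epsilon>" "\<epsilon> \<le> eps1" and psic: "continuous_on UNIV \<Psi>"
    and pos: "\<And>t. \<Psi> t > 0"
    and asym: "\<And>t. \<bar>\<Psi> t - exp (lm * t)\<bar> \<le> C * exp (2 * lm * t)"
    and lim: "\<And>t. \<bar>\<Psi> t - K\<bar> \<le> C * exp (- decay_rate * t)"
    and psiC: "\<And>t. \<Psi> t \<le> C"
    and Gasym: "\<And>t. \<bar>G (\<Psi> t) - p * exp (lm * t)\<bar> \<le> C * exp (2 * lm * t)"
    and Gb: "\<And>t. \<bar>G (\<Psi> t)\<bar> \<le> C"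
    and eq: "\<And>t. \<Psi> t = conv (wave_kernel \<epsilon>) (\<lambda>u. G (\<Psi> u)) t"
begin

text \<open>Applying the factor D + ka of the wave operator to the profile eliminates the past
  average and leaves a multiple of the future average. The expression contains no derivative, so it
  can be differentiated again and estimated directly.\<close>

definition profile_deriv :: "real \<Rightarrow> real" where
  "profile_deriv t = - ka \<epsilon> * \<Psi> t + ka \<epsilon> / kq \<epsilon> * future_avg (1 / kq \<epsilon>) (\<lambda>u. G (\<Psi> u)) (t - kd \<epsilon>)"

lemma q_pos: "kq \<epsilon> > 0" "1 / kq \<epsilon> \<ge> 2 * lm + 1" and a_pos: "ka \<epsilon> > 0" and A_pos: "kA \<epsilon> > 0"
  using kq_pos kq_inv param_bounds[of \<epsilon>] e by auto

lemma A_eq: "kA \<epsilon> * (ka \<epsilon> + 1 / kq \<epsilon>) = ka \<epsilon> / kq \<epsilon>"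
proof -
  have "kA \<epsilon> * (1 / ka \<epsilon> + kq \<epsilon>) * (ka \<epsilon> / kq \<epsilon>) = ka \<epsilon> / kq \<epsilon>" using param_eqs(1)[of \<epsilon>] e by simp
  moreover have "kA \<epsilon> * (1 / ka \<epsilon> + kq \<epsilon>) * (ka \<epsilon> / kq \<epsilon>) = kA \<epsilon> * (ka \<epsilon> + 1 / kq \<epsilon>)"
    using q_pos(1) a_pos by (simp add: field_simps)
  ultimately show ?thesis by metis
qed

lemma Gpsi_continuous: "continuous_on UNIV (\<lambda>u. G (\<Psi> u))"
  by (rule continuous_on_compose2[OF G_continuous[of UNIV] psic]) auto

lemma F_deriv: "((\<lambda>t. future_avg (1 / kq \<epsilon>) (\<lambda>u. G (\<Psi> u)) (t - kd \<epsilon>)) has_real_derivative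
   1 / kq \<epsilon> * future_avg (1 / kq \<epsilon>) (\<lambda>u. G (\<Psi> u)) (t - kd \<epsilon>) - G (\<Psi> (t - kd \<epsilon>))) (at t)"
proof -
  have b: "1 / kq \<epsilon> > 0" using q_pos by simp
  show ?thesis
    by (rule DERIV_delay, rule future_avg_deriv[OF Gpsi_continuous b]) (use Gb in auto)
qed

lemma psi_deriv: "(\<Psi> has_real_derivative profile_deriv t) (at t)"
proof -
  let ?z = "\<lambda>u. G (\<Psi> u)" and ?a = "ka \<epsilon>" and ?q = "kq \<epsilon>" and ?d = "kd \<epsilon>"
  have a0: "?a + 0 > 0" using a_pos by simp
  have rep: "\<Psi> t = kA \<epsilon> * (past_avg ?a ?z (t - ?d) + future_avg (1 / ?q) ?z (t - ?d))" for t
    unfolding eq[of t] by (rule conv_wave_kernel_pos[OF _ _ e(1) Gpsi_continuous, of C 0]) (use e Gb lam_props(1) in auto)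
  have P: "((\<lambda>t. past_avg ?a ?z (t - ?d)) has_real_derivative ?z (t - ?d) - ?a * past_avg ?a ?z (t - ?d)) (at t)"
    by (rule DERIV_delay, rule past_avg_deriv[OF Gpsi_continuous a0]) (use Gb in auto)
  let ?P = "past_avg ?a ?z (t - ?d)" and ?F = "future_avg (1 / ?q) ?z (t - ?d)"
  have "((\<lambda>t. kA \<epsilon> * (past_avg ?a ?z (t - ?d) + future_avg (1 / ?q) ?z (t - ?d))) has_real_derivative
     kA \<epsilon> * ((?z (t - ?d) - ?a * ?P) + (1 / ?q * ?F - ?z (t - ?d)))) (at t)"
    by (intro DERIV_cmult DERIV_add P F_deriv)
  moreover have "kA \<epsilon> * ((?z (t - ?d) - ?a * ?P) + (1 / ?q * ?F - ?z (t - ?d))) = - ?a * \<Psi> t + (kA \<epsilon> * (?a + 1 / ?q)) * ?F"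
    unfolding rep[of t] by (simp add: algebra_simps)
  moreover have "(\<lambda>t. kA \<epsilon> * (past_avg ?a ?z (t - ?d) + future_avg (1 / ?q) ?z (t - ?d))) = \<Psi>"
    using rep by (intro ext) (rule sym)
  ultimately show ?thesis unfolding A_eq profile_deriv_def by simp
qed

lemma psi_deriv2: "(profile_deriv has_real_derivative (time_scale \<epsilon> * profile_deriv t + \<Psi> t - G (\<Psi> (t - kd \<epsilon>))) / (\<epsilon> * (time_scale \<epsilon>)\<^sup>2)) (at t)"
proof -
  let ?a = "ka \<epsilon>" and ?q = "kq \<epsilon>" and ?z = "G (\<Psi> (t - kd \<epsilon>))"
  let ?F = "future_avg (1 / ?q) (\<lambda>u. G (\<Psi> u)) (t - kd \<epsilon>)"
  define x where "x = 1 / ?a"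
  have x: "x > 0" "?a = 1 / x" using a_pos by (simp_all add: x_def)
  have pe: "x - ?q = time_scale \<epsilon>" "x * ?q = \<epsilon> * (time_scale \<epsilon>)\<^sup>2" using param_eqs(2,3)[of \<epsilon>] e by (simp_all add: x_def)
  have "(profile_deriv has_real_derivative - ?a * profile_deriv t + ?a / ?q * (1 / ?q * ?F - ?z)) (at t)"
    unfolding profile_deriv_def by (intro DERIV_add DERIV_cmult psi_deriv[unfolded profile_deriv_def] F_deriv)
  moreover have "- ?a * profile_deriv t + ?a / ?q * (1 / ?q * ?F - ?z) = (time_scale \<epsilon> * profile_deriv t + \<Psi> t - ?z) / (\<epsilon> * (time_scale \<epsilon>)\<^sup>2)"
  proof -
    have F: "?a / ?q * ?F = profile_deriv t + ?a * \<Psi> t" by (simp add: profile_deriv_def)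
    have "- ?a * profile_deriv t + ?a / ?q * (1 / ?q * ?F - ?z) = - ?a * profile_deriv t + 1 / ?q * (?a / ?q * ?F) - ?a / ?q * ?z"
      by (simp add: algebra_simps)
    also have "\<dots> = - ?a * profile_deriv t + 1 / ?q * (profile_deriv t + ?a * \<Psi> t) - ?a / ?q * ?z" unfolding F ..
    also have "\<dots> = ((x - ?q) * profile_deriv t + \<Psi> t - ?z) / (x * ?q)"
      unfolding x(2) using x(1) q_pos(1) by (simp add: field_simps)
    finally show ?thesis unfolding pe .
  qed
  ultimately show ?thesis by simp
qed

text \<open>Subtracting p exp (\<lambda> t), whose future average is explicit, leaves an error O(exp
  (2 \<lambda> t)), and this order is preserved by the future average because 1 / kq > 2
  \<lambda>.\<close>

lemma profile_deriv_asym: "\<exists>C'>0. \<forall>t. \<bar>profile_deriv t - lm * exp (lm * t)\<bar> \<le> C' * exp (2 * lm * t)"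
proof -
  let ?z = "\<lambda>u. G (\<Psi> u)" and ?a = "ka \<epsilon>" and ?q = "kq \<epsilon>" and ?d = "kd \<epsilon>"
  have l: "lm > 0" by (rule lam_props)
  have C0: "C \<ge> 0" using Gb[of 0] by linarith
  have b: "1 / ?q > lm" "1 / ?q > 2 * lm" "1 / ?q > 0" using q_pos l by auto
  have d0: "?d \<ge> 0" using param_bounds(4)[of \<epsilon>] e h_pos by simp
  define C' where "C' = ?a * C + ?a / ?q * (C / (1 / ?q - 2 * lm)) + 1"
  have est: "\<bar>profile_deriv t - lm * exp (lm * t)\<bar> \<le> C' * exp (2 * lm * t)" for t
  proof -
    let ?F = "future_avg (1 / ?q) ?z (t - ?d)" and ?E = "p / (1 / ?q - lm) * exp (lm * (t - ?d))"
    have "future_avg (1 / ?q) (\<lambda>u. ?z u - p * exp (lm * u)) (t - ?d) = ?F - future_avg (1 / ?q) (\<lambda>u. p * exp (lm * u)) (t - ?d)"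
      by (rule future_avg_diff[OF Gpsi_continuous _ b(3) _ _ b(1), where Z = C and Z' = p])
        (use Gb p_gt1 in \<open>auto simp: abs_mult intro!: continuous_intros\<close>)
    then have FE: "?F - ?E = future_avg (1 / ?q) (\<lambda>u. ?z u - p * exp (lm * u)) (t - ?d)"
      using future_avg_exp[OF b(1), of p "t - ?d"] by simp
    have "\<bar>future_avg (1 / ?q) (\<lambda>u. ?z u - p * exp (lm * u)) (t - ?d)\<bar> \<le> C / (1 / ?q - 2 * lm) * exp (2 * lm * (t - ?d))"
      by (rule future_avg_bound[OF b(2)]) (use Gasym Gpsi_continuous in \<open>auto intro!: continuous_intros\<close>)
    also have "\<dots> \<le> C / (1 / ?q - 2 * lm) * exp (2 * lm * t)"
      using d0 l b C0 by (intro mult_left_mono) auto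
    finally have 1: "\<bar>?F - ?E\<bar> \<le> C / (1 / ?q - 2 * lm) * exp (2 * lm * t)" unfolding FE .
    \<comment> \<open>The characteristic equation in factored form, p exp (- \<lambda> kd) = (1 +
      \<lambda> / ka) (1 - \<lambda> kq), cancels the denominator of the explicit average. The
      summand ka exp (\<lambda> t) then cancels against the term - ka \<Psi>.\<close>
    have 2: "?a / ?q * ?E = (?a + lm) * exp (lm * t)"
    proof -
      define x where "x = 1 / ?a"
      have x: "x > 0" "?a = 1 / x" using a_pos by (simp_all add: x_def)
      have pe: "x - ?q = time_scale \<epsilon>" "x * ?q = \<epsilon> * (time_scale \<epsilon>)\<^sup>2" using param_eqs(2,3)[of \<epsilon>] e by (simp_all add: x_def)
      have ls: "lm * time_scale \<epsilon> = lead_root \<epsilon>" "lm * ?d = lead_root \<epsilon> * h" using l by (simp_all add: time_scale_def kd_def)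
      have "p * exp (- (lm * ?d)) = 1 + lead_root \<epsilon> - \<epsilon> * (lead_root \<epsilon>)\<^sup>2"
        using lead_root(3)[of \<epsilon>] e unfolding ls by (simp add: chi_def)
      also have "\<dots> = 1 + lm * (x - ?q) - lm\<^sup>2 * (x * ?q)" unfolding pe ls(1)[symmetric] by (simp add: power_mult_distrib)
      also have "\<dots> = (1 + lm * x) * (1 - lm * ?q)" by (simp add: power2_eq_square algebra_simps)
      finally have pf: "p * exp (- (lm * ?d)) = (1 + lm * x) * (1 - lm * ?q)" .
      have "lm * ?q < 1" using b(1) q_pos(1) by (simp add: field_simps)
      then have n: "1 - lm * ?q \<noteq> 0" by simp
      have "1 / ?q - lm = (1 - lm * ?q) / ?q" using q_pos(1) by (simp add: field_simps)
      then have "?a / ?q * ?E = ?a * (p * exp (- (lm * ?d))) / (1 - lm * ?q) * exp (lm * t)"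
        using q_pos(1) by (simp add: exp_diff exp_minus right_diff_distrib field_simps)
      also have "\<dots> = ?a * (1 + lm * x) * exp (lm * t)" unfolding pf using n by simp
      also have "?a * (1 + lm * x) = ?a + lm" unfolding x(2) using x(1) by (simp add: field_simps)
      finally show ?thesis .
    qed
    have "profile_deriv t - lm * exp (lm * t) = - ?a * (\<Psi> t - exp (lm * t)) + ?a / ?q * (?F - ?E)"
      unfolding right_diff_distrib[of "?a / ?q"] 2 profile_deriv_def by (simp add: algebra_simps)
    then have "\<bar>profile_deriv t - lm * exp (lm * t)\<bar> \<le> ?a * \<bar>\<Psi> t - exp (lm * t)\<bar> + ?a / ?q * \<bar>?F - ?E\<bar>"
      using abs_triangle_ineq[of "- ?a * (\<Psi> t - exp (lm * t))" "?a / ?q * (?F - ?E)"] a_pos q_pos(1) by (simp add: abs_mult)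
    also have "\<dots> \<le> ?a * (C * exp (2 * lm * t)) + ?a / ?q * (C / (1 / ?q - 2 * lm) * exp (2 * lm * t))"
      using 1 asym[of t] a_pos q_pos(1) by (intro add_mono mult_left_mono) auto
    also have "\<dots> \<le> C' * exp (2 * lm * t)" by (simp only: C'_def distrib_right mult.assoc) simp
    finally show ?thesis .
  qed
  have "C / (1 / ?q - 2 * lm) \<ge> 0" using C0 b by simp
  then have "C' > 0" unfolding C'_def using a_pos q_pos(1) C0 by (intro add_nonneg_pos add_nonneg_nonneg mult_nonneg_nonneg) auto
  then show ?thesis using est by blast
qed

lemma profile_deriv_bounded: "\<bar>profile_deriv t\<bar> \<le> 2 * ka \<epsilon> * C"
proof -
  have b: "1 / kq \<epsilon> > 0" using q_pos by simp
  have "\<bar>future_avg (1 / kq \<epsilon>) (\<lambda>u. G (\<Psi> u)) (t - kd \<epsilon>)\<bar> \<le> C / (1 / kq \<epsilon> - 0) * exp (0 * (t - kd \<epsilon>))"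
    by (rule future_avg_bound[OF b Gpsi_continuous]) (use Gb in auto)
  then have "\<bar>future_avg (1 / kq \<epsilon>) (\<lambda>u. G (\<Psi> u)) (t - kd \<epsilon>)\<bar> \<le> C * kq \<epsilon>" by simp
  then have "ka \<epsilon> / kq \<epsilon> * \<bar>future_avg (1 / kq \<epsilon>) (\<lambda>u. G (\<Psi> u)) (t - kd \<epsilon>)\<bar> \<le> ka \<epsilon> / kq \<epsilon> * (C * kq \<epsilon>)"
    using a_pos q_pos(1) by (intro mult_left_mono) auto
  then have 1: "\<bar>ka \<epsilon> / kq \<epsilon> * future_avg (1 / kq \<epsilon>) (\<lambda>u. G (\<Psi> u)) (t - kd \<epsilon>)\<bar> \<le> ka \<epsilon> * C"
    using a_pos q_pos(1) by (simp add: abs_mult)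
  have "\<bar>- ka \<epsilon> * \<Psi> t\<bar> \<le> ka \<epsilon> * C" using pos[of t] psiC[of t] a_pos by (simp add: abs_mult)
  with 1 show ?thesis unfolding profile_deriv_def by linarith
qed

lemma psi_lipschitz: "\<bar>\<Psi> t - \<Psi> s\<bar> \<le> 2 * ka \<epsilon> * C * \<bar>t - s\<bar>"
proof -
  have *: "\<bar>\<Psi> t - \<Psi> s\<bar> \<le> 2 * ka \<epsilon> * C * \<bar>t - s\<bar>" if st: "s < t" for s t
  proof -
    obtain x where "\<Psi> t - \<Psi> s = (t - s) * profile_deriv x" using MVT2[OF st, of \<Psi> profile_deriv] psi_deriv by blast
    then show ?thesis using mult_right_mono[OF profile_deriv_bounded[of x], of "\<bar>t - s\<bar>"] by (simp add: abs_mult mult.commute)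
  qed
  consider "s < t" | "t < s" | "s = t" by linarith
  then show ?thesis by cases (use *[of s t] *[of t s] in \<open>auto simp: abs_minus_commute\<close>)
qed

text \<open>Near \<open>K\<close> the map \<open>G\<close> is injective, so being equal to \<open>K\<close> on a half-line propagates to the left.\<close>

lemma not_eventually_K:
  assumes "g' K \<noteq> 0"
  shows "\<exists>t\<ge>t1. \<Psi> t \<noteq> K"
proof (rule ccontr)
  assume "\<not> ?thesis"
  then have t1: "\<forall>t\<ge>t1. \<Psi> t = K" by auto
  define \<Gamma> where "\<Gamma> = G1 K"
  have \<Gamma>: "\<bar>\<Gamma>\<bar> > 0" using assms K_pos by (simp add: \<Gamma>_def G1_def)
  have w: "\<bar>\<Gamma>\<bar> / 2 > 0" using \<Gamma> by simp
  obtain \<delta> where d: "\<delta> > 0" "\<forall>a x y. \<bar>a\<bar> \<le> K \<longrightarrow> \<bar>x - a\<bar> \<le> \<delta> \<longrightarrow> \<bar>y - a\<bar> \<le> \<delta> \<longrightarrow>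
      \<bar>G x - G y - G1 a * (x - y)\<bar> \<le> \<bar>\<Gamma>\<bar> / 2 * \<bar>x - y\<bar>"
    using G_uniform_diff[OF w, of K] by blast
  have inj: "x = K" if "\<bar>x - K\<bar> \<le> \<delta>" "G x = K" for x
  proof -
    have "\<bar>\<Gamma> * (x - K)\<bar> \<le> \<bar>\<Gamma>\<bar> / 2 * \<bar>x - K\<bar>"
      using d(2)[rule_format, of K x K] that d(1) K_pos G_K by (simp add: \<Gamma>_def)
    then have "\<bar>\<Gamma>\<bar> * \<bar>x - K\<bar> \<le> 0" by (simp add: abs_mult)
    then have "\<bar>x - K\<bar> \<le> 0" using \<Gamma> by (simp add: mult_le_0_iff)
    then show ?thesis by simp
  qed
  have a: "ka \<epsilon> > 0" by (rule a_pos)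
  have C0: "C > 0" using pos[of 0] psiC[of 0] by linarith
  define r where "r = \<delta> / (2 * ka \<epsilon> * C)"
  \<comment> \<open>Shorter than a delay, and so short that by the Lipschitz bound \<Psi> stays in
    the region where \<open>G\<close> takes the value \<open>K\<close> only at
    \<open>K\<close>.\<close>
  define \<eta> where "\<eta> = min (kd \<epsilon>) r / 2"
  have dpos: "kd \<epsilon> > 0" using param_bounds(4)[of \<epsilon>] e h_pos by simp
  have eta: "\<eta> > 0" using dpos d a C0 by (simp add: \<eta>_def r_def)
  have eta2: "\<eta> \<le> kd \<epsilon> / 2" "\<eta> \<le> r / 2" by (simp_all add: \<eta>_def)
  have step_back: "\<forall>t\<ge>T - \<eta>. \<Psi> t = K" if T: "\<forall>t\<ge>T. \<Psi> t = K" for T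
  proof (intro allI impI)
    fix u assume u: "u \<ge> T - \<eta>"
    show "\<Psi> u = K"
    proof (cases "u \<ge> T")
      case True then show ?thesis using T by simp
    next
      case False
      have "G (\<Psi> u) = K"
      proof -
        \<comment> \<open>One rescaled delay after u the profile is already constant, so the profile
          equation at t reduces to G (\<Psi> u) = K.\<close>
        define t where "t = u + kd \<epsilon>"
        have tT: "t > T" using u eta2(1) dpos unfolding t_def by linarith
        have c: "(\<Psi> has_real_derivative 0) (at x)" if "x > T" for x
          by (rule has_field_derivative_transform_within_open[OF DERIV_const[of K], of "{T<..}"])
            (use that T in auto)
        have pd0: "profile_deriv x = 0" if "x > T" for x using DERIV_unique[OF psi_deriv c[OF that]] .
        have "(profile_deriv has_real_derivative 0) (at t)"
          by (rule has_field_derivative_transform_within_open[OF DERIV_const[of 0], of "{T<..}"])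
            (use tT pd0 in auto)
        from DERIV_unique[OF psi_deriv2 this]
        have "(time_scale \<epsilon> * profile_deriv t + \<Psi> t - G (\<Psi> (t - kd \<epsilon>))) / (\<epsilon> * (time_scale \<epsilon>)\<^sup>2) = 0" .
        then have "time_scale \<epsilon> * profile_deriv t + \<Psi> t - G (\<Psi> (t - kd \<epsilon>)) = 0" using time_scale_bounds(1)[of \<epsilon>] e by simp
        then show ?thesis using pd0[OF tT] T tT by (simp add: t_def)
      qed
      moreover have "\<bar>\<Psi> u - K\<bar> \<le> \<delta>"
      proof -
        have "\<bar>\<Psi> u - \<Psi> T\<bar> \<le> 2 * ka \<epsilon> * C * \<bar>u - T\<bar>" by (rule psi_lipschitz)
        also have "\<dots> \<le> 2 * ka \<epsilon> * C * r"
        proof (rule mult_left_mono)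
          have "r > 0" using d a C0 by (simp add: r_def)
          then show "\<bar>u - T\<bar> \<le> r" using u False eta2(2) by linarith
        qed (use a C0 in auto)
        also have "\<dots> = \<delta>" using a C0 by (simp add: r_def)
        finally show ?thesis using T by simp
      qed
      ultimately show ?thesis using inj by blast
    qed
  qed
  have all: "\<forall>t\<ge>t1 - real n * \<eta>. \<Psi> t = K" for n
  proof (induction n)
    case (Suc n)
    have "t1 - real (Suc n) * \<eta> = t1 - real n * \<eta> - \<eta>" by (simp add: algebra_simps)
    then show ?case using step_back[OF Suc] by simp
  qed (use t1 in simp)
  have allK: "\<Psi> t = K" for t
  proof -
    obtain n where "t1 - t < real n * \<eta>" using reals_Archimedean3[OF eta] by blast
    then show ?thesis using all[of n] by simp
  qed
  have l: "lm > 0" by (rule lam_props)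
  have "((\<lambda>t. exp (lm * t) + C * exp (2 * lm * t)) \<longlongrightarrow> 0) at_bot" using l by real_asymp
  then have "\<forall>\<^sub>F t in at_bot. exp (lm * t) + C * exp (2 * lm * t) < K" using K_pos by (rule order_tendstoD)
  then obtain t where "exp (lm * t) + C * exp (2 * lm * t) < K" unfolding eventually_at_bot_linorder by blast
  then show False using asym[of t] allK[of t] by linarith
qed

lemma oscillation:
  assumes \<Gamma>: "g' K < 0" and s: "0 < s" "s < 1"
    and crit: "kA \<epsilon> * (s * \<bar>g' K\<bar>) * exp (ka \<epsilon> * kd \<epsilon>) * (1 - kq \<epsilon> / ((1 - s) * h)) * (kd \<epsilon> - (1 - s) * h) * exp 1 > 1"
    and sn: "sn = 1 \<or> sn = (-1::real)"
  shows "\<exists>t\<ge>t1. sn * (\<Psi> t - K) < 0"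
proof (rule ccontr)
  assume "\<not> ?thesis"
  then have y0: "\<forall>t\<ge>t1. sn * (\<Psi> t - K) \<ge> 0" by (auto simp: not_less)
  let ?a = "ka \<epsilon>" and ?d = "kd \<epsilon>"
  define b where "b = 1 / kq \<epsilon>"
  have qb: "kq \<epsilon> = 1 / b" by (simp add: b_def)
  define r0 where "r0 = (1 - s) * h"
  define Ah where "Ah = s * \<bar>g' K\<bar>"
  have G1K: "G1 K = g' K" using K_pos by (simp add: G1_def)
  have Ah: "Ah > 0" "r0 > 0" using mult_pos_pos[OF s(1), of "\<bar>g' K\<bar>"] \<Gamma> s h_pos by (simp_all add: Ah_def r0_def)
  have ab: "?a > 0" "b > 0" "?d \<ge> h" unfolding b_def using a_pos q_pos(1) param_bounds(4)[of \<epsilon>] e by auto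
  have om0: "(1 - s) * \<bar>g' K\<bar> > 0" using \<Gamma> s by (intro mult_pos_pos) auto
  obtain \<delta> where d: "\<delta> > 0" "\<forall>a x y. \<bar>a\<bar> \<le> K \<longrightarrow> \<bar>x - a\<bar> \<le> \<delta> \<longrightarrow> \<bar>y - a\<bar> \<le> \<delta> \<longrightarrow>
      \<bar>G x - G y - G1 a * (x - y)\<bar> \<le> ((1 - s) * \<bar>g' K\<bar>) * \<bar>x - y\<bar>"
    using G_uniform_diff[OF om0, of K] by blast
  have "((\<lambda>t. exp (- \<gamma> * t)) \<longlongrightarrow> 0) at_top" if "\<gamma> > 0" for \<gamma> :: real using that by real_asymp
  from this[OF decay_rate(1)] have "((\<lambda>t. exp (- decay_rate * t)) \<longlongrightarrow> 0) at_top" .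
  then have "((\<lambda>t. C * exp (- decay_rate * t)) \<longlongrightarrow> 0) at_top" by (rule tendsto_mult_right_zero)
  then have "\<forall>\<^sub>F t in at_top. C * exp (- decay_rate * t) < \<delta>" using d(1) by (rule order_tendstoD)
  then obtain N where N: "\<forall>t\<ge>N. C * exp (- decay_rate * t) < \<delta>" unfolding eventually_at_top_linorder by blast
  define T where "T = max t1 N"
  define y where "y t = sn * (\<Psi> t - K)" for t
  define f where "f t = sn * (G (\<Psi> t) - K)" for t
  have ynn: "y t \<ge> 0" if "t \<ge> T" for t using y0 that by (simp add: y_def T_def)
  have fy: "f t \<le> - Ah * y t" if t: "t \<ge> T" for t
  proof -
    have "\<bar>\<Psi> t - K\<bar> \<le> \<delta>" using lim[of t] N t by (fastforce simp: T_def)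
    then have 1: "\<bar>G (\<Psi> t) - K - g' K * (\<Psi> t - K)\<bar> \<le> (1 - s) * \<bar>g' K\<bar> * \<bar>\<Psi> t - K\<bar>"
      using d(2)[rule_format, of K "\<Psi> t" K] d(1) K_pos G_K by (simp add: G1K)
    have ay: "\<bar>\<Psi> t - K\<bar> = y t" using ynn[OF t] sn by (auto simp: y_def)
    have "f t - g' K * y t = sn * (G (\<Psi> t) - K - g' K * (\<Psi> t - K))" by (simp add: f_def y_def algebra_simps)
    then have "f t - g' K * y t \<le> \<bar>G (\<Psi> t) - K - g' K * (\<Psi> t - K)\<bar>" using sn by auto
    also have "\<dots> \<le> (1 - s) * \<bar>g' K\<bar> * y t" using 1 by (simp add: ay)
    finally show ?thesis using \<Gamma> by (simp add: Ah_def algebra_simps)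
  qed
  have fc: "continuous_on UNIV f" unfolding f_def by (intro continuous_intros Gpsi_continuous)
  have fb: "\<bar>f u\<bar> \<le> (C + K) * exp (0 * u)" for u using Gb[of u] K_pos sn by (auto simp: f_def)
  define H where "H x = future_avg b f x" for x
  have Hd: "(H has_real_derivative b * H x - f x) (at x)" for x
    unfolding H_def[abs_def] by (rule future_avg_deriv[OF fc ab(2)]) (use fb in blast)
  have fneg: "f u \<le> 0" if "u \<ge> T" for u
    using fy[OF that] mult_nonneg_nonneg[OF less_imp_le[OF Ah(1)] ynn[OF that]] by linarith
  have Hnp: "H x \<le> 0" if "x \<ge> T" for x unfolding H_def by (rule future_avg_nonpos) (use fneg that in auto)
  have Heq: "sn * profile_deriv t + ?a * y t = ?a * b * H (t - ?d)" for t
  proof -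
    have "future_avg b (\<lambda>u. G (\<Psi> u) - K * exp (0 * u)) (t - ?d) = future_avg b (\<lambda>u. G (\<Psi> u)) (t - ?d) - future_avg b (\<lambda>u. K * exp (0 * u)) (t - ?d)"
      by (rule future_avg_diff[where c = 0 and Z = C and c' = 0 and Z' = K]) (use Gb ab K_pos Gpsi_continuous in \<open>auto intro!: continuous_intros\<close>)
    then have "future_avg b (\<lambda>u. G (\<Psi> u) - K) (t - ?d) = future_avg b (\<lambda>u. G (\<Psi> u)) (t - ?d) - K / b"
      using future_avg_exp[OF ab(2), of K "t - ?d"] by simp
    then have H: "H (t - ?d) = sn * (future_avg b (\<lambda>u. G (\<Psi> u)) (t - ?d) - K / b)"
      unfolding H_def f_def future_avg_mult by simp
    have "?a * b * H (t - ?d) = sn * (?a * b * future_avg b (\<lambda>u. G (\<Psi> u)) (t - ?d) - ?a * K)"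
      unfolding H using ab(2) by (simp add: right_diff_distrib)
    also have "?a * b * future_avg b (\<lambda>u. G (\<Psi> u)) (t - ?d) = profile_deriv t + ?a * \<Psi> t" by (simp add: profile_deriv_def b_def)
    finally show ?thesis by (simp add: y_def algebra_simps)
  qed
  define w where "w t = y t * exp (?a * t)" for t
  define w' where "w' t = ?a * b * H (t - ?d) * exp (?a * t)" for t
  have wd: "(w has_real_derivative w' t) (at t)" for t
  proof -
    have "(w has_real_derivative (sn * profile_deriv t + ?a * y t) * exp (?a * t)) (at t)"
      unfolding w_def y_def by (auto intro!: derivative_eq_intros psi_deriv simp: algebra_simps)
    then show ?thesis unfolding Heq w'_def .
  qed
  have w'np: "w' t \<le> 0" if "t \<ge> T + ?d" for t
    unfolding w'_def using Hnp[of "t - ?d"] that ab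
    by (intro mult_nonpos_nonneg mult_nonneg_nonpos) auto
  have wmono: "w v \<le> w u" if "T + ?d \<le> u" "u \<le> v" for u v
    using DERIV_nonpos_imp_nonincreasing[OF that(2), of w] wd w'np that(1) by (meson order_trans)
  \<comment> \<open>A nonincreasing, nonnegative w that vanishes once vanishes from then on, so
    \<Psi> would equal \<open>K\<close> on a half-line.\<close>
  have wpos: "w t > 0" if t: "t \<ge> T + ?d" for t
  proof (rule ccontr)
    assume "\<not> w t > 0"
    have "\<Psi> u = K" if u: "u \<ge> t" for u
    proof -
      have "w u \<le> 0" using wmono[OF t u] \<open>\<not> w t > 0\<close> by linarith
      then have "y u \<le> 0" by (simp add: w_def mult_le_0_iff)
      moreover have "y u \<ge> 0" using ynn[of u] u t ab h_pos by simp
      ultimately show ?thesis using sn by (auto simp: y_def)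
    qed
    then show False using not_eventually_K[of t] \<Gamma> by auto
  qed
  define AA where "AA = kA \<epsilon> * Ah * exp (?a * ?d) * (1 - kq \<epsilon> / r0)"
  have tau: "?d - r0 > 0" using ab(3) mult_pos_pos[OF s(1) h_pos] unfolding r0_def left_diff_distrib mult_1 by linarith
  have crit': "AA * (?d - r0) * exp 1 > 1" using crit by (simp add: AA_def Ah_def r0_def)
  have AA: "AA > 0"
  proof (rule ccontr)
    assume "\<not> AA > 0"
    then have "AA * (?d - r0) * exp 1 \<le> 0" using tau by (intro mult_nonpos_nonneg) auto
    then show False using crit' by simp
  qed
  have ineq: "w' t \<le> - AA * w (t - (?d - r0))" if t: "t \<ge> T + 2 * ?d" for t
  proof -
    let ?x = "t - ?d"
    define W where "W = w (?x + r0)"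
    have W: "W > 0" unfolding W_def by (rule wpos) (use t Ah in auto)
    \<comment> \<open>The derivative of H exp (- b u) is - f exp (- b u). On the window w \<ge> W
      bounds - f from below, which the added explicit term turns into monotonicity of
      \<open>Nf\<close>; H at the right end is dropped because it is nonpositive.\<close>
    define Nf where "Nf = (\<lambda>u. H u * exp (- b * u) + Ah * W / (?a + b) * exp (- (?a + b) * u))"
    have ab0: "?a + b > 0" using ab by simp
    have "Nf ?x \<le> Nf (?x + r0)"
    proof (rule DERIV_nonneg_imp_nondecreasing[where f = Nf])
      fix u assume u: "?x \<le> u" "u \<le> ?x + r0"
      have "w u \<ge> W" unfolding W_def by (rule wmono) (use u t in auto)
      then have "y u * exp (?a * u) * exp (- ?a * u) \<ge> W * exp (- ?a * u)" unfolding w_def by (intro mult_right_mono) auto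
      then have "y u \<ge> W * exp (- ?a * u)" by (simp add: mult.assoc exp_add[symmetric])
      then have "Ah * y u \<ge> Ah * (W * exp (- ?a * u))" using Ah by (intro mult_left_mono) auto
      then have "- f u - Ah * W * exp (- ?a * u) \<ge> 0" using fy[of u] u t ab h_pos by simp
      then have nn: "(- f u - Ah * W * exp (- ?a * u)) * exp (- b * u) \<ge> 0" by simp
      have "(Nf has_real_derivative ((b * H u - f u) * exp (- b * u) + H u * (- b * exp (- b * u)))
          + Ah * W / (?a + b) * (- (?a + b) * exp (- (?a + b) * u))) (at u)"
        unfolding Nf_def using ab0 by (auto intro!: derivative_eq_intros Hd)
      moreover have "((b * H u - f u) * exp (- b * u) + H u * (- b * exp (- b * u)))
          + Ah * W / (?a + b) * (- (?a + b) * exp (- (?a + b) * u)) = (- f u - Ah * W * exp (- ?a * u)) * exp (- b * u)"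
      proof -
        have "exp (- (?a + b) * u) = exp (- ?a * u) * exp (- b * u)" by (simp add: exp_add[symmetric] algebra_simps)
        moreover have "c / m * (- m * X) = - c * X" if "m > 0" for c m X :: real using that by simp
        from this[OF ab0] have "Ah * W / (?a + b) * (- (?a + b) * X) = - (Ah * W) * X" for X .
        ultimately show ?thesis by (simp only:) (simp add: algebra_simps)
      qed
      ultimately show "\<exists>D. (Nf has_real_derivative D) (at u) \<and> D \<ge> 0" using nn by auto
    qed (use Ah in auto)
    also have "Nf (?x + r0) \<le> Ah * W / (?a + b) * exp (- (?a + b) * (?x + r0))"
      unfolding Nf_def using Hnp[of "?x + r0"] t Ah ab h_pos by (simp add: mult_nonpos_nonneg)
    finally have "H ?x * exp (- b * ?x) \<le> - (Ah * W / (?a + b)) * (exp (- (?a + b) * ?x) - exp (- (?a + b) * (?x + r0)))"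
      unfolding Nf_def by (simp add: right_diff_distrib)
    then have "H ?x * exp (- b * ?x) * exp (b * ?x) \<le> - (Ah * W / (?a + b)) * (exp (- (?a + b) * ?x) - exp (- (?a + b) * (?x + r0))) * exp (b * ?x)"
      by (rule mult_right_mono) simp
    also have "\<dots> = - (Ah * W / (?a + b)) * exp (- ?a * ?x) * (1 - exp (- (?a + b) * r0))"
    proof -
      have "exp (- (?a + b) * ?x) * exp (b * ?x) = exp (- ?a * ?x)" by (simp add: exp_add[symmetric] algebra_simps)
      moreover have "exp (- (?a + b) * (?x + r0)) * exp (b * ?x) = exp (- ?a * ?x) * exp (- (?a + b) * r0)" by (simp add: exp_add[symmetric] algebra_simps)
      ultimately show ?thesis by (simp only: mult.assoc left_diff_distrib right_diff_distrib mult_1_right)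
    qed
    finally have Hx: "H ?x \<le> - (Ah * W / (?a + b)) * exp (- ?a * ?x) * (1 - exp (- (?a + b) * r0))"
      by (simp add: mult.assoc exp_add[symmetric])
    have "w' t = ?a * b * exp (?a * t) * H ?x" by (simp add: w'_def)
    also have "\<dots> \<le> ?a * b * exp (?a * t) * (- (Ah * W / (?a + b)) * exp (- ?a * ?x) * (1 - exp (- (?a + b) * r0)))"
      using Hx ab by (intro mult_left_mono) auto
    also have "\<dots> = - (?a * b / (?a + b) * Ah * W * (exp (?a * t) * exp (- ?a * ?x)) * (1 - exp (- (?a + b) * r0)))" by simp
    also have "exp (?a * t) * exp (- ?a * ?x) = exp (?a * ?d)" by (simp add: exp_add[symmetric] algebra_simps)
    also have "?a * b / (?a + b) = kA \<epsilon>" 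
    proof -
      have "kA \<epsilon> * (?a + b) = ?a * b" using A_eq by (simp add: b_def)
      then show ?thesis using ab0 by (simp add: divide_eq_eq)
    qed
    also have "- (kA \<epsilon> * Ah * W * exp (?a * ?d) * (1 - exp (- (?a + b) * r0))) \<le> - (kA \<epsilon> * Ah * W * exp (?a * ?d) * (1 - kq \<epsilon> / r0))"
    proof -
      have "exp (- (?a + b) * r0) \<le> exp (- (b * r0))" using ab Ah by (simp add: algebra_simps)
      \<comment> \<open>The bound exp (- x) \<le> 1 / x is enough, since b = 1 / kq makes the loss
        vanish as \<epsilon> tends to 0.\<close>
      also have "\<dots> \<le> 1 / (b * r0)"
      proof -
        have "b * r0 \<le> exp (b * r0)" using exp_ge_add_one_self[of "b * r0"] by linarith
        moreover have "b * r0 > 0" using ab Ah by simp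
        ultimately show ?thesis by (simp only: exp_minus inverse_eq_divide) (intro frac_le, auto)
      qed
      also have "\<dots> = kq \<epsilon> / r0" by (simp add: qb)
      finally have "kA \<epsilon> * Ah * W * exp (?a * ?d) * (1 - kq \<epsilon> / r0) \<le> kA \<epsilon> * Ah * W * exp (?a * ?d) * (1 - exp (- (?a + b) * r0))"
        using A_pos Ah W by (intro mult_left_mono) auto
      then show ?thesis by simp
    qed
    also have "\<dots> = - AA * w (t - (?d - r0))" by (simp add: AA_def W_def algebra_simps)
    finally show ?thesis .
  qed
  show False
  proof (rule no_positive_delay_decay[OF tau AA crit', of "T + 2 * ?d" w w'])
    show "w t > 0" if "T + 2 * ?d - (?d - r0) \<le> t" for t by (rule wpos) (use that Ah in auto)
  qed (use wd ineq in auto)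
qed

end

end

section \<open>Travelling waves\<close>

lemma plane_wave_solution:
  fixes \<phi> \<phi>1 \<phi>2 :: "real \<Rightarrow> real" and \<nu> :: "'a::euclidean_space"
  assumes d1: "\<And>s. (\<phi> has_real_derivative \<phi>1 s) (at s)" and d2: "\<And>s. (\<phi>1 has_real_derivative \<phi>2 s) (at s)"
    and ode: "\<And>s. \<phi>1 s = \<phi>2 s / c\<^sup>2 - \<phi> s + g (\<phi> (s - h))" and nu: "norm \<nu> = 1"
  shows "pde_solution g h (\<lambda>t x. \<phi> (t + (\<nu> \<bullet> x) / c))"
  unfolding pde_solution_def
proof (intro allI)
  fix t and x :: 'a
  define s where "s = t + (\<nu> \<bullet> x) / c"
  define D where "D b = \<phi>2 s * ((\<nu> \<bullet> b) / c)\<^sup>2" for b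
  have "((\<lambda>\<tau>. \<phi> (\<tau> + (\<nu> \<bullet> x) / c)) has_real_derivative \<phi>1 s) (at t)"
    using d1[of s] unfolding s_def DERIV_shift .
  moreover have "dir_second_deriv (\<lambda>x. \<phi> (t + (\<nu> \<bullet> x) / c)) x b (D b)" for b
  proof -
    define k where "k = (\<nu> \<bullet> b) / c"
    have arg: "t + (\<nu> \<bullet> (x + r *\<^sub>R b)) / c = s + r * k" for r
      by (simp add: s_def k_def inner_add_right add_divide_distrib)
    have lin: "((\<lambda>r. s + r * k) has_real_derivative k) (at r)" for r
      by (auto intro!: derivative_eq_intros)
    have "((\<lambda>r. \<phi> (s + r * k)) has_real_derivative \<phi>1 (s + r * k) * k) (at r)" for r
      by (rule DERIV_chain2[OF d1 lin])
    moreover have "((\<lambda>r. \<phi>1 (s + r * k) * k) has_real_derivative \<phi>2 (s + 0 * k) * k * k) (at 0)"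
      by (rule DERIV_cmult_right, rule DERIV_chain2[OF d2 lin])
    moreover have "\<phi>2 (s + 0 * k) * k * k = D b" by (simp add: D_def k_def power2_eq_square)
    ultimately show ?thesis unfolding dir_second_deriv_def arg
      by (intro exI[of _ "\<lambda>r. \<phi>1 (s + r * k) * k"]) simp
  qed
  moreover have "\<phi>1 s = (\<Sum>b\<in>Basis. D b) - \<phi> (t + (\<nu> \<bullet> x) / c) + g (\<phi> (t - h + (\<nu> \<bullet> x) / c))"
  proof -
    \<comment> \<open>The Laplacian of a plane wave is the second derivative of its profile times
      the sum of the squared coordinates of \<nu> / c.\<close>
    have "(\<Sum>b\<in>Basis. (\<nu> \<bullet> b)\<^sup>2) = 1"
      using euclidean_inner[of \<nu> \<nu>] nu by (simp add: power2_eq_square norm_eq_1)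
    then have "(\<Sum>b\<in>Basis. D b) = \<phi>2 s / c\<^sup>2"
      by (simp add: D_def power_divide sum_distrib_left[symmetric] sum_divide_distrib[symmetric])
    moreover have "t - h + (\<nu> \<bullet> x) / c = s - h" "t + (\<nu> \<bullet> x) / c = s" by (simp_all add: s_def)
    ultimately show ?thesis using ode[of s] by (simp only:)
  qed
  ultimately show "\<exists>ut D. ((\<lambda>\<tau>. \<phi> (\<tau> + (\<nu> \<bullet> x) / c)) has_real_derivative ut) (at t) \<and>
      (\<forall>b\<in>Basis. dir_second_deriv (\<lambda>x. \<phi> (t + (\<nu> \<bullet> x) / c)) x b (D b)) \<and>
      ut = (\<Sum>b\<in>Basis. D b) - \<phi> (t + (\<nu> \<bullet> x) / c) + g (\<phi> (t - h + (\<nu> \<bullet> x) / c))"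
    by blast
qed

text \<open>The factor s enters the criterion twice, through the slope at \<open>K\<close> and
  through the shortened delay s h; strictness leaves room for both. The choice s^2 = (1 + 1 / X) / 2
  lies between 1 / X and 1.\<close>

lemma square_le_criterion:
  fixes X :: real assumes "X > 1"
  obtains s where "0 < s" "s < 1" "s * s * X > 1"
proof -
  define r where "r = 1 / X"
  define s where "s = sqrt ((1 + r) / 2)"
  have r: "0 < r" "r < 1" using assms by (simp_all add: r_def)
  have ss: "s * s = (1 + r) / 2" using r by (simp add: s_def)
  have "s > 0" "s < 1" using r by (simp_all add: s_def)
  moreover have "s * s * X > 1" unfolding ss r_def using assms by (simp add: field_simps)
  ultimately show ?thesis using that by blast
qed

context wave
begin

text \<open>At \<epsilon> = 0 the left-hand side of the delay criterion is s^2 |g'(K)| h e^(h+1); it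
  stays above 1 for small \<epsilon> by continuity of the kernel parameters.\<close>

lemma oscillation_parameters:
  assumes "g' K * h * exp (h + 1) < -1"
  shows "\<exists>s. 0 < s \<and> s < 1 \<and> (\<exists>\<epsilon>3>0. \<forall>\<epsilon>. 0 \<le> \<epsilon> \<and> \<epsilon> < \<epsilon>3 \<and> \<epsilon> \<le> eps1 \<longrightarrow>
    kA \<epsilon> * (s * \<bar>g' K\<bar>) * exp (ka \<epsilon> * kd \<epsilon>) * (1 - kq \<epsilon> / ((1 - s) * h)) * (kd \<epsilon> - (1 - s) * h) * exp 1 > 1)"
proof -
  have neg: "g' K < 0"
  proof (rule ccontr)
    assume "\<not> g' K < 0"
    then have "0 \<le> g' K * h * exp (h + 1)" using h_pos by simp
    then show False using assms by simp
  qed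
  define X where "X = \<bar>g' K\<bar> * h * exp (h + 1)"
  have X: "X > 1" using assms neg by (simp add: X_def)
  obtain s where s: "0 < s" "s < 1" "s * s * X > 1" by (rule square_le_criterion[OF X])
  define \<phi> where "\<phi> \<epsilon> = kA \<epsilon> * (s * \<bar>g' K\<bar>) * exp (ka \<epsilon> * kd \<epsilon>) * (1 - kq \<epsilon> / ((1 - s) * h)) * (kd \<epsilon> - (1 - s) * h) * exp 1" for \<epsilon>
  have r0: "(1 - s) * h \<noteq> 0" using s h_pos by simp
  have phi0: "\<phi> 0 = s * s * X"
  proof -
    have "\<phi> 0 = (s * \<bar>g' K\<bar>) * (h - (1 - s) * h) * (exp h * exp 1)" by (simp add: \<phi>_def at0)
    also have "exp h * exp 1 = exp (h + 1)" by (simp add: exp_add)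
    also have "h - (1 - s) * h = s * h" by (simp add: algebra_simps)
    finally show ?thesis by (simp add: X_def mult_ac)
  qed
  have e0: "(0::real) \<le> 0" "0 \<le> eps1" using eps1(1) by auto
  have "(\<phi> \<longlongrightarrow> \<phi> 0) (at 0 within {0..eps1})"
    unfolding tendsto_at_iff_sequentially comp_def
  proof (intro allI impI)
    fix Y assume Y: "\<forall>i. Y i \<in> {0..eps1} - {0}" "Y \<longlonglongrightarrow> 0"
    have Y1: "0 \<le> Y i" "Y i \<le> eps1" for i using Y(1) by auto
    note T = param_tendsto[OF decay_rate(1,2) Y1 e0 Y(2)]
    show "(\<lambda>i. \<phi> (Y i)) \<longlonglongrightarrow> \<phi> 0" unfolding \<phi>_def using r0 by (intro tendsto_intros T)
  qed
  then have "\<forall>\<^sub>F \<epsilon> in at 0 within {0..eps1}. \<phi> \<epsilon> > 1"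
    using order_tendstoD(1) s(3) phi0 by metis
  then obtain d where d: "d > 0" "\<forall>\<epsilon>\<in>{0..eps1}. \<epsilon> \<noteq> 0 \<and> dist \<epsilon> 0 < d \<longrightarrow> \<phi> \<epsilon> > 1"
    unfolding eventually_at by blast
  have "\<phi> \<epsilon> > 1" if "0 \<le> \<epsilon>" "\<epsilon> < d" "\<epsilon> \<le> eps1" for \<epsilon>
    using d(2)[rule_format, of \<epsilon>] that s(3) phi0 by (cases "\<epsilon> = 0") (auto simp: dist_real_def)
  then show ?thesis using s d(1) unfolding \<phi>_def by blast
qed

lemma time_scale_lipschitz:
  assumes "0 \<le> \<epsilon>" "\<epsilon> \<le> eps1" "0 \<le> \<epsilon>'" "\<epsilon>' \<le> eps1"
  shows "\<bar>time_scale \<epsilon> - time_scale \<epsilon>'\<bar> \<le> 8 * lm * \<bar>\<epsilon> - \<epsilon>'\<bar>"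
proof -
  have l: "lm > 0" by (rule lam_props)
  have "\<bar>time_scale \<epsilon> - time_scale \<epsilon>'\<bar> = \<bar>lead_root \<epsilon> - lead_root \<epsilon>'\<bar> / lm"
    using l by (simp add: time_scale_def diff_divide_distrib[symmetric])
  also have "\<dots> \<le> (8 * lm\<^sup>2 * \<bar>\<epsilon> - \<epsilon>'\<bar>) / lm" using lead_root_lipschitz[OF assms] l by (intro divide_right_mono) auto
  also have "\<dots> = 8 * lm * \<bar>\<epsilon> - \<epsilon>'\<bar>" using l by (simp add: power2_eq_square)
  finally show ?thesis .
qed

lemma travelling_waves:
  "\<exists>cstar > 0. \<exists>\<Phi> :: real \<Rightarrow> real \<Rightarrow> real.
     (\<forall>c > cstar.
        (\<forall>s. \<Phi> c s > 0) \<and>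
        (\<Phi> c \<longlongrightarrow> 0) at_bot \<and> (\<Phi> c \<longlongrightarrow> K) at_top \<and>
        (\<forall>\<nu>::'a::euclidean_space. norm \<nu> = 1 \<longrightarrow>
            pde_solution g h (\<lambda>t x. \<Phi> c (t + (\<nu> \<bullet> x) / c))) \<and>
        (\<forall>s. \<Phi> c differentiable (at s)) \<and>
        (\<exists>s0. \<exists>M s1. \<forall>s \<le> s1.
            \<bar>\<Phi> c (s - s0) - exp (lam1 (g' 0) h c * s)\<bar> \<le> M * exp (2 * lam (g' 0) h * s) \<and>
            \<bar>deriv (\<Phi> c) (s - s0) - lam1 (g' 0) h c * exp (lam1 (g' 0) h c * s)\<bar>
               \<le> M * exp (2 * lam (g' 0) h * s)) \<and>
        (\<exists>z. \<forall>s \<le> z. deriv (\<Phi> c) s > 0)) \<and>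
     (\<forall>c > cstar. \<forall>\<epsilon> > 0. \<exists>\<delta> > 0. \<forall>c'. c' > cstar \<and> \<bar>c' - c\<bar> < \<delta> \<longrightarrow>
        (\<forall>s. \<bar>\<Phi> c' s - \<Phi> c s\<bar> \<le> \<epsilon>)) \<and>
     (g' K * h * exp (h + 1) < -1 \<longrightarrow>
        (\<forall>c > cstar. \<forall>z. (\<exists>s \<ge> z. \<Phi> c s > K) \<and> (\<exists>s \<ge> z. \<Phi> c s < K)))"
proof -
  have l: "lm > 0" by (rule lam_props)
  obtain \<epsilon>2 \<Psi> C where e2: "\<epsilon>2 > 0" "\<epsilon>2 \<le> eps1" and C: "C > 0"
    and prof: "\<forall>\<epsilon>. 0 \<le> \<epsilon> \<and> \<epsilon> \<le> \<epsilon>2 \<longrightarrow> continuous_on UNIV (\<Psi> \<epsilon>) \<and>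
        (\<forall>t. \<Psi> \<epsilon> t > 0) \<and> (\<forall>t. \<Psi> \<epsilon> t \<le> C) \<and>
        (\<forall>t. \<bar>\<Psi> \<epsilon> t - exp (lm * t)\<bar> \<le> C * exp (2 * lm * t)) \<and>
        (\<forall>t. \<bar>\<Psi> \<epsilon> t - K\<bar> \<le> C * exp (- decay_rate * t)) \<and>
        (\<forall>t. \<bar>G (\<Psi> \<epsilon> t) - p * exp (lm * t)\<bar> \<le> C * exp (2 * lm * t)) \<and>
        (\<forall>t. \<bar>G (\<Psi> \<epsilon> t)\<bar> \<le> C) \<and>
        (\<forall>t. \<Psi> \<epsilon> t = conv (wave_kernel \<epsilon>) (\<lambda>u. G (\<Psi> \<epsilon> u)) t)"
    and pcont: "\<forall>\<epsilon> \<epsilon>'. 0 \<le> \<epsilon> \<and> \<epsilon> \<le> \<epsilon>2 \<and> 0 \<le> \<epsilon>' \<and> \<epsilon>' \<le> \<epsilon>2 \<longrightarrow>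
        (\<forall>t. \<bar>\<Psi> \<epsilon> t - \<Psi> \<epsilon>' t\<bar> \<le> C * kdist \<epsilon> \<epsilon>')"
    by (rule exE[OF profiles], elim conjE exE, rule that, assumption+)
  have prof_facts: "continuous_on UNIV (\<Psi> \<epsilon>)"
    "\<Psi> \<epsilon> t > 0"
    "\<Psi> \<epsilon> t \<le> C"
    "\<bar>\<Psi> \<epsilon> t - exp (lm * t)\<bar> \<le> C * exp (2 * lm * t)"
    "\<bar>\<Psi> \<epsilon> t - K\<bar> \<le> C * exp (- decay_rate * t)"
    "\<bar>G (\<Psi> \<epsilon> t) - p * exp (lm * t)\<bar> \<le> C * exp (2 * lm * t)"
    "\<bar>G (\<Psi> \<epsilon> t)\<bar> \<le> C"
    "\<Psi> \<epsilon> t = conv (wave_kernel \<epsilon>) (\<lambda>u. G (\<Psi> \<epsilon> u)) t"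
    if "0 \<le> \<epsilon>" "\<epsilon> \<le> \<epsilon>2" for \<epsilon> t
  proof -
    note q1 = prof[rule_format, OF conjI[OF that]]
    note q2 = conjunct2[OF q1]
    note q3 = conjunct2[OF q2]
    note q4 = conjunct2[OF q3]
    note q5 = conjunct2[OF q4]
    note q6 = conjunct2[OF q5]
    note q7 = conjunct2[OF q6]
    show "continuous_on UNIV (\<Psi> \<epsilon>)" by (rule conjunct1[OF q1])
    show "\<Psi> \<epsilon> t > 0" by (rule conjunct1[OF q2, rule_format])
    show "\<Psi> \<epsilon> t \<le> C" by (rule conjunct1[OF q3, rule_format])
    show "\<bar>\<Psi> \<epsilon> t - exp (lm * t)\<bar> \<le> C * exp (2 * lm * t)" by (rule conjunct1[OF q4, rule_format])
    show "\<bar>\<Psi> \<epsilon> t - K\<bar> \<le> C * exp (- decay_rate * t)" by (rule conjunct1[OF q5, rule_format])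
    show "\<bar>G (\<Psi> \<epsilon> t) - p * exp (lm * t)\<bar> \<le> C * exp (2 * lm * t)" by (rule conjunct1[OF q6, rule_format])
    show "\<bar>G (\<Psi> \<epsilon> t)\<bar> \<le> C" by (rule conjunct1[OF q7, rule_format])
    show "\<Psi> \<epsilon> t = conv (wave_kernel \<epsilon>) (\<lambda>u. G (\<Psi> \<epsilon> u)) t" by (rule conjunct2[OF q7, rule_format])
  qed
  \<comment> \<open>The threshold must be fixed before \<open>cstar\<close>, hence the implication
    inside: without the oscillation hypothesis any positive threshold will do.\<close>
  have "\<exists>s \<epsilon>o. \<epsilon>o > 0 \<and> (g' K * h * exp (h + 1) < -1 \<longrightarrow> 0 < s \<and> s < 1 \<and> (\<forall>\<epsilon>. 0 \<le> \<epsilon> \<and> \<epsilon> < \<epsilon>o \<and> \<epsilon> \<le> eps1 \<longrightarrow>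
    kA \<epsilon> * (s * \<bar>g' K\<bar>) * exp (ka \<epsilon> * kd \<epsilon>) * (1 - kq \<epsilon> / ((1 - s) * h)) * (kd \<epsilon> - (1 - s) * h) * exp 1 > 1))"
  proof (cases "g' K * h * exp (h + 1) < -1")
    case True
    from oscillation_parameters[OF True] show ?thesis by (elim exE conjE, intro exI conjI impI)
  next
    case False
    then show ?thesis by (intro exI[of _ "1::real"]) simp
  qed
  then obtain s \<epsilon>o where so: "\<epsilon>o > 0" "g' K * h * exp (h + 1) < -1 \<longrightarrow> 0 < s \<and> s < 1 \<and> (\<forall>\<epsilon>. 0 \<le> \<epsilon> \<and> \<epsilon> < \<epsilon>o \<and> \<epsilon> \<le> eps1 \<longrightarrow>
    kA \<epsilon> * (s * \<bar>g' K\<bar>) * exp (ka \<epsilon> * kd \<epsilon>) * (1 - kq \<epsilon> / ((1 - s) * h)) * (kd \<epsilon> - (1 - s) * h) * exp 1 > 1)"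
    by blast
  define \<epsilon>3 where "\<epsilon>3 = min \<epsilon>2 \<epsilon>o"
  have e3: "\<epsilon>3 > 0" using e2 so by (simp add: \<epsilon>3_def)
  define cstar where "cstar = 1 / sqrt \<epsilon>3"
  have cs: "cstar > 0" using e3 by (simp add: cstar_def)
  have ceps: "c > 0" "0 < 1 / c\<^sup>2" "1 / c\<^sup>2 < \<epsilon>3" if "c > cstar" for c
  proof -
    show c0: "c > 0" using that cs by linarith
    then show "0 < 1 / c\<^sup>2" by simp
    have "cstar\<^sup>2 < c\<^sup>2" using that cs by (intro power_strict_mono) auto
    moreover have "cstar\<^sup>2 = 1 / \<epsilon>3" using e3 by (simp add: cstar_def power_divide)
    ultimately have "1 < c\<^sup>2 * \<epsilon>3" using e3 by (simp add: divide_less_eq)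
    then show "1 / c\<^sup>2 < \<epsilon>3" using c0 by (simp add: divide_less_eq mult.commute)
  qed
  \<comment> \<open>Undoes the rescaling of time, so that the leading exponent \<lambda> of \<Psi>
    becomes \<open>lam1\<close>.\<close>
  define \<Phi> where "\<Phi> c s = \<Psi> (1 / c\<^sup>2) (time_scale (1 / c\<^sup>2) * s)" for c s
  have wave_c: "(\<forall>s. \<Phi> c s > 0) \<and>
        (\<Phi> c \<longlongrightarrow> 0) at_bot \<and> (\<Phi> c \<longlongrightarrow> K) at_top \<and>
        (\<forall>\<nu>::'a::euclidean_space. norm \<nu> = 1 \<longrightarrow>
            pde_solution g h (\<lambda>t x. \<Phi> c (t + (\<nu> \<bullet> x) / c))) \<and>
        (\<forall>s. \<Phi> c differentiable (at s)) \<and>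
        (\<exists>s0. \<exists>M s1. \<forall>s \<le> s1.
            \<bar>\<Phi> c (s - s0) - exp (lam1 (g' 0) h c * s)\<bar> \<le> M * exp (2 * lam (g' 0) h * s) \<and>
            \<bar>deriv (\<Phi> c) (s - s0) - lam1 (g' 0) h c * exp (lam1 (g' 0) h c * s)\<bar>
               \<le> M * exp (2 * lam (g' 0) h * s)) \<and>
        (\<exists>z. \<forall>s \<le> z. deriv (\<Phi> c) s > 0)"
    and osc_c: "g' K * h * exp (h + 1) < -1 \<Longrightarrow> (\<exists>s \<ge> z. \<Phi> c s > K) \<and> (\<exists>s \<ge> z. \<Phi> c s < K)"
    and lip_c: "\<exists>L>0. \<forall>t s. \<bar>\<Psi> (1 / c\<^sup>2) t - \<Psi> (1 / c\<^sup>2) s\<bar> \<le> L * \<bar>t - s\<bar>"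
    if c: "c > cstar" for c z
  proof -
    define \<epsilon> where "\<epsilon> = 1 / c\<^sup>2"
    have e: "0 < \<epsilon>" "\<epsilon> \<le> eps1" "\<epsilon> \<le> \<epsilon>2" "\<epsilon> < \<epsilon>o" using ceps[OF c] e2 by (auto simp: \<epsilon>_def \<epsilon>3_def)
    have hy: "continuous_on UNIV (\<Psi> \<epsilon>)" "\<And>t. 0 < \<Psi> \<epsilon> t" "\<And>t. \<bar>\<Psi> \<epsilon> t - exp (lm * t)\<bar> \<le> C * exp (2 * lm * t)"
      "\<And>t. \<bar>\<Psi> \<epsilon> t - K\<bar> \<le> C * exp (- decay_rate * t)" "\<And>t. \<Psi> \<epsilon> t \<le> C"
      "\<And>t. \<bar>G (\<Psi> \<epsilon> t) - p * exp (lm * t)\<bar> \<le> C * exp (2 * lm * t)" "\<And>t. \<bar>G (\<Psi> \<epsilon> t)\<bar> \<le> C"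
      "\<And>t. \<Psi> \<epsilon> t = conv (wave_kernel \<epsilon>) (\<lambda>u. G (\<Psi> \<epsilon> u)) t"
      by (rule prof_facts[OF less_imp_le[OF e(1)] e(3)])+
    note H = e(1,2) hy
    let ?\<sigma> = "time_scale \<epsilon>" and ?profile_deriv = "profile_deriv \<epsilon> (\<Psi> \<epsilon>)"
    have sig: "?\<sigma> \<ge> 1" using time_scale_bounds(1)[of \<epsilon>] e by simp
    have Phi: "\<Phi> c = (\<lambda>s. \<Psi> \<epsilon> (?\<sigma> * s))" by (intro ext) (simp add: \<Phi>_def \<epsilon>_def)
    have lin: "((\<lambda>s. ?\<sigma> * s) has_real_derivative ?\<sigma>) (at s)" for s by (auto intro!: derivative_eq_intros)
    have d1: "(\<Phi> c has_real_derivative ?profile_deriv (?\<sigma> * s) * ?\<sigma>) (at s)" for s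
      unfolding Phi by (rule DERIV_chain2[OF psi_deriv[OF H] lin])
    have der: "deriv (\<Phi> c) s = ?profile_deriv (?\<sigma> * s) * ?\<sigma>" for s by (rule DERIV_imp_deriv[OF d1])
    define p2 where "p2 t = (?\<sigma> * ?profile_deriv t + \<Psi> \<epsilon> t - G (\<Psi> \<epsilon> (t - kd \<epsilon>))) / (\<epsilon> * ?\<sigma>\<^sup>2)" for t
    have d2: "((\<lambda>s. ?profile_deriv (?\<sigma> * s) * ?\<sigma>) has_real_derivative (p2 (?\<sigma> * s) * ?\<sigma>) * ?\<sigma>) (at s)" for s
      unfolding p2_def by (rule DERIV_cmult_right, rule DERIV_chain2[OF psi_deriv2[OF H] lin])
    have ode: "?profile_deriv (?\<sigma> * s) * ?\<sigma> = ((p2 (?\<sigma> * s) * ?\<sigma>) * ?\<sigma>) / c\<^sup>2 - \<Phi> c s + g (\<Phi> c (s - h))" for s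
    proof -
      have "\<epsilon> * ((p2 (?\<sigma> * s) * ?\<sigma>) * ?\<sigma>) = ?\<sigma> * ?profile_deriv (?\<sigma> * s) + \<Psi> \<epsilon> (?\<sigma> * s) - G (\<Psi> \<epsilon> (?\<sigma> * s - kd \<epsilon>))"
        using e(1) sig by (simp add: p2_def power2_eq_square)
      moreover have "G (\<Psi> \<epsilon> (?\<sigma> * s - kd \<epsilon>)) = g (\<Phi> c (s - h))"
        using hy(2)[of "?\<sigma> * s - kd \<epsilon>"] by (simp add: Phi G_def kd_def right_diff_distrib)
      moreover have "((p2 (?\<sigma> * s) * ?\<sigma>) * ?\<sigma>) / c\<^sup>2 = \<epsilon> * ((p2 (?\<sigma> * s) * ?\<sigma>) * ?\<sigma>)" by (simp add: \<epsilon>_def)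
      ultimately show ?thesis by (simp add: Phi mult.commute)
    qed
    have lam1: "lam1 p h c = lm * ?\<sigma>"
      using lam1_root[OF ceps(1)[OF c]] e(2) l by (simp add: \<epsilon>_def time_scale_def)
    obtain C' where C': "C' > 0" "\<forall>t. \<bar>?profile_deriv t - lm * exp (lm * t)\<bar> \<le> C' * exp (2 * lm * t)"
      using profile_deriv_asym[OF H] by blast
    \<comment> \<open>For negative times the error, which has exponent 2 \<open>lam1\<close>, is
      below exp (2 \<lambda> s) because \<open>time_scale\<close> \<ge> 1.\<close>
    have fast: "exp (2 * lm * (?\<sigma> * s)) \<le> exp (2 * lm * s)" if "s \<le> 0" for s
    proof -
      have "?\<sigma> * s \<le> 1 * s" using sig that by (intro mult_right_mono_neg) auto
      then show ?thesis using l by simp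
    qed
    have lims: "(\<Phi> c \<longlongrightarrow> 0) at_bot" "(\<Phi> c \<longlongrightarrow> K) at_top"
    proof -
      have s0: "?\<sigma> > 0" using sig by linarith
      have "((\<lambda>s. exp (lm * (\<sigma> * s)) + C * exp (2 * lm * (\<sigma> * s))) \<longlongrightarrow> 0) at_bot" if "\<sigma> > 0" for \<sigma> :: real
        using that l by real_asymp
      from this[OF s0] have b: "((\<lambda>s. exp (lm * (?\<sigma> * s)) + C * exp (2 * lm * (?\<sigma> * s))) \<longlongrightarrow> 0) at_bot" .
      show "(\<Phi> c \<longlongrightarrow> 0) at_bot"
      proof (rule Lim_null_comparison[OF _ b], intro always_eventually allI)
        fix s show "norm (\<Phi> c s) \<le> exp (lm * (?\<sigma> * s)) + C * exp (2 * lm * (?\<sigma> * s))"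
          using hy(3)[of "?\<sigma> * s"] hy(2)[of "?\<sigma> * s"] unfolding Phi real_norm_def by linarith
      qed
      have "((\<lambda>s. C * exp (- \<gamma> * (\<sigma> * s))) \<longlongrightarrow> 0) at_top" if "\<sigma> > 0" "\<gamma> > 0" for \<sigma> \<gamma> :: real
      proof -
        have "((\<lambda>s. exp (- \<gamma> * (\<sigma> * s))) \<longlongrightarrow> 0) at_top" using that by real_asymp
        then show ?thesis by (rule tendsto_mult_right_zero)
      qed
      from this[OF s0 decay_rate(1)] have t: "((\<lambda>s. C * exp (- decay_rate * (?\<sigma> * s))) \<longlongrightarrow> 0) at_top" .
      have "((\<lambda>s. \<Phi> c s - K) \<longlongrightarrow> 0) at_top"
        by (rule Lim_null_comparison[OF _ t], intro always_eventually allI) (use hy(4) in \<open>simp add: Phi\<close>)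
      then show "(\<Phi> c \<longlongrightarrow> K) at_top" by (simp add: LIM_zero_iff)
    qed
    have pde: "pde_solution g h (\<lambda>t x. \<Phi> c (t + (\<nu> \<bullet> x) / c))" if "norm \<nu> = 1" for \<nu> :: 'a
      by (rule plane_wave_solution[OF d1 d2 ode that])
    have asy: "\<bar>\<Phi> c (s - 0) - exp (lam1 p h c * s)\<bar> \<le> (C + C' * ?\<sigma>) * exp (2 * lm * s) \<and>
            \<bar>deriv (\<Phi> c) (s - 0) - lam1 p h c * exp (lam1 p h c * s)\<bar> \<le> (C + C' * ?\<sigma>) * exp (2 * lm * s)"
      if s: "s \<le> 0" for s
    proof
      have "\<bar>\<Phi> c (s - 0) - exp (lam1 p h c * s)\<bar> \<le> C * exp (2 * lm * (?\<sigma> * s))"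
        using hy(3)[of "?\<sigma> * s"] by (simp add: Phi lam1 mult.assoc)
      also have "\<dots> \<le> (C + C' * ?\<sigma>) * exp (2 * lm * s)"
        using fast[OF s] C C'(1) sig by (intro mult_mono) auto
      finally show "\<bar>\<Phi> c (s - 0) - exp (lam1 p h c * s)\<bar> \<le> (C + C' * ?\<sigma>) * exp (2 * lm * s)" .
      have "deriv (\<Phi> c) (s - 0) - lam1 p h c * exp (lam1 p h c * s) = (?profile_deriv (?\<sigma> * s) - lm * exp (lm * (?\<sigma> * s))) * ?\<sigma>"
        by (simp add: der lam1 algebra_simps)
      then have "\<bar>deriv (\<Phi> c) (s - 0) - lam1 p h c * exp (lam1 p h c * s)\<bar> = \<bar>?profile_deriv (?\<sigma> * s) - lm * exp (lm * (?\<sigma> * s))\<bar> * ?\<sigma>"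
        using sig by (simp add: abs_mult)
      also have "\<dots> \<le> C' * exp (2 * lm * (?\<sigma> * s)) * ?\<sigma>" using C'(2) sig by (intro mult_right_mono) auto
      also have "\<dots> = (C' * ?\<sigma>) * exp (2 * lm * (?\<sigma> * s))" by simp
      also have "\<dots> \<le> (C + C' * ?\<sigma>) * exp (2 * lm * s)"
        using fast[OF s] C C'(1) sig by (intro mult_mono) auto
      finally show "\<bar>deriv (\<Phi> c) (s - 0) - lam1 p h c * exp (lam1 p h c * s)\<bar> \<le> (C + C' * ?\<sigma>) * exp (2 * lm * s)" .
    qed
    have dpos: "\<exists>z. \<forall>s \<le> z. deriv (\<Phi> c) s > 0"
    proof -
      have "((\<lambda>t. C' * exp (lm * t)) \<longlongrightarrow> 0) at_bot" using l by real_asymp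
      then have "\<forall>\<^sub>F t in at_bot. C' * exp (lm * t) < lm" using l by (rule order_tendstoD)
      then obtain T where T: "\<forall>t\<le>T. C' * exp (lm * t) < lm" unfolding eventually_at_bot_linorder by blast
      have "deriv (\<Phi> c) s > 0" if s: "s \<le> T / ?\<sigma>" for s
      proof -
        have "?\<sigma> * s \<le> T" using s sig by (simp add: le_divide_eq mult.commute)
        then have "C' * exp (lm * (?\<sigma> * s)) * exp (lm * (?\<sigma> * s)) < lm * exp (lm * (?\<sigma> * s))" using T by simp
        moreover have "exp (2 * lm * (?\<sigma> * s)) = exp (lm * (?\<sigma> * s)) * exp (lm * (?\<sigma> * s))" by (simp add: exp_add[symmetric])
        ultimately have "C' * exp (2 * lm * (?\<sigma> * s)) < lm * exp (lm * (?\<sigma> * s))" by (simp only: mult.assoc)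
        then have "?profile_deriv (?\<sigma> * s) > 0" using C'(2)[rule_format, of "?\<sigma> * s"] by linarith
        then show ?thesis unfolding der using sig by (intro mult_pos_pos) auto
      qed
      then show ?thesis by blast
    qed
    have diff: "\<Phi> c differentiable (at s)" for s
      using d1 real_differentiable_def by blast
    \<comment> \<open>The shift can be 0: the profiles are normalised by the coefficient 1 of their
      leading exponential.\<close>
    have asyE: "\<exists>s0. \<exists>M s1. \<forall>s \<le> s1.
            \<bar>\<Phi> c (s - s0) - exp (lam1 (g' 0) h c * s)\<bar> \<le> M * exp (2 * lam (g' 0) h * s) \<and>
            \<bar>deriv (\<Phi> c) (s - s0) - lam1 (g' 0) h c * exp (lam1 (g' 0) h c * s)\<bar>
               \<le> M * exp (2 * lam (g' 0) h * s)"
      by (rule exI[of _ 0], rule exI[of _ "C + C' * ?\<sigma>"], rule exI[of _ 0], intro allI impI, rule asy)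
    show "(\<forall>s. \<Phi> c s > 0) \<and>
        (\<Phi> c \<longlongrightarrow> 0) at_bot \<and> (\<Phi> c \<longlongrightarrow> K) at_top \<and>
        (\<forall>\<nu>::'a::euclidean_space. norm \<nu> = 1 \<longrightarrow>
            pde_solution g h (\<lambda>t x. \<Phi> c (t + (\<nu> \<bullet> x) / c))) \<and>
        (\<forall>s. \<Phi> c differentiable (at s)) \<and>
        (\<exists>s0. \<exists>M s1. \<forall>s \<le> s1.
            \<bar>\<Phi> c (s - s0) - exp (lam1 (g' 0) h c * s)\<bar> \<le> M * exp (2 * lam (g' 0) h * s) \<and>
            \<bar>deriv (\<Phi> c) (s - s0) - lam1 (g' 0) h c * exp (lam1 (g' 0) h c * s)\<bar>
               \<le> M * exp (2 * lam (g' 0) h * s)) \<and>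
        (\<exists>z. \<forall>s \<le> z. deriv (\<Phi> c) s > 0)"
      using hy(2) lims pde diff asyE dpos by (intro conjI allI impI) (auto simp: Phi)
    show "\<exists>L>0. \<forall>t s. \<bar>\<Psi> (1 / c\<^sup>2) t - \<Psi> (1 / c\<^sup>2) s\<bar> \<le> L * \<bar>t - s\<bar>"
    proof (rule exI[of _ "2 * ka \<epsilon> * C"], intro conjI allI)
      show "2 * ka \<epsilon> * C > 0" using param_bounds(1)[of \<epsilon>] e C by simp
      show "\<bar>\<Psi> (1 / c\<^sup>2) t - \<Psi> (1 / c\<^sup>2) s\<bar> \<le> 2 * ka \<epsilon> * C * \<bar>t - s\<bar>" for t s
        using psi_lipschitz[OF H, of t s] by (simp add: \<epsilon>_def)
    qed
    assume osc: "g' K * h * exp (h + 1) < -1"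
    have neg: "g' K < 0"
    proof (rule ccontr)
      assume "\<not> g' K < 0"
      then have "0 \<le> g' K * h * exp (h + 1)" using h_pos by simp
      then show False using osc by simp
    qed
    have s: "0 < s" "s < 1" and crit: "kA \<epsilon> * (s * \<bar>g' K\<bar>) * exp (ka \<epsilon> * kd \<epsilon>) * (1 - kq \<epsilon> / ((1 - s) * h)) * (kd \<epsilon> - (1 - s) * h) * exp 1 > 1"
      using so(2) osc e by auto
    have s0: "?\<sigma> > 0" using sig by linarith
    have ex: "\<exists>u\<ge>z. sn * (\<Phi> c u - K) < 0" if sn: "sn = 1 \<or> sn = (-1::real)" for sn
    proof -
      obtain t where t: "t \<ge> ?\<sigma> * z" "sn * (\<Psi> \<epsilon> t - K) < 0"
        using oscillation[OF H neg s crit sn, of "?\<sigma> * z"] by blast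
      have "t / ?\<sigma> \<ge> z" using t(1) s0 by (simp add: le_divide_eq mult.commute)
      moreover have "sn * (\<Phi> c (t / ?\<sigma>) - K) < 0" using t(2) s0 by (simp add: Phi)
      ultimately show ?thesis by blast
    qed
    show "(\<exists>s \<ge> z. \<Phi> c s > K) \<and> (\<exists>s \<ge> z. \<Phi> c s < K)"
      using ex[of 1] ex[of "-1"] by (auto simp: algebra_simps)
  qed
  have cont_c: "\<exists>\<delta>>0. \<forall>c'. c' > cstar \<and> \<bar>c' - c\<bar> < \<delta> \<longrightarrow> (\<forall>s. \<bar>\<Phi> c' s - \<Phi> c s\<bar> \<le> \<eta>)"
    if c: "c > cstar" and eta: "\<eta> > 0" for c \<eta>
  proof -
    define \<epsilon> where "\<epsilon> = 1 / c\<^sup>2"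
    have e: "0 \<le> \<epsilon>" "\<epsilon> \<le> eps1" "\<epsilon> \<le> \<epsilon>2" using ceps[OF c] e2 by (auto simp: \<epsilon>_def \<epsilon>3_def)
    have pr: "\<And>t. \<bar>\<Psi> \<epsilon> t - exp (lm * t)\<bar> \<le> C * exp (2 * lm * t)" "\<And>t. \<bar>\<Psi> \<epsilon> t - K\<bar> \<le> C * exp (- decay_rate * t)"
      "\<And>t. \<Psi> \<epsilon> t > 0"
      by (rule prof_facts[OF e(1,3)])+
    obtain L where L: "L > 0" "\<forall>t s. \<bar>\<Psi> \<epsilon> t - \<Psi> \<epsilon> s\<bar> \<le> L * \<bar>t - s\<bar>" using lip_c[OF c] unfolding \<epsilon>_def by blast
    have "((\<lambda>t. exp (lm * t) + C * exp (2 * lm * t)) \<longlongrightarrow> 0) at_bot" using l by real_asymp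
    then have "\<forall>\<^sub>F t in at_bot. exp (lm * t) + C * exp (2 * lm * t) < \<eta> / 4" using eta by (intro order_tendstoD) auto
    then obtain T1 where T1: "\<forall>t\<le>T1. exp (lm * t) + C * exp (2 * lm * t) < \<eta> / 4" unfolding eventually_at_bot_linorder by blast
    have "((\<lambda>t. exp (- \<gamma> * t)) \<longlongrightarrow> 0) at_top" if "\<gamma> > 0" for \<gamma> :: real using that by real_asymp
    from tendsto_mult_right_zero[OF this[OF decay_rate(1)]] have "((\<lambda>t. C * exp (- decay_rate * t)) \<longlongrightarrow> 0) at_top" .
    then have "\<forall>\<^sub>F t in at_top. C * exp (- decay_rate * t) < \<eta> / 4" using eta by (intro order_tendstoD) auto
    then obtain T2 where T2: "\<forall>t\<ge>T2. C * exp (- decay_rate * t) < \<eta> / 4" unfolding eventually_at_top_linorder by blast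
    define S where "S = max 1 (max (- T1) T2)"
    have S: "S \<ge> 1" "- S \<le> T1" "S \<ge> T2" by (auto simp: S_def)
    have left: "\<bar>\<Psi> \<epsilon> t\<bar> \<le> \<eta> / 4" if "t \<le> - S" for t
      using pr(1)[of t] pr(3)[of t] T1[rule_format, of t] that S(2) by linarith
    have right: "\<bar>\<Psi> \<epsilon> t - K\<bar> \<le> \<eta> / 4" if "t \<ge> S" for t
      using pr(2)[of t] T2[rule_format, of t] that S(3) by linarith
    \<comment> \<open>Profiles at nearby speeds also differ by a dilation of time, and a s - b s is
      not small uniformly in s. For |s| \<ge> S both arguments lie in the tails, since a and b are
      at least 1, and there the profile is close to its limit; elsewhere Lipschitz continuity
      suffices.\<close>
    have shear: "\<bar>\<Psi> \<epsilon> (a * s) - \<Psi> \<epsilon> (b * s)\<bar> \<le> \<eta> / 2" if ab: "a \<ge> 1" "b \<ge> 1" "L * (\<bar>a - b\<bar> * S) \<le> \<eta> / 2" for a b s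
    proof -
      consider "s \<ge> S" | "s \<le> - S" | "\<bar>s\<bar> \<le> S" by linarith
      then show ?thesis
      proof cases
        case 1
        have "1 * s \<le> a * s" "1 * s \<le> b * s" using ab 1 S by (intro mult_right_mono, auto)+
        then show ?thesis using right[of "a * s"] right[of "b * s"] 1 by linarith
      next
        case 2
        have "a * s \<le> 1 * s" "b * s \<le> 1 * s" using ab 2 S by (intro mult_right_mono_neg, auto)+
        then show ?thesis using left[of "a * s"] left[of "b * s"] 2 by linarith
      next
        case 3
        have "\<bar>\<Psi> \<epsilon> (a * s) - \<Psi> \<epsilon> (b * s)\<bar> \<le> L * \<bar>a * s - b * s\<bar>" using L(2) by blast
        also have "\<bar>a * s - b * s\<bar> = \<bar>a - b\<bar> * \<bar>s\<bar>" by (simp add: left_diff_distrib[symmetric] abs_mult)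
        also have "L * (\<bar>a - b\<bar> * \<bar>s\<bar>) \<le> L * (\<bar>a - b\<bar> * S)" using 3 L(1) by (intro mult_left_mono) auto
        finally show ?thesis using ab(3) by linarith
      qed
    qed
    have eC: "\<eta> / (2 * C) > 0" using eta C by simp
    obtain d1 where d1: "d1 > 0" "\<forall>\<epsilon>'. 0 \<le> \<epsilon>' \<and> \<epsilon>' \<le> eps1 \<and> \<bar>\<epsilon>' - \<epsilon>\<bar> < d1 \<longrightarrow> kdist \<epsilon>' \<epsilon> < \<eta> / (2 * C)"
      using wave_kernel_knorm_continuous[OF decay_rate(1,2) e(1,2) eC] by blast
    \<comment> \<open>The second entry controls the dilation: \<open>time_scale\<close> has
      Lipschitz constant 8 \<lambda>, so L S times its variation is at most \<eta> / 2.\<close>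
    define d2 where "d2 = min d1 (\<eta> / (2 * L * S * 8 * lm))"
    have d2: "d2 > 0" "d2 \<le> d1" "d2 \<le> \<eta> / (2 * L * S * 8 * lm)" using d1 eta L S l by (auto simp: d2_def)
    have "isCont (\<lambda>c. 1 / c\<^sup>2) c" using ceps(1)[OF c] by (intro continuous_intros) auto
    then obtain \<delta> where d: "\<delta> > 0" "\<forall>c'. dist c' c < \<delta> \<longrightarrow> dist (1 / c'\<^sup>2) (1 / c\<^sup>2) < d2"
      unfolding continuous_at_eps_delta using d2(1) by blast
    have "\<bar>\<Phi> c' s - \<Phi> c s\<bar> \<le> \<eta>" if c': "c' > cstar" "\<bar>c' - c\<bar> < \<delta>" for c' s
    proof -
      define \<epsilon>' where "\<epsilon>' = 1 / c'\<^sup>2"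
      have e': "0 \<le> \<epsilon>'" "\<epsilon>' \<le> eps1" "\<epsilon>' \<le> \<epsilon>2" using ceps[OF c'(1)] e2 by (auto simp: \<epsilon>'_def \<epsilon>3_def)
      have de: "\<bar>\<epsilon>' - \<epsilon>\<bar> < d2" using d(2)[rule_format, of c'] c'(2) by (simp add: dist_real_def \<epsilon>_def \<epsilon>'_def)
      have "kdist \<epsilon>' \<epsilon> < \<eta> / (2 * C)" using d1(2) e' de d2(2) by auto
      then have "C * kdist \<epsilon>' \<epsilon> \<le> C * (\<eta> / (2 * C))" using C by (intro mult_left_mono) auto
      also have "\<dots> = \<eta> / 2" using C by simp
      finally have k: "C * kdist \<epsilon>' \<epsilon> \<le> \<eta> / 2" .
      have "\<bar>\<Psi> \<epsilon>' (time_scale \<epsilon>' * s) - \<Psi> \<epsilon> (time_scale \<epsilon>' * s)\<bar> \<le> C * kdist \<epsilon>' \<epsilon>"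
        by (rule pcont[rule_format], intro conjI) (rule e e')+
      then have 1: "\<bar>\<Psi> \<epsilon>' (time_scale \<epsilon>' * s) - \<Psi> \<epsilon> (time_scale \<epsilon>' * s)\<bar> \<le> \<eta> / 2" using k by (rule order_trans)
      have "\<bar>time_scale \<epsilon>' - time_scale \<epsilon>\<bar> \<le> 8 * lm * \<bar>\<epsilon>' - \<epsilon>\<bar>" by (rule time_scale_lipschitz[OF e'(1,2) e(1,2)])
      also have "\<dots> \<le> 8 * lm * (\<eta> / (2 * L * S * 8 * lm))" using de d2(3) l by (intro mult_left_mono) auto
      also have "\<dots> = \<eta> / (2 * L * S)" using l by simp
      finally have "\<bar>time_scale \<epsilon>' - time_scale \<epsilon>\<bar> * (L * S) \<le> \<eta> / (2 * L * S) * (L * S)" using L S by (intro mult_right_mono) auto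
      also have "\<dots> = \<eta> / 2" using L S by simp
      finally have "L * (\<bar>time_scale \<epsilon>' - time_scale \<epsilon>\<bar> * S) \<le> \<eta> / 2" by (simp only: mult_ac)
      from shear[OF time_scale_bounds(1)[OF e'(1,2)] time_scale_bounds(1)[OF e(1,2)] this, of s]
      have 2: "\<bar>\<Psi> \<epsilon> (time_scale \<epsilon>' * s) - \<Psi> \<epsilon> (time_scale \<epsilon> * s)\<bar> \<le> \<eta> / 2" .
      have "\<Phi> c' s = \<Psi> \<epsilon>' (time_scale \<epsilon>' * s)" "\<Phi> c s = \<Psi> \<epsilon> (time_scale \<epsilon> * s)" by (simp_all add: \<Phi>_def \<epsilon>_def \<epsilon>'_def)
      then show ?thesis using 1 2 by linarith
    qed
    then show ?thesis using d(1) by blast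
  qed
  show ?thesis
  proof (rule exI[of _ cstar], rule conjI[OF cs], rule exI[of _ \<Phi>], intro conjI)
    show "\<forall>c > cstar.
        (\<forall>s. \<Phi> c s > 0) \<and>
        (\<Phi> c \<longlongrightarrow> 0) at_bot \<and> (\<Phi> c \<longlongrightarrow> K) at_top \<and>
        (\<forall>\<nu>::'a::euclidean_space. norm \<nu> = 1 \<longrightarrow>
            pde_solution g h (\<lambda>t x. \<Phi> c (t + (\<nu> \<bullet> x) / c))) \<and>
        (\<forall>s. \<Phi> c differentiable (at s)) \<and>
        (\<exists>s0. \<exists>M s1. \<forall>s \<le> s1.
            \<bar>\<Phi> c (s - s0) - exp (lam1 (g' 0) h c * s)\<bar> \<le> M * exp (2 * lam (g' 0) h * s) \<and>
            \<bar>deriv (\<Phi> c) (s - s0) - lam1 (g' 0) h c * exp (lam1 (g' 0) h c * s)\<bar>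
               \<le> M * exp (2 * lam (g' 0) h * s)) \<and>
        (\<exists>z. \<forall>s \<le> z. deriv (\<Phi> c) s > 0)"
      by (intro allI impI, rule wave_c)
    show "\<forall>c > cstar. \<forall>\<epsilon> > 0. \<exists>\<delta> > 0. \<forall>c'. c' > cstar \<and> \<bar>c' - c\<bar> < \<delta> \<longrightarrow> (\<forall>s. \<bar>\<Phi> c' s - \<Phi> c s\<bar> \<le> \<epsilon>)"
      by (intro allI impI, rule cont_c)
    show "g' K * h * exp (h + 1) < -1 \<longrightarrow> (\<forall>c > cstar. \<forall>z. (\<exists>s \<ge> z. \<Phi> c s > K) \<and> (\<exists>s \<ge> z. \<Phi> c s < K))"
      by (intro impI allI, rule osc_c)
  qed
qed

end

theorem theorem1:
  fixes g g' :: "real \<Rightarrow> real" and h K :: real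
  assumes h_pos: "h > 0"
    and g_nonneg: "\<forall>x\<ge>0. g x \<ge> 0"
    and g_deriv: "\<forall>x\<ge>0. (g has_real_derivative g' x) (at x within {0..})"
    and g'_cont: "continuous_on {0..} g'"
    and C2_0: "C2_near g 0"
    and C2_K: "C2_near g K"
    and K_pos: "K > 0"
    and equilibria: "{a. a \<ge> 0 \<and> g a = a} = {0, K}"
    and K_stable: "exp_asymp_stable g h K"
    and zero_hyp: "hyperbolic_equilibrium g' h 0"
    and p_gt1: "g' 0 > 1"
    and K_glob: "globally_attracting g h K"
  shows "\<exists>cstar > 0. \<exists>\<Phi> :: real \<Rightarrow> real \<Rightarrow> real.
     (\<forall>c > cstar.
        (\<forall>s. \<Phi> c s > 0) \<and>
        (\<Phi> c \<longlongrightarrow> 0) at_bot \<and> (\<Phi> c \<longlongrightarrow> K) at_top \<and>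
        (\<forall>\<nu>::'a::euclidean_space. norm \<nu> = 1 \<longrightarrow>
            pde_solution g h (\<lambda>t x. \<Phi> c (t + (\<nu> \<bullet> x) / c))) \<and>
        (\<forall>s. \<Phi> c differentiable (at s)) \<and>
        (\<exists>s0. \<exists>M s1. \<forall>s \<le> s1.
            \<bar>\<Phi> c (s - s0) - exp (lam1 (g' 0) h c * s)\<bar> \<le> M * exp (2 * lam (g' 0) h * s) \<and>
            \<bar>deriv (\<Phi> c) (s - s0) - lam1 (g' 0) h c * exp (lam1 (g' 0) h c * s)\<bar>
               \<le> M * exp (2 * lam (g' 0) h * s)) \<and>
        (\<exists>z. \<forall>s \<le> z. deriv (\<Phi> c) s > 0)) \<and>
     (\<forall>c > cstar. \<forall>\<epsilon> > 0. \<exists>\<delta> > 0. \<forall>c'. c' > cstar \<and> \<bar>c' - c\<bar> < \<delta> \<longrightarrow>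
        (\<forall>s. \<bar>\<Phi> c' s - \<Phi> c s\<bar> \<le> \<epsilon>)) \<and>
     (g' K * h * exp (h + 1) < -1 \<longrightarrow>
        (\<forall>c > cstar. \<forall>z. (\<exists>s \<ge> z. \<Phi> c s > K) \<and> (\<exists>s \<ge> z. \<Phi> c s < K)))"
proof -
  interpret wave g g' h K
    using assms by unfold_locales auto
  show ?thesis by (rule travelling_waves)
qed

end
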